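(* Let $(M,\pi,\psi)$ be an orientable twisted Poisson manifold. Then the modular class of $(M,\pi,\psi)$ is equal to one half the ELW-modular class of its cotangent bundle Lie algebroid $(T^*M,\pi^\sharp,[~,~]_{\pi,\psi})$.
   Context: Conventions. $(X\wedge Y)(\alpha,\beta)=\alpha(X)\beta(Y)-\alpha(Y)\beta(X)$; $i_{X_1\wedge\dots\wedge X_p}=i_{X_1}\circ\dots\circ i_{X_p}$; for a bivector $\pi$, $\langle\beta,\pi^\sharp\alpha\rangle=\pi(\alpha,\beta)$, so $i_\pi(\alpha\wedge\beta)=-\pi(\alpha,\beta)$; $\wedge^q\pi^\sharp$ maps $\alpha_1\wedge\dots\wedge\alpha_q$ to $\pi^\sharp\alpha_1\wedge\dots\wedge\pi^\sharp\alpha_q$. The Schouten (Gerstenhaber) bracket on multivector fields is the graded biderivation with $[a,f]=a\cdot f$ for vector fields $a$, and $[a_1\wedge\dots\wedge a_q,b_1\wedge\dots\wedge b_r]=\sum_{k,\ell}(-1)^{k+\ell}[a_k,b_\ell]\wedge a_1\wedge\dots\widehat{a_k}\dots\wedge a_q\wedge b_1\wedge\dots\widehat{b_\ell}\dots\wedge b_r$; the bracket of any Lie algebroid $E$ is extended to $\Gamma(\wedge^\bullet E)$ in the same way (with $[a,f]$ given by the anchor). Twisted Poisson manifold. $(M,\pi,\psi)$, with $\pi$ a bivector field and $\psi$ a closed 3-form on $M$ such that $\frac12[\pi,\pi]=(\wedge^3\pi^\sharp)\psi$. Set $\psi^{(2)}(\xi,\eta)(X)=\psi(\pi^\sharp\xi,\pi^\sharp\eta,X)$,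 and for a vector $X$ let $\psi^{(2)}(X)$ be the bivector $(\xi,\eta)\mapsto\psi(\pi^\sharp\xi,\pi^\sharp\eta,X)$. Then $T^*M$ is a Lie algebroid with anchor $\pi^\sharp$ and bracket $[\alpha,\beta]_{\pi,\psi}={\mathcal L}_{\pi^\sharp\alpha}\beta-{\mathcal L}_{\pi^\sharp\beta}\alpha-d(\pi(\alpha,\beta))+\psi^{(2)}(\alpha,\beta)$; its differential on multivector fields is $d_{\pi,\psi}=[\pi,\cdot\,]+\underline d_{\pi,\psi}$, with $\underline d_{\pi,\psi}(X_1\wedge\dots\wedge X_p)=\sum_k(-1)^{k+1}\psi^{(2)}(X_k)\wedge X_1\wedge\dots\widehat{X_k}\dots\wedge X_p$, zero on functions. Modular class. For a volume form $\lambda$ on $M$, let $X_{\pi,\lambda}$ be the vector field with $\langle\alpha,X_{\pi,\lambda}\rangle\lambda={\mathcal L}_{\pi^\sharp\alpha}\lambda-(i_\pi d\alpha)\lambda$ for all 1-forms $\alpha$, and let $Y_{\pi,\psi}$ be the vector field with $\langle\alpha,Y_{\pi,\psi}\rangle=\frac12\mathrm{Tr}\,\Psi_\alpha$, where $\Psi_\alpha$ is the endomorphism $\beta\mapsto\psi^{(2)}(\alpha,\beta)$ of $T^*M$. Then $Z_{\pi,\psi,\lambda}=X_{\pi,\lambda}+Y_{\pi,\psi}$ is a $d_{\pi,\psi}$-cocycle whose class does not depend on $\lambda$; this class is the modular class of $(M,\pi,\psi)$. ELW-modular class (Evens–Lu–Weinstein). A representation $D$ of a Lie algebroid $E$ (anchor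 $\rho$) on a line bundle $L$ is a flat $E$-connection: $D_x$ is $C^\infty(M)$-linear in $x$, $D_x(f\mu)=fD_x\mu+(\rho(x)\cdot f)\mu$, $D_{[x,y]}=[D_x,D_y]$. If $s$ is a nowhere-vanishing section of $L$, its characteristic class is the class of the $d_E$-cocycle $\theta_s\in\Gamma(E^* )$ with $D_xs=\langle\theta_s,x\rangle s$. The ELW-modular class of $E$ (rank $N$, $n=\dim M$) is the characteristic class of the representation on $L^E=\wedge^NE\otimes\wedge^nT^*M$ given by $D^E_x(\omega\otimes\mu)=[x,\omega]_E\otimes\mu+\omega\otimes{\mathcal L}_{\rho(x)}\mu$. *)

theory Defs
  imports
    "HOL-Analysis.Analysis"
    "HOL-Library.Function_Algebras"
    "HOL-Combinatorics.Permutations"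
begin

text \<open>
  Functions carry the pointwise ring operations of \<^theory>\<open>HOL-Library.Function_Algebras\<close>.
  A manifold is a Hausdorff, second countable type with a smooth atlas. Vector fields are the
  derivations of the algebra of smooth functions, tensor fields are multilinear maps over that
  algebra. All of these maps are taken to be \<open>0\<close> outside their domain, so that equality of
  fields is equality of functions.

  The \<open>k\<close> arguments of an alternating map are passed as a list of length \<open>k\<close>; indices count
  from \<open>0\<close>. Since a parity such as that of \<open>k + l\<close> is unchanged if both \<open>k\<close> and \<open>l\<close> are shifted
  by one, most signs below look as they do when one counts from \<open>1\<close>.
\<close>

type_synonym 'm scalar = "'m \<Rightarrow> real"
type_synonym 'm vfield = "'m scalar \<Rightarrow> 'm scalar"
type_synonym 'm form = "'m vfield list \<Rightarrow> 'm scalar"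
type_synonym 'm mvector = "'m form list \<Rightarrow> 'm scalar"

fun Ck_on :: "nat \<Rightarrow> 'a::real_normed_vector set \<Rightarrow> ('a \<Rightarrow> 'b::real_normed_vector) \<Rightarrow> bool" where
  "Ck_on 0 S f \<longleftrightarrow> continuous_on S f"
| "Ck_on (Suc k) S f \<longleftrightarrow>
     f differentiable_on S \<and> (\<forall>v. Ck_on k S (\<lambda>x. frechet_derivative f (at x) v))"

text \<open>Only meant for open \<open>S\<close>.\<close>

definition smooth_on :: "'a::real_normed_vector set \<Rightarrow> ('a \<Rightarrow> 'b::real_normed_vector) \<Rightarrow> bool" where
  "smooth_on S f \<longleftrightarrow> (\<forall>k. Ck_on k S f)"

definition smooth_atlas ::
    "('m::{t2_space,second_countable_topology} set \<times> ('m \<Rightarrow> real^'n)) set \<Rightarrow> bool" where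
  "smooth_atlas \<A> \<longleftrightarrow>
     (\<forall>(U,\<phi>)\<in>\<A>. open U \<and> open (\<phi> ` U) \<and> homeomorphism U (\<phi> ` U) \<phi> (inv_into U \<phi>)) \<and>
     (\<Union>(U,\<phi>)\<in>\<A>. U) = UNIV \<and>
     (\<forall>(U,\<phi>)\<in>\<A>. \<forall>(V,\<phi>')\<in>\<A>. smooth_on (\<phi> ` (U \<inter> V)) (\<phi>' \<circ> inv_into U \<phi>))"

definition fscale :: "'m scalar \<Rightarrow> ('x \<Rightarrow> 'm scalar) \<Rightarrow> 'x \<Rightarrow> 'm scalar" where
  "fscale f v = (\<lambda>x. f * v x)"

definition omit :: "nat \<Rightarrow> 'a list \<Rightarrow> 'a list" where
  "omit k xs = take k xs @ drop (Suc k) xs"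

definition psign :: "nat \<Rightarrow> 'm scalar" where
  "psign k = (\<lambda>p. (-1) ^ k)"

text \<open>
  A vector bundle \<open>E\<close> is given by its sections, the sections of \<open>E\<^sup>*\<close>, their pairing, and its rank.
  Sections of \<open>\<And>\<^sup>q E\<close> are alternating maps on sections of \<open>E\<^sup>*\<close>. Keeping \<open>E\<^sup>*\<close> as separate data
  makes \<open>E\<^sup>* = TM\<close> literally true for \<open>E = T\<^sup>*M\<close>.
\<close>

record ('x, 'y, 'm) vbundle =
  sec :: "('x \<Rightarrow> 'm scalar) set"
  dsec :: "('y \<Rightarrow> 'm scalar) set"
  pairing :: "('x \<Rightarrow> 'm scalar) \<Rightarrow> ('y \<Rightarrow> 'm scalar) \<Rightarrow> 'm scalar"
  rk :: nat

record ('x, 'y, 'm) algebroid = "('x, 'y, 'm) vbundle" +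
  anchor :: "('x \<Rightarrow> 'm scalar) \<Rightarrow> 'm vfield"
  brk :: "('x \<Rightarrow> 'm scalar) \<Rightarrow> ('x \<Rightarrow> 'm scalar) \<Rightarrow> ('x \<Rightarrow> 'm scalar)"

text \<open>\<open>(x\<^sub>1 \<and> \<dots> \<and> x\<^sub>q)(\<xi>\<^sub>1, \<dots>, \<xi>\<^sub>q) = det \<langle>\<xi>\<^sub>j, x\<^sub>i\<rangle>\<close>\<close>

definition wedge ::
    "('x, 'y, 'm, 'z) vbundle_scheme \<Rightarrow> ('x \<Rightarrow> 'm scalar) list \<Rightarrow> ('y \<Rightarrow> 'm scalar) list \<Rightarrow> 'm scalar" where
  "wedge E xs = (\<lambda>\<xi>s. if length \<xi>s = length xs \<and> set \<xi>s \<subseteq> dsec E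
     then (\<lambda>p. \<Sum>\<sigma> | \<sigma> permutes {..<length xs}.
             of_int (sign \<sigma>) * (\<Prod>i<length xs. pairing E (xs ! i) (\<xi>s ! \<sigma> i) p))
     else 0)"

text \<open>
  Near \<open>p\<close>, the section \<open>P\<close> of \<open>\<And>\<^sup>q E\<close> is the sum of the decomposables \<open>x\<^sub>1 \<and> \<dots> \<and> x\<^sub>q\<close>, for
  \<open>[x\<^sub>1, \<dots>, x\<^sub>q]\<close> in the list \<open>xss\<close>. Every \<open>P\<close> has such a decomposition near every point, and
  operators given on decomposables are extended by additivity with its help.
\<close>

definition decomp ::
    "('x, 'y, 'm::topological_space, 'z) vbundle_scheme \<Rightarrow> nat \<Rightarrow> (('y \<Rightarrow> 'm scalar) list \<Rightarrow> 'm scalar)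
      \<Rightarrow> 'm \<Rightarrow> ('x \<Rightarrow> 'm scalar) list list \<Rightarrow> bool" where
  "decomp E q P p xss \<longleftrightarrow>
     (\<forall>xs\<in>set xss. length xs = q \<and> set xs \<subseteq> sec E) \<and>
     (\<exists>U. open U \<and> p \<in> U \<and> (\<forall>y\<in>U. \<forall>\<xi>s. P \<xi>s y = (\<Sum>xs\<leftarrow>xss. wedge E xs \<xi>s y)))"

text \<open>
  The bracket \<open>[P, Q]\<close> of sections of \<open>\<And>\<^sup>q E\<close> and \<open>\<And>\<^sup>r E\<close> for \<open>q, r \<ge> 1\<close>.
\<close>

definition gerst ::
    "('x, 'y, 'm::topological_space) algebroid \<Rightarrow> nat \<Rightarrow> nat
      \<Rightarrow> (('y \<Rightarrow> 'm scalar) list \<Rightarrow> 'm scalar) \<Rightarrow> (('y \<Rightarrow> 'm scalar) list \<Rightarrow> 'm scalar)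
      \<Rightarrow> ('y \<Rightarrow> 'm scalar) list \<Rightarrow> 'm scalar" where
  "gerst E q r P Q = (\<lambda>\<xi>s p. THE c. \<exists>ass bss. decomp E q P p ass \<and> decomp E r Q p bss \<and>
     c = (\<Sum>as\<leftarrow>ass. \<Sum>bs\<leftarrow>bss. \<Sum>k<q. \<Sum>l<r.
            (-1) ^ (k + l) * wedge E (brk E (as ! k) (bs ! l) # omit k as @ omit l bs) \<xi>s p))"

text \<open>
  The bracket \<open>[P, f]\<close> of a section of \<open>\<And>\<^sup>q E\<close>, \<open>q \<ge> 1\<close>, with a function. The Leibniz rule
  \<open>[P \<and> P', f] = P \<and> [P', f] + (-1)\<^sup>q\<^sup>' [P, f] \<and> P'\<close> and \<open>[a, f] = \<rho>(a)\<cdot>f\<close> give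
  \<open>[a\<^sub>1 \<and> \<dots> \<and> a\<^sub>q, f] = \<Sum>\<^sub>k (-1)\<^sup>q\<^sup>-\<^sup>k (\<rho>(a\<^sub>k)\<cdot>f) a\<^sub>1 \<and> \<dots> \<and> a\<^sub>q\<close> with \<open>a\<^sub>k\<close> omitted, \<open>k\<close> counted from
  \<open>1\<close>; for a bivector \<open>\<pi>\<close> on \<open>M\<close> this is \<open>[\<pi>, f] = - \<pi>\<^sup>\<sharp> df\<close>.
\<close>

definition gerst_fun ::
    "('x, 'y, 'm::topological_space) algebroid \<Rightarrow> nat
      \<Rightarrow> (('y \<Rightarrow> 'm scalar) list \<Rightarrow> 'm scalar) \<Rightarrow> 'm scalar
      \<Rightarrow> ('y \<Rightarrow> 'm scalar) list \<Rightarrow> 'm scalar" where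
  "gerst_fun E q P f = (\<lambda>\<xi>s p. THE c. \<exists>ass. decomp E q P p ass \<and>
     c = (\<Sum>as\<leftarrow>ass. \<Sum>k<q.
            (-1) ^ (q - 1 - k) * anchor E (as ! k) f p * wedge E (omit k as) \<xi>s p))"

definition tensor :: "('u \<Rightarrow> 'm scalar) \<Rightarrow> ('w \<Rightarrow> 'm scalar) \<Rightarrow> 'u \<times> 'w \<Rightarrow> 'm scalar" where
  "tensor \<omega> \<mu> = (\<lambda>(u, w). \<omega> u * \<mu> w)"

text \<open>The definitions below make sense when \<^const>\<open>smooth_atlas\<close> holds of \<open>atlas\<close>.\<close>

locale charted =
  fixes atlas :: "('m::{t2_space,second_countable_topology} set \<times> ('m \<Rightarrow> real^'n)) set"
begin

definition smooth_funs :: "'m scalar set" where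
  "smooth_funs = {f. \<forall>(U,\<phi>)\<in>atlas. smooth_on (\<phi> ` U) (f \<circ> inv_into U \<phi>)}"

definition vfields :: "'m vfield set" where
  "vfields = {X.
     (\<forall>f. f \<notin> smooth_funs \<longrightarrow> X f = 0) \<and>
     (\<forall>f\<in>smooth_funs. X f \<in> smooth_funs) \<and>
     (\<forall>f\<in>smooth_funs. \<forall>g\<in>smooth_funs. X (f + g) = X f + X g \<and> X (f * g) = X f * g + f * X g) \<and>
     (\<forall>f\<in>smooth_funs. \<forall>c. X (\<lambda>p. c * f p) = (\<lambda>p. c * X f p))}"

definition alt :: "nat \<Rightarrow> ('x \<Rightarrow> 'm scalar) set \<Rightarrow> (('x \<Rightarrow> 'm scalar) list \<Rightarrow> 'm scalar) set" where
  "alt k D = {\<omega>.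
     (\<forall>xs. \<not> (length xs = k \<and> set xs \<subseteq> D) \<longrightarrow> \<omega> xs = 0) \<and>
     (\<forall>xs. length xs = k \<and> set xs \<subseteq> D \<longrightarrow>
        \<omega> xs \<in> smooth_funs \<and>
        (\<forall>i<k. \<forall>v\<in>D. \<omega> (xs[i := xs ! i + v]) = \<omega> xs + \<omega> (xs[i := v])) \<and>
        (\<forall>i<k. \<forall>f\<in>smooth_funs. \<omega> (xs[i := fscale f (xs ! i)]) = f * \<omega> xs) \<and>
        (\<forall>i<k. \<forall>j<i. xs ! i = xs ! j \<longrightarrow> \<omega> xs = 0))}"

definition forms :: "nat \<Rightarrow> 'm form set" where
  "forms k = alt k vfields"

definition mvectors :: "nat \<Rightarrow> 'm mvector set" where
  "mvectors q = alt q (forms 1)"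

definition vbracket :: "'m vfield \<Rightarrow> 'm vfield \<Rightarrow> 'm vfield" where
  "vbracket X Y = (\<lambda>f. X (Y f) - Y (X f))"

definition form0 :: "'m scalar \<Rightarrow> 'm form" where
  "form0 f = (\<lambda>Xs. if Xs = [] then f else 0)"

definition ext_d :: "'m form \<Rightarrow> 'm form" where
  "ext_d \<omega> = (\<lambda>Xs. if set Xs \<subseteq> vfields
     then (\<Sum>i<length Xs. psign i * (Xs ! i) (\<omega> (omit i Xs)))
        + (\<Sum>j<length Xs. \<Sum>i<j.
             psign (i + j) * \<omega> (vbracket (Xs ! i) (Xs ! j) # omit i (omit j Xs)))
     else 0)"

definition lie_d :: "'m vfield \<Rightarrow> 'm form \<Rightarrow> 'm form" where
  "lie_d X \<omega> = (\<lambda>Ys. if set Ys \<subseteq> vfields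
     then X (\<omega> Ys) - (\<Sum>i<length Ys. \<omega> (Ys[i := vbracket X (Ys ! i)]))
     else 0)"

definition volume_form :: "'m form \<Rightarrow> bool" where
  "volume_form vol \<longleftrightarrow> vol \<in> forms CARD('n) \<and> (\<forall>p. \<exists>Ys. vol Ys p \<noteq> 0)"

definition orientable :: bool where
  "orientable \<longleftrightarrow> (\<exists>vol. volume_form vol)"

definition tangent :: "('m scalar, 'm vfield list, 'm) algebroid" where
  "tangent = \<lparr>sec = vfields, dsec = forms 1, pairing = (\<lambda>X \<alpha>. \<alpha> [X]), rk = CARD('n),
     anchor = (\<lambda>X. X), brk = vbracket\<rparr>"

definition cotangent_bundle :: "('m vfield list, 'm scalar, 'm) vbundle" where
  "cotangent_bundle = \<lparr>sec = forms 1, dsec = vfields, pairing = (\<lambda>\<alpha> X. \<alpha> [X]), rk = CARD('n)\<rparr>"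

text \<open>
  \<open>i\<^sub>P \<omega>\<close> for \<open>P\<close> of degree \<open>q\<close>. As \<open>i\<^bsub>X\<^sub>1 \<and> \<dots> \<and> X\<^sub>q\<^esub> = i\<^bsub>X\<^sub>1\<^esub> \<circ> \<dots> \<circ> i\<^bsub>X\<^sub>q\<^esub>\<close>, the vectors enter \<open>\<omega>\<close> in
  the order \<open>X\<^sub>q, \<dots>, X\<^sub>1\<close>.
\<close>

definition contract :: "nat \<Rightarrow> 'm mvector \<Rightarrow> 'm form \<Rightarrow> 'm form" where
  "contract q P \<omega> = (\<lambda>Ys p. THE c. \<exists>Xss. decomp tangent q P p Xss \<and>
     c = (\<Sum>Xs\<leftarrow>Xss. \<omega> (rev Xs @ Ys) p))"

definition sharp :: "'m mvector \<Rightarrow> 'm form \<Rightarrow> 'm vfield" where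
  "sharp \<pi> \<alpha> = (THE X. X \<in> vfields \<and> (\<forall>\<beta>\<in>forms 1. \<beta> [X] = \<pi> [\<alpha>, \<beta>]))"

definition wedge_sharp :: "nat \<Rightarrow> 'm mvector \<Rightarrow> 'm form \<Rightarrow> 'm mvector" where
  "wedge_sharp q \<pi> \<omega> = (\<lambda>\<xi>s p. THE c. \<exists>\<alpha>ss. decomp cotangent_bundle q \<omega> p \<alpha>ss \<and>
     c = (\<Sum>\<alpha>s\<leftarrow>\<alpha>ss. wedge tangent (map (sharp \<pi>) \<alpha>s) \<xi>s p))"

definition twisted_poisson :: "'m mvector \<Rightarrow> 'm form \<Rightarrow> bool" where
  "twisted_poisson \<pi> \<psi> \<longleftrightarrow> \<pi> \<in> mvectors 2 \<and> \<psi> \<in> forms 3 \<and> ext_d \<psi> = 0 \<and>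
     fscale (\<lambda>_. 1/2) (gerst tangent 2 2 \<pi> \<pi>) = wedge_sharp 3 \<pi> \<psi>"

definition psi2 :: "'m mvector \<Rightarrow> 'm form \<Rightarrow> 'm form \<Rightarrow> 'm form \<Rightarrow> 'm form" where
  "psi2 \<pi> \<psi> \<xi> \<eta> = (\<lambda>Xs. \<psi> (sharp \<pi> \<xi> # sharp \<pi> \<eta> # Xs))"

definition cotangent_bracket :: "'m mvector \<Rightarrow> 'm form \<Rightarrow> 'm form \<Rightarrow> 'm form \<Rightarrow> 'm form" where
  "cotangent_bracket \<pi> \<psi> \<alpha> \<beta> =
     lie_d (sharp \<pi> \<alpha>) \<beta> - lie_d (sharp \<pi> \<beta>) \<alpha> - ext_d (form0 (\<pi> [\<alpha>, \<beta>])) + psi2 \<pi> \<psi> \<alpha> \<beta>"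

definition cotangent_algebroid ::
    "'m mvector \<Rightarrow> 'm form \<Rightarrow> ('m vfield list, 'm scalar, 'm) algebroid" where
  "cotangent_algebroid \<pi> \<psi> = vbundle.extend cotangent_bundle
     (algebroid.fields (sharp \<pi>) (cotangent_bracket \<pi> \<psi>))"

text \<open>The trace at \<open>p\<close> is computed in a basis \<open>\<epsilon>\<close> of \<open>T\<^sup>*\<^sub>pM\<close> and the dual basis \<open>X\<close> of \<open>T\<^sub>pM\<close>.\<close>

definition trace :: "('m form \<Rightarrow> 'm form) \<Rightarrow> 'm scalar" where
  "trace \<Phi> = (\<lambda>p. THE t. \<exists>\<epsilon> X. (\<forall>i::'n. \<epsilon> i \<in> forms 1 \<and> X i \<in> vfields) \<and>
     (\<forall>i j. \<epsilon> i [X j] p = (if i = j then 1 else 0)) \<and>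
     t = (\<Sum>i\<in>UNIV. \<Phi> (\<epsilon> i) [X i] p))"

definition mod_X :: "'m mvector \<Rightarrow> 'm form \<Rightarrow> 'm vfield" where
  "mod_X \<pi> vol = (THE X. X \<in> vfields \<and> (\<forall>\<alpha>\<in>forms 1.
     fscale (\<alpha> [X]) vol = lie_d (sharp \<pi> \<alpha>) vol - fscale (contract 2 \<pi> (ext_d \<alpha>) []) vol))"

definition mod_Y :: "'m mvector \<Rightarrow> 'm form \<Rightarrow> 'm vfield" where
  "mod_Y \<pi> \<psi> = (THE Y. Y \<in> vfields \<and> (\<forall>\<alpha>\<in>forms 1.
     \<alpha> [Y] = (\<lambda>p. 1/2 * trace (psi2 \<pi> \<psi> \<alpha>) p)))"

definition mod_Z :: "'m mvector \<Rightarrow> 'm form \<Rightarrow> 'm form \<Rightarrow> 'm vfield" where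
  "mod_Z \<pi> \<psi> vol = mod_X \<pi> vol + mod_Y \<pi> \<psi>"

text \<open>
  The class of a cocycle in \<open>ker d / im d\<close> is its coset modulo \<open>im d\<close>. On functions
  \<open>d\<^bsub>\<pi>,\<psi>\<^esub> f = [\<pi>, f]\<close>, the term in \<open>\<psi>\<close> being zero there, and \<open>wedge tangent [Y]\<close> is \<open>Y\<close> as a multivector field of degree 1.
\<close>

definition twisted_class :: "'m mvector \<Rightarrow> 'm vfield \<Rightarrow> 'm vfield set" where
  "twisted_class \<pi> Z = {Y \<in> vfields. \<exists>f\<in>smooth_funs.
     wedge tangent [Y] = wedge tangent [Z] + gerst_fun tangent 2 \<pi> f}"

definition modular_class :: "'m mvector \<Rightarrow> 'm form \<Rightarrow> 'm vfield set" where
  "modular_class \<pi> \<psi> = (THE C. \<exists>vol. volume_form vol \<and> C = twisted_class \<pi> (mod_Z \<pi> \<psi> vol))"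

text \<open>Likewise for a Lie algebroid \<open>E\<close>, where \<open>\<langle>d\<^sub>E f, x\<rangle> = \<rho>(x)\<cdot>f\<close>.\<close>

definition algebroid_class ::
    "('x, 'y, 'm) algebroid \<Rightarrow> ('y \<Rightarrow> 'm scalar) \<Rightarrow> ('y \<Rightarrow> 'm scalar) set" where
  "algebroid_class E \<theta> = {\<eta> \<in> dsec E. \<exists>f\<in>smooth_funs. \<forall>x\<in>sec E.
     pairing E x \<eta> = pairing E x \<theta> + anchor E x f}"

text \<open>
  Sections of \<open>L\<^sup>E = \<And>\<^sup>N E \<otimes> \<And>\<^sup>n T\<^sup>*M\<close>, as maps that are alternating in each of the two groups of
  arguments. The operator \<open>D\<^sup>E\<^sub>x\<close> is given on sections \<open>\<omega> \<otimes> \<mu>\<close> and extended by additivity; its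
  definition requires the rank \<open>N\<close> of \<open>E\<close> to be positive.
\<close>

definition elw_sections ::
    "('x, 'y, 'm) algebroid \<Rightarrow> (('y \<Rightarrow> 'm scalar) list \<times> 'm vfield list \<Rightarrow> 'm scalar) set" where
  "elw_sections E = {s.
     (\<forall>Ys. (\<lambda>\<xi>s. s (\<xi>s, Ys)) \<in> alt (rk E) (dsec E)) \<and>
     (\<forall>\<xi>s. (\<lambda>Ys. s (\<xi>s, Ys)) \<in> forms CARD('n))}"

definition elw_D ::
    "('x, 'y, 'm) algebroid \<Rightarrow> ('x \<Rightarrow> 'm scalar)
      \<Rightarrow> (('y \<Rightarrow> 'm scalar) list \<times> 'm vfield list \<Rightarrow> 'm scalar)
      \<Rightarrow> ('y \<Rightarrow> 'm scalar) list \<times> 'm vfield list \<Rightarrow> 'm scalar" where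
  "elw_D E x s = (\<lambda>z p. THE c. \<exists>ts.
     (\<forall>(\<omega>,\<mu>)\<in>set ts. \<omega> \<in> alt (rk E) (dsec E) \<and> \<mu> \<in> forms CARD('n)) \<and>
     (\<exists>U. open U \<and> p \<in> U \<and> (\<forall>y\<in>U. \<forall>w. s w y = (\<Sum>(\<omega>,\<mu>)\<leftarrow>ts. tensor \<omega> \<mu> w y))) \<and>
     c = (\<Sum>(\<omega>,\<mu>)\<leftarrow>ts. tensor (gerst E 1 (rk E) (wedge E [x]) \<omega>) \<mu> z p
                       + tensor \<omega> (lie_d (anchor E x) \<mu>) z p))"

definition elw_theta ::
    "('x, 'y, 'm) algebroid \<Rightarrow> (('y \<Rightarrow> 'm scalar) list \<times> 'm vfield list \<Rightarrow> 'm scalar)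
      \<Rightarrow> 'y \<Rightarrow> 'm scalar" where
  "elw_theta E s = (THE \<theta>. \<theta> \<in> dsec E \<and> (\<forall>x\<in>sec E. elw_D E x s = fscale (pairing E x \<theta>) s))"

definition elw_modular_class :: "('x, 'y, 'm) algebroid \<Rightarrow> ('y \<Rightarrow> 'm scalar) set" where
  "elw_modular_class E = (THE C. \<exists>s. s \<in> elw_sections E \<and> (\<forall>p. \<exists>z. s z p \<noteq> 0) \<and>
     C = algebroid_class E (elw_theta E s))"

end

text \<open>A scalar multiple \<open>c C\<close>, \<open>c \<noteq> 0\<close>, of a class: multiply all representatives.\<close>

definition class_scale :: "real \<Rightarrow> ('y \<Rightarrow> 'm scalar) set \<Rightarrow> ('y \<Rightarrow> 'm scalar) set" where
  "class_scale c C = fscale (\<lambda>_. c) ` C"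

end

theory Submission
  imports Defs
begin

text \<open>
  Since \<open>L\<^bsub>\<pi>\<^sup>\<sharp>\<beta>\<^esub> \<alpha> = i\<^bsub>\<pi>\<^sup>\<sharp>\<beta>\<^esub> d\<alpha> - d(\<pi>(\<alpha>, \<beta>))\<close>, the bracket of \<open>T\<^sup>*M\<close> is
  \<open>[\<alpha>, \<beta>] = L\<^bsub>\<pi>\<^sup>\<sharp>\<alpha>\<^esub> \<beta> - i\<^bsub>\<pi>\<^sup>\<sharp>\<beta>\<^esub> d\<alpha> + \<Psi>\<^sub>\<alpha> \<beta>\<close>, a Lie derivative up to an endomorphism of \<open>T\<^sup>*M\<close>. The
  trace of \<open>\<beta> \<mapsto> i\<^bsub>\<pi>\<^sup>\<sharp>\<beta>\<^esub> d\<alpha>\<close> is \<open>2 i\<^sub>\<pi> d\<alpha>\<close>. Hence on a volume form \<open>\<lambda>\<close>, regarded as a section of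
  \<open>\<And>\<^sup>n T\<^sup>*M\<close>, \<open>[\<alpha>, \<lambda>] = L\<^bsub>\<pi>\<^sup>\<sharp>\<alpha>\<^esub> \<lambda> + (Tr \<Psi>\<^sub>\<alpha> - 2 i\<^sub>\<pi> d\<alpha>) \<lambda>\<close>, and
  \<open>D\<^sub>\<alpha> (\<lambda> \<otimes> \<lambda>) = [\<alpha>, \<lambda>] \<otimes> \<lambda> + \<lambda> \<otimes> L\<^bsub>\<pi>\<^sup>\<sharp>\<alpha>\<^esub> \<lambda> = 2 \<langle>\<alpha>, X + Y\<rangle> \<lambda> \<otimes> \<lambda>\<close>.

  Every section of the line bundle is \<open>g \<lambda> \<otimes> \<lambda>\<close> for a function \<open>g\<close>. If \<open>g\<close> has no zeros, replacing
  \<open>\<lambda>\<close> by \<open>g \<lambda>\<close> in either construction changes the cocycle by the differential of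
  \<open>1/2 ln (g\<^sup>2)\<close>.

  All operators are local and all tensors are determined by their values on frames. For vector
  fields as derivations of the global smooth functions, both facts come from bump functions and
  Hadamard's lemma.
\<close>

section \<open>Smooth functions on open sets\<close>

text \<open>Most objects of the statement are definite descriptions: brackets, contractions and
  \<open>elw_D\<close> range over all local decompositions, traces over all dual bases, classes over
  all volume forms or sections. Each must be shown to have exactly one value. The pattern is to
  exhibit one decomposition and to evaluate the sum over an arbitrary one to an expression in which
  it no longer occurs. To obtain such expressions, the bracket with \<alpha> is transposed to an
  operator \<open>dual_lie\<close> on vector fields; the bracket of \<alpha> with an n-form is then
  an action \<open>dact\<close> of the same kind as a Lie derivative. Sections of the top exterior
  power of T*M are literally n-forms, so both factors of the line bundle are compared with one
  volume form. The two actions have the same symbol, so they differ by an endomorphism of TM, which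
  acts on n-forms as minus its trace. The factor 2 arises three times: the divergence appears once
  per tensor factor, a trace counts each pair of indices twice where i_\<pi> counts it once, and Y
  is defined with a half.\<close>

lemma Ck_on_cong:
  assumes "open S" and "\<And>x. x \<in> S \<Longrightarrow> f x = g x"
  shows "Ck_on k S f \<longleftrightarrow> Ck_on k S g"
  using assms(2)
proof (induction k arbitrary: f g)
  case 0
  then show ?case by (simp cong: continuous_on_cong)
next
  case (Suc k)
  have "f differentiable_on S \<longleftrightarrow> g differentiable_on S"
    unfolding differentiable_on_def differentiable_def
    using has_derivative_transform Suc.prems by metis
  moreover have "frechet_derivative f (at x) v = frechet_derivative g (at x) v"
    if "f differentiable_on S" "x \<in> S" for x v
  proof -
    have "f differentiable at x"
      using that assms(1) by (simp add: differentiable_on_eq_differentiable_at)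
    then show ?thesis
      using frechet_derivative_transform_within_open[OF _ assms(1) that(2)] Suc.prems by metis
  qed
  ultimately show ?case
    using Suc.IH[of "\<lambda>x. frechet_derivative f (at x) v" "\<lambda>x. frechet_derivative g (at x) v" for v]
    by auto
qed

text \<open>\<open>frechet_derivative\<close> is a choice; on an open set the derivative is unique,
  so any explicit formula f' may stand in for it. Most inductions on the order k below go through
  this rule.\<close>

lemma Ck_on_SucI:
  assumes "open S" "\<And>x. x \<in> S \<Longrightarrow> (f has_derivative f' x) (at x)" "\<And>v. Ck_on k S (\<lambda>x. f' x v)"
  shows "Ck_on (Suc k) S f"
proof -
  have "f differentiable_on S"
    using assms(1,2) by (auto simp: differentiable_on_eq_differentiable_at differentiable_def)
  moreover have "Ck_on k S (\<lambda>x. frechet_derivative f (at x) v)" for v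
    using assms(3)[of v]
    by (subst Ck_on_cong[OF assms(1), where g = "\<lambda>x. f' x v"])
       (simp_all add: frechet_derivative_at[OF assms(2), symmetric])
  ultimately show ?thesis by simp
qed

lemma Ck_on_has_derivative:
  assumes "open S" "Ck_on (Suc k) S f" "x \<in> S"
  shows "(f has_derivative frechet_derivative f (at x)) (at x)"
  using assms by (auto simp: differentiable_on_eq_differentiable_at frechet_derivative_works)

lemma Ck_on_Suc_imp: "Ck_on (Suc k) S f \<Longrightarrow> Ck_on k S f"
proof (induction k arbitrary: f)
  case 0
  then show ?case by (simp add: differentiable_imp_continuous_on)
next
  case (Suc k)
  then show ?case by (metis Ck_on.simps(2))
qed

lemma Ck_on_subset: "Ck_on k S f \<Longrightarrow> T \<subseteq> S \<Longrightarrow> Ck_on k T f"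
  by (induction k arbitrary: f) (auto intro: continuous_on_subset differentiable_on_subset)

text \<open>Derivatives are taken at x and not within S, so each order of differentiability is a
  local matter.\<close>

lemma Ck_on_local:
  assumes "\<And>x. x \<in> S \<Longrightarrow> \<exists>T. open T \<and> x \<in> T \<and> Ck_on k T f"
  shows "Ck_on k S f"
  using assms
proof (induction k arbitrary: f)
  case 0
  then show ?case
    by (metis Ck_on.simps(1) continuous_at_imp_continuous_on continuous_on_eq_continuous_at)
next
  case (Suc k)
  have "f differentiable_on S"
    unfolding differentiable_on_def
    by (metis Ck_on.simps(2) Suc.prems differentiable_at_withinI differentiable_on_eq_differentiable_at)
  moreover have "Ck_on k S (\<lambda>x. frechet_derivative f (at x) v)" for v
    using Suc.prems by (intro Suc.IH) (metis Ck_on.simps(2))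
  ultimately show ?case by simp
qed

lemma Ck_on_const: "open S \<Longrightarrow> Ck_on k S (\<lambda>x. c)"
  by (induction k arbitrary: c) simp_all

lemma Ck_on_bounded_linear:
  assumes "open S" "bounded_linear L"
  shows "Ck_on k S L"
proof (cases k)
  case 0
  then show ?thesis using assms by (simp add: linear_continuous_on)
next
  case (Suc l)
  show ?thesis unfolding Suc
    by (rule Ck_on_SucI[where f' = "\<lambda>_. L"])
       (use assms in \<open>auto intro: bounded_linear_imp_has_derivative Ck_on_const\<close>)
qed

lemma Ck_on_bounded_linear_compose:
  assumes "open S" "bounded_linear L" "Ck_on k S f"
  shows "Ck_on k S (\<lambda>x. L (f x))"
  using assms(3)
proof (induction k arbitrary: f)
  case 0
  then show ?case using assms(2) by (simp add: bounded_linear.continuous_on)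
next
  case (Suc k)
  show ?case
  proof (rule Ck_on_SucI[OF assms(1)])
    show "((\<lambda>x. L (f x)) has_derivative (\<lambda>v. L (frechet_derivative f (at x) v))) (at x)"
      if "x \<in> S" for x
      using bounded_linear.has_derivative[OF assms(2) Ck_on_has_derivative[OF assms(1) Suc.prems that]] .
    show "Ck_on k S (\<lambda>x. L (frechet_derivative f (at x) v))" for v
      using Suc by simp
  qed
qed

lemma Ck_on_add:
  assumes "open S" "Ck_on k S f" "Ck_on k S g"
  shows "Ck_on k S (\<lambda>x. f x + g x)"
  using assms(2,3)
proof (induction k arbitrary: f g)
  case 0
  then show ?case by (simp add: continuous_on_add)
next
  case (Suc k)
  show ?case
    by (rule Ck_on_SucI[OF assms(1) has_derivative_add[OF
          Ck_on_has_derivative[OF assms(1) Suc.prems(1)] Ck_on_has_derivative[OF assms(1) Suc.prems(2)]]])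
       (use Suc in auto)
qed

lemma Ck_on_mult:
  fixes f g :: "'a::real_normed_vector \<Rightarrow> real"
  assumes "open S" "Ck_on k S f" "Ck_on k S g"
  shows "Ck_on k S (\<lambda>x. f x * g x)"
  using assms(2,3)
proof (induction k arbitrary: f g)
  case 0
  then show ?case by (simp add: continuous_on_mult)
next
  case (Suc k)
  have "Ck_on k S f" "Ck_on k S g"
    using Suc.prems Ck_on_Suc_imp by blast+
  then show ?case
    by (intro Ck_on_SucI[OF assms(1) has_derivative_mult[OF
          Ck_on_has_derivative[OF assms(1) Suc.prems(1)] Ck_on_has_derivative[OF assms(1) Suc.prems(2)]]])
       (use Suc in \<open>auto intro!: Ck_on_add[OF assms(1)]\<close>)
qed

lemma Ck_on_sum:
  assumes "open S" "\<And>i. i \<in> I \<Longrightarrow> Ck_on k S (f i)"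
  shows "Ck_on k S (\<lambda>x. \<Sum>i\<in>I. f i x)"
  using assms(2)
  by (induction I rule: infinite_finite_induct) (auto intro: Ck_on_const Ck_on_add assms(1))

lemma Ck_on_inverse:
  fixes f :: "'a::real_normed_vector \<Rightarrow> real"
  assumes "open S" "\<And>x. x \<in> S \<Longrightarrow> f x \<noteq> 0" "Ck_on k S f"
  shows "Ck_on k S (\<lambda>x. inverse (f x))"
  using assms(3)
proof (induction k)
  case 0
  then show ?case using assms(2) by (simp add: continuous_on_inverse)
next
  case (Suc k)
  \<comment> \<open>The derivative of 1/f contains 1/f again; the induction hypothesis supplies this
    factor one order lower, which is enough.\<close>
  have 1: "Ck_on k S (\<lambda>x. inverse (f x))"
    using Suc Ck_on_Suc_imp by blast
  show ?case
  proof (rule Ck_on_SucI[OF assms(1)])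
    show "((\<lambda>x. inverse (f x)) has_derivative
        (\<lambda>v. (-1) * (inverse (f x) * frechet_derivative f (at x) v * inverse (f x)))) (at x)" if "x \<in> S" for x
      using Deriv.has_derivative_inverse[OF assms(2)[OF that] Ck_on_has_derivative[OF assms(1) Suc.prems that]]
      by simp
    show "Ck_on k S (\<lambda>x. (-1) * (inverse (f x) * frechet_derivative f (at x) v * inverse (f x)))" for v
      using Suc.prems 1 by (intro Ck_on_mult Ck_on_const assms(1)) auto
  qed
qed

lemma Ck_on_compose:
  fixes f :: "real^'n \<Rightarrow> real^'m" and g :: "real^'m \<Rightarrow> real"
  assumes "open S" "open T" "f ` S \<subseteq> T" "Ck_on k S f" "Ck_on k T g"
  shows "Ck_on k S (\<lambda>x. g (f x))"
  using assms(4,5)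
proof (induction k arbitrary: g)
  case 0
  then show ?case using assms(3) by (auto intro: continuous_on_compose2)
next
  case (Suc k)
  let ?f' = "\<lambda>x. frechet_derivative f (at x)" and ?g' = "\<lambda>y. frechet_derivative g (at y)"
  have f: "Ck_on k S f" using Suc.prems Ck_on_Suc_imp by blast
  show ?case
  proof (rule Ck_on_SucI[OF assms(1)])
    fix x assume x: "x \<in> S"
    have g': "(g has_derivative ?g' (f x)) (at (f x))"
      using Ck_on_has_derivative[OF assms(2) Suc.prems(2)] x assms(3) by blast
    have "((\<lambda>x. g (f x)) has_derivative (\<lambda>v. ?g' (f x) (?f' x v))) (at x)"
      using has_derivative_compose[OF Ck_on_has_derivative[OF assms(1) Suc.prems(1) x] g'] .
    \<comment> \<open>In the chain rule both the base point and the direction depend on x, while the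
      induction hypothesis treats a fixed direction. Expanding in the standard basis leaves the
      fixed directions \<open>axis i 1\<close>.\<close>
    also have "(\<lambda>v. ?g' (f x) (?f' x v)) = (\<lambda>v. \<Sum>i\<in>UNIV. ?f' x v $ i * ?g' (f x) (axis i 1))"
    proof
      fix v
      have "?g' (f x) (?f' x v) = ?g' (f x) (\<Sum>i\<in>UNIV. ?f' x v $ i *\<^sub>R axis i 1)"
        by (simp add: basis_expansion scalar_mult_eq_scaleR[symmetric])
      also have "\<dots> = (\<Sum>i\<in>UNIV. ?f' x v $ i * ?g' (f x) (axis i 1))"
        using has_derivative_linear[OF g'] by (simp add: linear_sum linear_cmul o_def)
      finally show "?g' (f x) (?f' x v) = (\<Sum>i\<in>UNIV. ?f' x v $ i * ?g' (f x) (axis i 1))" .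
    qed
    finally show "((\<lambda>x. g (f x)) has_derivative
        (\<lambda>v. \<Sum>i\<in>UNIV. ?f' x v $ i * ?g' (f x) (axis i 1))) (at x)" .
  next
    fix v
    show "Ck_on k S (\<lambda>x. \<Sum>i\<in>UNIV. ?f' x v $ i * ?g' (f x) (axis i 1))"
    proof (intro Ck_on_sum Ck_on_mult assms(1))
      show "Ck_on k S (\<lambda>x. ?f' x v $ i)" for i
        using Suc.prems by (intro Ck_on_bounded_linear_compose[OF assms(1) bounded_linear_vec_nth]) simp
      show "Ck_on k S (\<lambda>x. ?g' (f x) (axis i 1))" for i
        using Suc.prems by (intro Suc.IH f) simp
    qed
  qed
qed

lemma smooth_on_cong:
  "open S \<Longrightarrow> (\<And>x. x \<in> S \<Longrightarrow> f x = g x) \<Longrightarrow> smooth_on S f \<longleftrightarrow> smooth_on S g"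
  unfolding smooth_on_def using Ck_on_cong[of S f g] by blast

lemma smooth_on_subset: "smooth_on S f \<Longrightarrow> T \<subseteq> S \<Longrightarrow> smooth_on T f"
  unfolding smooth_on_def using Ck_on_subset by blast

lemma smooth_on_local:
  assumes "\<And>x. x \<in> S \<Longrightarrow> \<exists>T. open T \<and> x \<in> T \<and> smooth_on T f"
  shows "smooth_on S f"
  unfolding smooth_on_def by (intro allI Ck_on_local) (metis assms smooth_on_def)

lemma smooth_on_const: "open S \<Longrightarrow> smooth_on S (\<lambda>x. c)"
  unfolding smooth_on_def using Ck_on_const by blast

lemma smooth_on_bounded_linear: "open S \<Longrightarrow> bounded_linear L \<Longrightarrow> smooth_on S L"
  unfolding smooth_on_def using Ck_on_bounded_linear by blast

lemma smooth_on_add: "open S \<Longrightarrow> smooth_on S f \<Longrightarrow> smooth_on S g \<Longrightarrow> smooth_on S (\<lambda>x. f x + g x)"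
  unfolding smooth_on_def using Ck_on_add by blast

lemma smooth_on_mult:
  fixes f g :: "'a::real_normed_vector \<Rightarrow> real"
  shows "open S \<Longrightarrow> smooth_on S f \<Longrightarrow> smooth_on S g \<Longrightarrow> smooth_on S (\<lambda>x. f x * g x)"
  unfolding smooth_on_def using Ck_on_mult by blast

lemma smooth_on_diff:
  fixes f g :: "'a::real_normed_vector \<Rightarrow> real"
  assumes "open S" "smooth_on S f" "smooth_on S g"
  shows "smooth_on S (\<lambda>x. f x - g x)"
  using smooth_on_add[OF assms(1,2) smooth_on_mult[OF assms(1) smooth_on_const[OF assms(1), of "-1"] assms(3)]]
  by simp

lemma smooth_on_inverse:
  fixes f :: "'a::real_normed_vector \<Rightarrow> real"
  shows "open S \<Longrightarrow> (\<And>x. x \<in> S \<Longrightarrow> f x \<noteq> 0) \<Longrightarrow> smooth_on S f \<Longrightarrow> smooth_on S (\<lambda>x. inverse (f x))"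
  unfolding smooth_on_def using Ck_on_inverse[of S f] by blast

lemma smooth_on_compose:
  fixes f :: "real^'n \<Rightarrow> real^'m" and g :: "real^'m \<Rightarrow> real"
  assumes "open S" "open T" "f ` S \<subseteq> T" "smooth_on S f" "smooth_on T g"
  shows "smooth_on S (\<lambda>x. g (f x))"
  using Ck_on_compose[OF assms(1-3)] assms(4,5) unfolding smooth_on_def by blast

lemma smooth_on_frechet_derivative:
  "smooth_on S f \<Longrightarrow> smooth_on S (\<lambda>x. frechet_derivative f (at x) v)"
  unfolding smooth_on_def by (metis Ck_on.simps(2))

lemma smooth_on_has_derivative:
  assumes "open S" "smooth_on S f" "x \<in> S"
  shows "(f has_derivative frechet_derivative f (at x)) (at x)"
  using assms Ck_on_has_derivative unfolding smooth_on_def by blast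

text \<open>Spares an induction on the order when the derivative is an expression in functions
  already known to be smooth.\<close>

lemma smooth_onI_derivative:
  assumes "open S" "\<And>x. x \<in> S \<Longrightarrow> (f has_derivative f' x) (at x)" "\<And>v. smooth_on S (\<lambda>x. f' x v)"
  shows "smooth_on S f"
proof -
  have "Ck_on (Suc k) S f" for k
    using Ck_on_SucI[OF assms(1,2)] assms(3) unfolding smooth_on_def by blast
  then show ?thesis unfolding smooth_on_def using Ck_on_Suc_imp by blast
qed

lemma smooth_on_ln:
  fixes f :: "'a::real_normed_vector \<Rightarrow> real"
  assumes "open S" "\<And>x. x \<in> S \<Longrightarrow> f x > 0" "smooth_on S f"
  shows "smooth_on S (\<lambda>x. ln (f x))"
proof (rule smooth_onI_derivative[OF assms(1)])
  show "((\<lambda>x. ln (f x)) has_derivative (\<lambda>v. frechet_derivative f (at x) v * inverse (f x))) (at x)"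
    if "x \<in> S" for x
    using has_derivative_ln[OF assms(2)[OF that] smooth_on_has_derivative[OF assms(1,3) that]] .
  show "smooth_on S (\<lambda>x. frechet_derivative f (at x) v * inverse (f x))" for v
    using assms by (intro smooth_on_mult smooth_on_inverse smooth_on_frechet_derivative) force+
qed

text \<open>Bump functions are made from n = 0 alone. The powers of 1/x make the family closed under
  differentiation, so that one induction on the order, for all n at once, proves smoothness.\<close>

definition flat :: "nat \<Rightarrow> real \<Rightarrow> real" where
  "flat n x = (if 0 < x then exp (- inverse x) * inverse x ^ n else 0)"

lemma flat_tendsto_0: "(flat n \<longlongrightarrow> 0) (at 0)"
proof -
  \<comment> \<open>Substituting y = 1/x gives y^n / exp y at infinity.\<close>
  have "((\<lambda>x. inverse x ^ n / exp (inverse x)) \<longlongrightarrow> 0) (at_right (0::real))"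
    using filterlim_compose[OF tendsto_power_div_exp_0 filterlim_inverse_at_top_right] .
  moreover have "\<forall>\<^sub>F x in at_right 0. inverse x ^ n / exp (inverse x) = flat n x"
    by (auto simp: eventually_at_filter flat_def exp_minus divide_inverse mult.commute)
  ultimately have "(flat n \<longlongrightarrow> 0) (at_right 0)"
    by (rule Lim_transform_eventually)
  moreover have "(flat n \<longlongrightarrow> 0) (at_left 0)"
    by (rule Lim_transform_eventually[OF tendsto_const]) (auto simp: eventually_at_filter flat_def)
  ultimately show ?thesis by (simp add: filterlim_at_split)
qed

lemma flat_has_derivative:
  "(flat n has_real_derivative (flat (n + 2) x - real n * flat (n + 1) x)) (at x)"
proof -
  consider "x > 0" | "x < 0" | "x = 0" by linarith
  then show ?thesis
  proof cases
    case 1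
    have "((\<lambda>x. exp (- inverse x) * inverse x ^ n) has_real_derivative
        (flat (n + 2) x - real n * flat (n + 1) x)) (at x)"
    proof (cases n)
      case 0
      show ?thesis unfolding 0 using 1
        by (auto intro!: derivative_eq_intros simp: flat_def power2_eq_square)
    next
      case (Suc m)
      \<comment> \<open>The power rule produces the exponent m - 1, truncated at 0; for m = 0 the
        term has the factor m and disappears.\<close>
      have "m = 0 \<or> inverse x ^ m = inverse x * inverse x ^ (m - Suc 0)" by (cases m) auto
      then show ?thesis unfolding Suc using 1
        by (auto intro!: derivative_eq_intros simp: flat_def power2_eq_square algebra_simps)
    qed
    then show ?thesis
      by (rule has_field_derivative_transform_within_open[of _ _ _ "{0<..}"]) (use 1 in \<open>auto simp: flat_def\<close>)
  next
    case 2
    have "((\<lambda>x. 0) has_real_derivative (flat (n + 2) x - real n * flat (n + 1) x)) (at x)"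
      using 2 by (simp add: flat_def)
    then show ?thesis
      by (rule has_field_derivative_transform_within_open[of _ _ _ "{..<0}"]) (use 2 in \<open>auto simp: flat_def\<close>)
  next
    case 3
    \<comment> \<open>The difference quotient of \<open>flat n\<close> at 0 is
      \<open>flat (Suc n)\<close>, which tends to 0.\<close>
    have "((\<lambda>h. (flat n (0 + h) - flat n 0) / h) \<longlongrightarrow> 0) (at 0)"
      by (rule Lim_transform_eventually[OF flat_tendsto_0[of "Suc n"]])
         (auto simp: eventually_at_filter flat_def divide_inverse)
    then show ?thesis
      unfolding 3 has_field_derivative_def[symmetric] DERIV_def by (simp add: flat_def)
  qed
qed

lemma Ck_on_flat:
  assumes "open S" "Ck_on k S q"
  shows "Ck_on k S (\<lambda>x. flat n (q x))"
  using assms(2)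
proof (induction k arbitrary: n)
  case 0
  have "continuous_on UNIV (flat n)"
    using flat_has_derivative DERIV_isCont by (blast intro: continuous_at_imp_continuous_on)
  with 0 show ?case using continuous_on_compose2[of UNIV "flat n" S q] by simp
next
  case (Suc k)
  have q: "Ck_on k S q" using Suc.prems Ck_on_Suc_imp by blast
  show ?case
  proof (rule Ck_on_SucI[OF assms(1)])
    fix x assume "x \<in> S"
    then have "(q has_derivative frechet_derivative q (at x)) (at x)"
      using Ck_on_has_derivative[OF assms(1) Suc.prems] by blast
    from has_derivative_compose[OF this flat_has_derivative[of n, unfolded has_field_derivative_def]]
    show "((\<lambda>x. flat n (q x)) has_derivative (\<lambda>v. (flat (n + 2) (q x) + (- real n) * flat (n + 1) (q x))
        * frechet_derivative q (at x) v)) (at x)" by simp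
  next
    fix v
    show "Ck_on k S (\<lambda>x. (flat (n + 2) (q x) + (- real n) * flat (n + 1) (q x)) * frechet_derivative q (at x) v)"
      using Suc.prems by (intro Ck_on_mult Ck_on_add Ck_on_const assms(1) Suc.IH q) auto
  qed
qed

lemma smooth_on_flat: "open S \<Longrightarrow> smooth_on S q \<Longrightarrow> smooth_on S (\<lambda>x. flat n (q x))"
  unfolding smooth_on_def using Ck_on_flat by blast

lemma smooth_on_dist_sq:
  fixes c :: "'a::real_inner"
  shows "smooth_on UNIV (\<lambda>x. (x - c) \<bullet> (x - c))"
proof (rule smooth_onI_derivative[OF open_UNIV])
  show "((\<lambda>x. (x - c) \<bullet> (x - c)) has_derivative (\<lambda>v. 2 * (x \<bullet> v) + (- 2) * (c \<bullet> v))) (at x)" for x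
    by (auto intro!: derivative_eq_intros simp: inner_diff_left inner_diff_right inner_commute algebra_simps)
  show "smooth_on UNIV (\<lambda>x. 2 * (x \<bullet> v) + (- 2) * (c \<bullet> v))" for v
    by (intro smooth_on_add smooth_on_mult smooth_on_const smooth_on_bounded_linear
          bounded_linear_inner_left open_UNIV)
qed

text \<open>With u positive exactly inside radius r and w positive exactly outside radius r', the
  denominator of u / (u + w) has no zeros because r' < r.\<close>

lemma exists_bump_euclidean:
  fixes c :: "'a::real_inner"
  assumes "0 < r'" "r' < r"
  obtains b :: "'a \<Rightarrow> real" where "smooth_on UNIV b"
    "\<And>x. x \<in> cball c r' \<Longrightarrow> b x = 1" "\<And>x. x \<notin> ball c r \<Longrightarrow> b x = 0"
proof
  define n where "n = (\<lambda>x. (x - c) \<bullet> (x - c))"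
  define u where "u = (\<lambda>x. flat 0 (r\<^sup>2 - n x))"
  define w where "w = (\<lambda>x. flat 0 (n x - r'\<^sup>2))"
  let ?b = "\<lambda>x. u x * inverse (u x + w x)"
  have n: "n x = (dist c x)\<^sup>2" for x
    by (simp add: n_def dist_norm power2_norm_eq_inner[symmetric] norm_minus_commute)
  have lt: "r'\<^sup>2 < r\<^sup>2" using assms by (simp add: power_strict_mono)
  have nz: "u x + w x \<noteq> 0" for x
    using lt by (auto simp: u_def w_def flat_def add_pos_pos less_imp_neq[symmetric])
  show "smooth_on UNIV ?b"
    using nz unfolding u_def w_def n_def
    by (intro smooth_on_mult smooth_on_inverse smooth_on_add smooth_on_flat smooth_on_diff
        smooth_on_const smooth_on_dist_sq open_UNIV) auto
  show "?b x = 1" if "x \<in> cball c r'" for x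
  proof -
    have "n x \<le> r'\<^sup>2" using that unfolding n by (simp add: power_mono)
    then have "w x = 0" by (simp add: w_def flat_def)
    then show ?thesis using nz[of x] by simp
  qed
  show "?b x = 0" if "x \<notin> ball c r" for x
  proof -
    have "r\<^sup>2 \<le> n x" using that assms unfolding n by (simp add: power_mono)
    then have "u x = 0" by (simp add: u_def flat_def)
    then show ?thesis by simp
  qed
qed

text \<open>The remainder of Hadamard's lemma; the powers of \<open>t\<close> make the family closed under differentiation.\<close>

definition ray_integral :: "'a::euclidean_space \<Rightarrow> nat \<Rightarrow> ('a \<Rightarrow> real) \<Rightarrow> 'a \<Rightarrow> real" where
  "ray_integral q m h x = integral (cbox 0 1) (\<lambda>t. t ^ m * h (q + t *\<^sub>R (x - q)))"

lemma ray_in_ball: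
  fixes q :: "'a::real_normed_vector"
  assumes "x \<in> ball q s" "t \<in> cbox 0 (1::real)"
  shows "q + t *\<^sub>R (x - q) \<in> ball q s"
proof -
  have "norm (t *\<^sub>R (x - q)) \<le> norm (x - q)"
    using assms(2) by (simp add: mult_left_le_one_le)
  then show ?thesis using assms(1) by (simp add: dist_norm norm_minus_commute)
qed

lemma continuous_on_ray:
  fixes q :: "'a::euclidean_space"
  assumes "continuous_on (ball q s) h"
  shows "continuous_on (ball q s \<times> cbox 0 1) (\<lambda>(x, t). t ^ m * h (q + t *\<^sub>R (x - q)) :: real)"
  unfolding split_beta
  by (intro continuous_intros continuous_on_compose2[OF assms]) (use ray_in_ball in fastforce)

lemma ray_integrable:
  fixes q :: "'a::euclidean_space"
  assumes "continuous_on (ball q s) h" "x \<in> ball q s"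
  shows "(\<lambda>t. t ^ m * h (q + t *\<^sub>R (x - q)) :: real) integrable_on cbox 0 1"
  by (rule integrable_continuous, rule continuous_on_compose2[OF continuous_on_ray[OF assms(1), of m],
       of _ "\<lambda>t. (x, t)", simplified])
     (use assms(2) in \<open>auto intro!: continuous_intros\<close>)

text \<open>Differentiation under the integral sign; the inner derivative of q + t (x - q)
  contributes one more factor t, whence \<open>Suc m\<close>.\<close>

lemma ray_integral_has_derivative:
  fixes q :: "'a::euclidean_space"
  assumes "smooth_on (ball q s) h" "x \<in> ball q s"
  shows "(ray_integral q m h has_derivative
    (\<lambda>v. ray_integral q (Suc m) (\<lambda>y. frechet_derivative h (at y) v) x)) (at x)"
proof -
  let ?B = "ball q s" and ?D = "\<lambda>y. frechet_derivative h (at y)"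
  have D: "(h has_derivative ?D y) (at y)" if "y \<in> ?B" for y
    using smooth_on_has_derivative[OF open_ball assms(1) that] .
  have cont: "continuous_on ?B h" "continuous_on ?B (\<lambda>y. ?D y v)" for v
    using assms(1) smooth_on_frechet_derivative[OF assms(1)] Ck_on.simps(1)
    unfolding smooth_on_def by blast+
  \<comment> \<open>The Leibniz rule wants the derivative as a bounded linear function.
    \<open>Blinfun\<close> has its meaning only on bounded linear maps, so \<open>F\<close> is
    evaluated for x in the ball and t in [0, 1] only.\<close>
  define F where "F x t = t ^ Suc m *\<^sub>R Blinfun (?D (q + t *\<^sub>R (x - q)))" for x and t :: real
  have F: "blinfun_apply (F x t) v = t ^ Suc m * ?D (q + t *\<^sub>R (x - q)) v"
    if "x \<in> ?B" "t \<in> cbox 0 1" for x t v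
    using has_derivative_bounded_linear[OF D[OF ray_in_ball[OF that]]]
    by (simp add: F_def blinfun.scaleR_left bounded_linear_Blinfun_apply)
  have contF: "continuous_on (?B \<times> cbox 0 1) (\<lambda>(x, t). F x t)"
  proof (rule continuous_on_blinfun_componentwise)
    fix v :: 'a
    show "continuous_on (?B \<times> cbox 0 1) (\<lambda>z. blinfun_apply (case z of (x, t) \<Rightarrow> F x t) v)"
      using continuous_on_ray[OF cont(2)[of v], of "Suc m"]
      by (rule continuous_on_eq) (auto simp: F simp del: power_Suc)
  qed
  have "(ray_integral q m h has_derivative integral (cbox 0 1) (F x)) (at x within ?B)"
    unfolding ray_integral_def[abs_def]
  proof (rule leibniz_rule[OF _ _ contF assms(2) convex_ball])
    fix x t assume x: "x \<in> ?B" and t: "t \<in> cbox 0 (1::real)"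
    have "((\<lambda>x. q + t *\<^sub>R (x - q)) has_derivative (\<lambda>v. t *\<^sub>R v)) (at x within ?B)"
      by (auto intro!: derivative_eq_intros)
    from has_derivative_compose[OF this D[OF ray_in_ball[OF x t]]]
    have "((\<lambda>x. h (q + t *\<^sub>R (x - q))) has_derivative (\<lambda>v. ?D (q + t *\<^sub>R (x - q)) (t *\<^sub>R v))) (at x within ?B)" .
    from has_derivative_mult_right[OF this, of "t ^ m"]
    show "((\<lambda>x. t ^ m * h (q + t *\<^sub>R (x - q))) has_derivative blinfun_apply (F x t)) (at x within ?B)"
      by (rule has_derivative_eq_rhs)
         (use linear_cmul[OF has_derivative_linear[OF D[OF ray_in_ball[OF x t]]]] F[OF x t]
           in \<open>auto simp: fun_eq_iff\<close>)
  next
    show "(\<lambda>t. t ^ m * h (q + t *\<^sub>R (x - q))) integrable_on cbox 0 1" if "x \<in> ?B" for x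
      using ray_integrable[OF cont(1) that] .
  qed
  moreover have "blinfun_apply (integral (cbox 0 1) (F x)) =
      (\<lambda>v. ray_integral q (Suc m) (\<lambda>y. ?D y v) x)"
  proof
    fix v
    have "F x integrable_on cbox 0 1"
      by (rule integrable_continuous, rule continuous_on_compose2[OF contF, of _ "\<lambda>t. (x, t)", simplified])
         (use assms(2) in \<open>auto intro!: continuous_intros\<close>)
    then have "blinfun_apply (integral (cbox 0 1) (F x)) v = integral (cbox 0 1) (\<lambda>t. blinfun_apply (F x t) v)"
      by (rule blinfun_apply_integral)
    also have "\<dots> = ray_integral q (Suc m) (\<lambda>y. ?D y v) x"
      unfolding ray_integral_def using F[OF assms(2)] by (intro integral_cong)
    finally show "blinfun_apply (integral (cbox 0 1) (F x)) v = ray_integral q (Suc m) (\<lambda>y. ?D y v) x" .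
  qed
  ultimately show ?thesis
    using assms(2) by (simp only: at_within_open[OF _ open_ball])
qed

lemma smooth_on_ray_integral:
  fixes q :: "'a::euclidean_space"
  assumes "smooth_on (ball q s) h"
  shows "smooth_on (ball q s) (ray_integral q m h)"
proof -
  have "Ck_on k (ball q s) (ray_integral q m h)" for k
    using assms
  proof (induction k arbitrary: m h)
    case 0
    have "ray_integral q m h differentiable_on ball q s"
      using ray_integral_has_derivative[OF 0]
      unfolding differentiable_on_eq_differentiable_at[OF open_ball] differentiable_def by blast
    then show ?case by (simp add: differentiable_imp_continuous_on)
  next
    case (Suc k)
    show ?case
      by (rule Ck_on_SucI[OF open_ball ray_integral_has_derivative[OF Suc.prems]])
         (simp_all only: Suc.IH[OF smooth_on_frechet_derivative[OF Suc.prems]])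
  qed
  then show ?thesis unfolding smooth_on_def by blast
qed

text \<open>The fundamental theorem of calculus on the segment from q to x. What matters later is
  that the cofactors of x_i - q_i are smooth and equal the partial derivatives of f at q: this lets
  an abstract derivation be evaluated on f.\<close>

lemma hadamard:
  fixes q :: "real^'n"
  assumes "smooth_on (ball q s) f" "x \<in> ball q s"
  shows "f x = f q + (\<Sum>i\<in>UNIV. (x $ i - q $ i) * ray_integral q 0 (\<lambda>y. frechet_derivative f (at y) (axis i 1)) x)"
proof -
  let ?D = "\<lambda>y. frechet_derivative f (at y)"
  let ?y = "\<lambda>t. q + t *\<^sub>R (x - q)"
  have D: "(f has_derivative ?D y) (at y)" if "y \<in> ball q s" for y
    using smooth_on_has_derivative[OF open_ball assms(1) that] .
  have "((\<lambda>t. ?D (?y t) (x - q)) has_integral f (?y 1) - f (?y 0)) {0..1}"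
  proof (rule fundamental_theorem_of_calculus)
    fix t :: real assume t: "t \<in> {0..1}"
    then have y: "?y t \<in> ball q s" using ray_in_ball[OF assms(2)] by simp
    have "(?y has_derivative (\<lambda>h. h *\<^sub>R (x - q))) (at t within {0..1})"
      by (auto intro!: derivative_eq_intros)
    from has_derivative_compose[OF this D[OF y]]
    show "((\<lambda>t. f (?y t)) has_vector_derivative ?D (?y t) (x - q)) (at t within {0..1})"
      using linear_cmul[OF has_derivative_linear[OF D[OF y]]] by (simp add: has_vector_derivative_def)
  qed simp
  then have 1: "f x - f q = integral {0..1} (\<lambda>t. ?D (?y t) (x - q))"
    by (simp add: has_integral_iff)
  have "?D (?y t) (x - q) = (\<Sum>i\<in>UNIV. (x $ i - q $ i) * ?D (?y t) (axis i 1))" if "t \<in> {0..1}" for t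
  proof -
    have "?y t \<in> ball q s" using ray_in_ball[OF assms(2)] that by simp
    then have lin: "linear (?D (?y t))" using D has_derivative_linear by blast
    have "?D (?y t) (x - q) = ?D (?y t) (\<Sum>i\<in>UNIV. (x - q) $ i *\<^sub>R axis i 1)"
      using basis_expansion[of "x - q"] by (simp add: scalar_mult_eq_scaleR)
    also have "\<dots> = (\<Sum>i\<in>UNIV. (x $ i - q $ i) * ?D (?y t) (axis i 1))"
      using lin by (simp add: linear_sum linear_cmul o_def)
    finally show ?thesis .
  qed
  then have "integral {0..1} (\<lambda>t. ?D (?y t) (x - q)) =
      integral {0..1} (\<lambda>t. \<Sum>i\<in>UNIV. (x $ i - q $ i) * ?D (?y t) (axis i 1))"
    by (rule integral_cong)
  also have "\<dots> = (\<Sum>i\<in>UNIV. (x $ i - q $ i) * integral {0..1} (\<lambda>t. ?D (?y t) (axis i 1)))"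
  proof (subst integral_sum)
    fix i
    have "continuous_on (ball q s) (\<lambda>y. ?D y (axis i 1))"
      using smooth_on_frechet_derivative[OF assms(1)] Ck_on.simps(1) unfolding smooth_on_def by blast
    from ray_integrable[OF this assms(2), of 0]
    show "(\<lambda>t. (x $ i - q $ i) * ?D (?y t) (axis i 1)) integrable_on {0..1}"
      by (auto intro: integrable_on_mult_right)
  qed simp_all
  finally show ?thesis using 1 by (simp add: ray_integral_def)
qed

lemma ray_integral_center: "ray_integral q 0 h q = h q"
  by (simp add: ray_integral_def)

section \<open>Smooth functions and vector fields on a manifold\<close>

lemma sum_fun_apply [simp]: "(\<Sum>i\<in>I. f i) x = (\<Sum>i\<in>I. f i x :: 'b::comm_monoid_add)"
  by (induction I rule: infinite_finite_induct) auto

locale smooth_manifold = charted atlas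
  for atlas :: "('m::{t2_space,second_countable_topology} set \<times> ('m \<Rightarrow> real^'n)) set" +
  assumes smooth_atlas: "smooth_atlas atlas"
begin

section \<open>Charts, the ring of smooth functions, bump functions\<close>

lemma chart:
  assumes "(U, \<phi>) \<in> atlas"
  shows "open U" "open (\<phi> ` U)" "homeomorphism U (\<phi> ` U) \<phi> (inv_into U \<phi>)"
  using smooth_atlas assms unfolding smooth_atlas_def by blast+

lemma chart_at: obtains U \<phi> where "(U, \<phi>) \<in> atlas" "p \<in> U"
  using smooth_atlas unfolding smooth_atlas_def by blast

lemma transition:
  assumes "(U, \<phi>) \<in> atlas" "(V, \<phi>') \<in> atlas"
  shows "smooth_on (\<phi> ` (U \<inter> V)) (\<phi>' \<circ> inv_into U \<phi>)"
  using smooth_atlas assms unfolding smooth_atlas_def by blast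

lemma chart_inv [simp]: "(U, \<phi>) \<in> atlas \<Longrightarrow> y \<in> U \<Longrightarrow> inv_into U \<phi> (\<phi> y) = y"
  using chart(3)[of U \<phi>] by (simp add: homeomorphism_def)

lemma chart_inj: "(U, \<phi>) \<in> atlas \<Longrightarrow> y \<in> U \<Longrightarrow> z \<in> U \<Longrightarrow> \<phi> y = \<phi> z \<Longrightarrow> y = z"
  using chart_inv by metis

lemma chart_open_image:
  assumes "(U, \<phi>) \<in> atlas" "open W" "W \<subseteq> U"
  shows "open (\<phi> ` W)"
  using homeomorphism_imp_open_map[OF chart(3)[OF assms(1)], of W] assms chart[OF assms(1)]
  by (simp add: openin_open_eq)

lemma chart_open_preimage:
  assumes "(U, \<phi>) \<in> atlas" "open T"
  shows "open {y \<in> U. \<phi> y \<in> T}"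
proof -
  have "continuous_on U \<phi>" using chart(3)[OF assms(1)] by (simp add: homeomorphism_def)
  from continuous_open_preimage[OF this chart(1)[OF assms(1)] assms(2)]
  show ?thesis by (simp add: vimage_def Int_def)
qed

text \<open>Traces, contractions and quotients of top forms have a formula on each frame domain but
  none on all of M. This is how they are seen to be smooth.\<close>

lemma smooth_funs_local:
  assumes "\<And>p. \<exists>W g. open W \<and> p \<in> W \<and> g \<in> smooth_funs \<and> (\<forall>y\<in>W. f y = g y)"
  shows "f \<in> smooth_funs"
  unfolding smooth_funs_def
proof (clarify, rule smooth_on_local)
  fix V \<kappa> x assume V: "(V, \<kappa>) \<in> atlas" and "x \<in> \<kappa> ` V"
  then obtain y where y: "y \<in> V" "x = \<kappa> y" by blast
  obtain W g where W: "open W" "y \<in> W" "g \<in> smooth_funs" "\<forall>y\<in>W. f y = g y" using assms by blast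
  let ?T = "\<kappa> ` (W \<inter> V)"
  have T: "open ?T" using chart_open_image[OF V] W(1) chart(1)[OF V] by blast
  have "smooth_on ?T (g \<circ> inv_into V \<kappa>)"
    using W(3) V by (auto simp: smooth_funs_def intro: smooth_on_subset)
  then have "smooth_on ?T (f \<circ> inv_into V \<kappa>)"
    by (subst smooth_on_cong[OF T, where g = "g \<circ> inv_into V \<kappa>"]) (use W(4) V in auto)
  then show "\<exists>T. open T \<and> x \<in> T \<and> smooth_on T (f \<circ> inv_into V \<kappa>)"
    using T y W(2) by blast
qed

lemma smooth_const [simp]: "(\<lambda>_. c) \<in> smooth_funs"
  unfolding smooth_funs_def o_def using chart(2) by (auto intro: smooth_on_const)

lemma smooth_zero [simp]: "0 \<in> smooth_funs"
  unfolding zero_fun_def by simp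

lemma smooth_add [simp]: "f \<in> smooth_funs \<Longrightarrow> g \<in> smooth_funs \<Longrightarrow> f + g \<in> smooth_funs"
  unfolding smooth_funs_def o_def plus_fun_def using chart(2) by (auto intro!: smooth_on_add)

lemma smooth_mult [simp]: "f \<in> smooth_funs \<Longrightarrow> g \<in> smooth_funs \<Longrightarrow> f * g \<in> smooth_funs"
  unfolding smooth_funs_def o_def times_fun_def using chart(2) by (auto intro!: smooth_on_mult)

lemma smooth_cmult [simp]: "f \<in> smooth_funs \<Longrightarrow> (\<lambda>p. c * f p) \<in> smooth_funs"
  using smooth_mult[OF smooth_const, of f c] by (simp add: times_fun_def)

lemma smooth_uminus [simp]: "f \<in> smooth_funs \<Longrightarrow> - f \<in> smooth_funs"
  using smooth_cmult[of f "-1"] by (simp add: fun_Compl_def)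

lemma smooth_diff [simp]: "f \<in> smooth_funs \<Longrightarrow> g \<in> smooth_funs \<Longrightarrow> f - g \<in> smooth_funs"
  using smooth_add[of f "- g"] by simp

lemma smooth_sum [simp]: "(\<And>i. i \<in> I \<Longrightarrow> f i \<in> smooth_funs) \<Longrightarrow> (\<Sum>i\<in>I. f i) \<in> smooth_funs"
  by (induction I rule: infinite_finite_induct) auto

lemma smooth_prod: "(\<And>i. i \<in> I \<Longrightarrow> f i \<in> smooth_funs) \<Longrightarrow> (\<lambda>p. \<Prod>i\<in>I. f i p) \<in> smooth_funs"
proof (induction I rule: infinite_finite_induct)
  case (insert i I)
  then have "f i * (\<lambda>p. \<Prod>i\<in>I. f i p) \<in> smooth_funs" by simp
  then show ?case using insert by (simp add: times_fun_def)
qed simp_all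

lemma smooth_inverse:
  "f \<in> smooth_funs \<Longrightarrow> (\<And>p. f p \<noteq> 0) \<Longrightarrow> (\<lambda>p. inverse (f p)) \<in> smooth_funs"
  unfolding smooth_funs_def o_def using chart(2) by (auto intro!: smooth_on_inverse)

lemma smooth_ln: "f \<in> smooth_funs \<Longrightarrow> (\<And>p. f p > 0) \<Longrightarrow> (\<lambda>p. ln (f p)) \<in> smooth_funs"
  unfolding smooth_funs_def o_def using chart(2) by (auto intro!: smooth_on_ln)

definition chart_ext :: "'m set \<Rightarrow> ('m \<Rightarrow> real^'n) \<Rightarrow> (real^'n) set \<Rightarrow> (real^'n \<Rightarrow> real) \<Rightarrow> 'm scalar" where
  "chart_ext U \<phi> T h = (\<lambda>y. if y \<in> U \<and> \<phi> y \<in> T then h (\<phi> y) else 0)"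

text \<open>Near a point of U that is mapped into T the extension is h after a transition map; every
  other point has a neighbourhood on which it is 0.\<close>

lemma smooth_chart_ext:
  assumes U: "(U, \<phi>) \<in> atlas" and T: "open T" "T \<subseteq> \<phi> ` U" "smooth_on T h"
    and C: "compact C" "C \<subseteq> T" "\<And>x. x \<in> T - C \<Longrightarrow> h x = 0"
  shows "chart_ext U \<phi> T h \<in> smooth_funs"
  unfolding smooth_funs_def
proof (clarify, rule smooth_on_local)
  fix V \<kappa> x assume V: "(V, \<kappa>) \<in> atlas" and "x \<in> \<kappa> ` V"
  then obtain y where y: "y \<in> V" "x = \<kappa> y" by blast
  let ?f = "chart_ext U \<phi> T h \<circ> inv_into V \<kappa>"
  show "\<exists>S. open S \<and> x \<in> S \<and> smooth_on S ?f"
  proof (cases "y \<in> U \<and> \<phi> y \<in> T")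
    case True
    define W where "W = V \<inter> {y \<in> U. \<phi> y \<in> T}"
    have S: "open (\<kappa> ` W)"
      unfolding W_def by (intro chart_open_image[OF V] open_Int chart(1)[OF V] chart_open_preimage[OF U T(1)]) auto
    have "smooth_on (\<kappa> ` W) (\<lambda>x. h ((\<phi> \<circ> inv_into V \<kappa>) x))"
    proof (rule smooth_on_compose[OF S T(1) _ _ T(3)])
      show "(\<phi> \<circ> inv_into V \<kappa>) ` \<kappa> ` W \<subseteq> T" using V by (auto simp: W_def)
      show "smooth_on (\<kappa> ` W) (\<phi> \<circ> inv_into V \<kappa>)"
        by (rule smooth_on_subset[OF transition[OF V U]]) (auto simp: W_def)
    qed
    then have "smooth_on (\<kappa> ` W) ?f"
      by (subst smooth_on_cong[OF S]) (use V in \<open>auto simp: W_def chart_ext_def\<close>)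
    then show ?thesis using S True y by (auto simp: W_def)
  next
    case False
    define K where "K = inv_into U \<phi> ` C"
    have "continuous_on C (inv_into U \<phi>)"
      using chart(3)[OF U] C(2) T(2) unfolding homeomorphism_def by (meson continuous_on_subset order_trans)
    then have K: "closed K" unfolding K_def using C(1) compact_continuous_image compact_imp_closed by blast
    have S: "open (\<kappa> ` (V - K))"
      by (intro chart_open_image[OF V] open_Diff chart(1)[OF V] K) auto
    have "chart_ext U \<phi> T h z = 0" if "z \<notin> K" for z
    proof (cases "z \<in> U \<and> \<phi> z \<in> C")
      case True
      then have "z \<in> K" unfolding K_def using chart_inv[OF U, of z] by (metis image_eqI)
      with that show ?thesis by simp
    next
      case False
      then show ?thesis using C by (auto simp: chart_ext_def)
    qed
    then have "smooth_on (\<kappa> ` (V - K)) ?f"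
      by (subst smooth_on_cong[OF S, where g = "\<lambda>_. 0"]) (use V S in \<open>auto intro: smooth_on_const\<close>)
    moreover have "y \<notin> K"
    proof
      assume "y \<in> K"
      then obtain c where "c \<in> C" "y = inv_into U \<phi> c" by (auto simp: K_def)
      moreover have "inv_into U \<phi> c \<in> U" "\<phi> (inv_into U \<phi> c) = c"
        using calculation C(2) T(2) by (auto simp: inv_into_into f_inv_into_f)
      ultimately show False using False C(2) by auto
    qed
    ultimately show ?thesis using S y by blast
  qed
qed

lemma exists_bump:
  assumes "open W" "p \<in> W"
  obtains \<kappa> N where "\<kappa> \<in> smooth_funs" "open N" "p \<in> N" "N \<subseteq> W"
    "\<And>y. y \<in> N \<Longrightarrow> \<kappa> y = 1" "\<And>y. y \<notin> W \<Longrightarrow> \<kappa> y = 0"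
proof -
  obtain U \<phi> where U: "(U, \<phi>) \<in> atlas" "p \<in> U" using chart_at .
  let ?T = "\<phi> ` (U \<inter> W)"
  have T: "open ?T" using chart_open_image[OF U(1)] chart(1)[OF U(1)] assms(1) by blast
  moreover have "\<phi> p \<in> ?T" using U(2) assms(2) by blast
  ultimately obtain r where r: "r > 0" "cball (\<phi> p) r \<subseteq> ?T" using open_contains_cball by blast
  have r2: "0 < r / 2" "r / 2 < r" using r(1) by auto
  obtain b :: "real^'n \<Rightarrow> real" where b: "smooth_on UNIV b" "\<And>x. x \<in> cball (\<phi> p) (r / 2) \<Longrightarrow> b x = 1"
      "\<And>x. x \<notin> ball (\<phi> p) r \<Longrightarrow> b x = 0"
    using exists_bump_euclidean[OF r2, of "\<phi> p"] by metis
  let ?N = "{y \<in> U. \<phi> y \<in> ball (\<phi> p) (r / 2)}"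
  have inT: "\<phi> y \<in> ?T \<longleftrightarrow> y \<in> W" if "y \<in> U" for y
    using that chart_inj[OF U(1)] by (auto simp: image_iff)
  have rT: "\<phi> y \<in> ?T" if "\<phi> y \<in> ball (\<phi> p) (r / 2)" for y
    using that r by auto
  show thesis
  proof (rule that[of "chart_ext U \<phi> ?T b" ?N])
    show "chart_ext U \<phi> ?T b \<in> smooth_funs"
      by (rule smooth_chart_ext[OF U(1) T _ _ compact_cball r(2)])
         (use b smooth_on_subset[OF b(1)] in auto)
    show "open ?N" using chart_open_preimage[OF U(1) open_ball] .
    show "?N \<subseteq> W" using rT inT by blast
    show "chart_ext U \<phi> ?T b y = 1" if "y \<in> ?N" for y
      using that rT[of y] b(2) by (simp add: chart_ext_def)
    show "chart_ext U \<phi> ?T b y = 0" if "y \<notin> W" for y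
      using that inT by (auto simp: chart_ext_def)
  qed (use U(2) r(1) in auto)
qed

section \<open>Vector fields as derivations\<close>

lemma vfield_outside: "X \<in> vfields \<Longrightarrow> f \<notin> smooth_funs \<Longrightarrow> X f = 0"
  and vfield_smooth [simp]: "X \<in> vfields \<Longrightarrow> f \<in> smooth_funs \<Longrightarrow> X f \<in> smooth_funs"
  and vfield_add: "X \<in> vfields \<Longrightarrow> f \<in> smooth_funs \<Longrightarrow> g \<in> smooth_funs \<Longrightarrow> X (f + g) = X f + X g"
  and vfield_mult: "X \<in> vfields \<Longrightarrow> f \<in> smooth_funs \<Longrightarrow> g \<in> smooth_funs \<Longrightarrow> X (f * g) = X f * g + f * X g"
  and vfield_cmult: "X \<in> vfields \<Longrightarrow> f \<in> smooth_funs \<Longrightarrow> X (\<lambda>p. c * f p) = (\<lambda>p. c * X f p)"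
  unfolding vfields_def by blast+

lemma vfield_zero [simp]: "X \<in> vfields \<Longrightarrow> X 0 = 0"
  using vfield_cmult[of X 0 0] by (simp add: zero_fun_def)

lemma vfield_uminus: "X \<in> vfields \<Longrightarrow> f \<in> smooth_funs \<Longrightarrow> X (- f) = - X f"
  using vfield_cmult[of X f "-1"] by (simp add: fun_Compl_def)

lemma vfield_diff: "X \<in> vfields \<Longrightarrow> f \<in> smooth_funs \<Longrightarrow> g \<in> smooth_funs \<Longrightarrow> X (f - g) = X f - X g"
  using vfield_add[of X f "- g"] by (simp add: vfield_uminus fun_eq_iff)

lemma vfield_sum:
  "X \<in> vfields \<Longrightarrow> (\<And>i. i \<in> I \<Longrightarrow> f i \<in> smooth_funs) \<Longrightarrow> X (\<Sum>i\<in>I. f i) = (\<Sum>i\<in>I. X (f i))"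
  by (induction I rule: infinite_finite_induct) (auto simp: vfield_add)

lemma vfield_const: "X \<in> vfields \<Longrightarrow> X (\<lambda>_. c) = 0"
proof -
  assume X: "X \<in> vfields"
  have "X (1 * 1) = X 1 * 1 + 1 * X 1" using X smooth_const[of 1] by (intro vfield_mult) (auto simp: one_fun_def)
  then have "X 1 = 0" by simp
  then show ?thesis using vfield_cmult[OF X smooth_const, of c 1] by (simp add: one_fun_def zero_fun_def)
qed

text \<open>For a bump \<kappa> that vanishes off W, with \<kappa> q = 1, the product \<kappa> (f -
  g) is 0. At q the Leibniz rule reduces X of it to X (f - g), because f - g vanishes at q.\<close>

lemma vfield_local:
  assumes X: "X \<in> vfields" and fg: "f \<in> smooth_funs" "g \<in> smooth_funs"
    and W: "open W" "q \<in> W" "\<And>y. y \<in> W \<Longrightarrow> f y = g y"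
  shows "X f q = X g q"
proof -
  obtain \<kappa> where \<kappa>: "\<kappa> \<in> smooth_funs" "\<kappa> q = 1" "\<And>y. y \<notin> W \<Longrightarrow> \<kappa> y = 0"
    using exists_bump[OF W(1,2)] by metis
  have "\<kappa> * (f - g) = 0" using W(3) \<kappa>(3) by (force simp: fun_eq_iff)
  then have "0 = X (\<kappa> * (f - g))" using vfield_zero[OF X] by metis
  also have "\<dots> = X \<kappa> * (f - g) + \<kappa> * X (f - g)" using X fg \<kappa>(1) by (intro vfield_mult smooth_diff)
  finally have "0 = (X \<kappa> * (f - g) + \<kappa> * X (f - g)) q" by (metis zero_fun_apply)
  then show ?thesis using W \<kappa>(2) X fg by (simp add: vfield_diff)
qed

lemma vfields_zero [simp]: "0 \<in> vfields"
  unfolding vfields_def by (auto simp: zero_fun_def plus_fun_def times_fun_def smooth_const[of 0, simplified])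

lemma vfields_add [simp]: "X \<in> vfields \<Longrightarrow> Y \<in> vfields \<Longrightarrow> X + Y \<in> vfields"
  unfolding vfields_def by (auto simp: fun_eq_iff algebra_simps)

lemma vfields_fscale [simp]: "f \<in> smooth_funs \<Longrightarrow> X \<in> vfields \<Longrightarrow> fscale f X \<in> vfields"
  unfolding vfields_def fscale_def by (auto simp: fun_eq_iff algebra_simps)

lemma vfields_uminus [simp]: "X \<in> vfields \<Longrightarrow> - X \<in> vfields"
  unfolding vfields_def by (auto simp: fun_eq_iff algebra_simps)

lemma vfields_diff [simp]: "X \<in> vfields \<Longrightarrow> Y \<in> vfields \<Longrightarrow> X - Y \<in> vfields"
  using vfields_add[of X "- Y"] by simp

lemma vfields_vbracket [simp]:
  assumes "X \<in> vfields" "Y \<in> vfields"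
  shows "vbracket X Y \<in> vfields"
  unfolding vfields_def mem_Collect_eq
proof (intro conjI ballI allI impI)
  show "vbracket X Y f = 0" if "f \<notin> smooth_funs" for f
    unfolding vbracket_def vfield_outside[OF assms(1) that] vfield_outside[OF assms(2) that] by (simp add: assms)
  show "vbracket X Y f \<in> smooth_funs" if "f \<in> smooth_funs" for f
    using that assms by (simp add: vbracket_def)
  fix f g assume "f \<in> smooth_funs" "g \<in> smooth_funs"
  then show "vbracket X Y (f + g) = vbracket X Y f + vbracket X Y g"
      "vbracket X Y (f * g) = vbracket X Y f * g + f * vbracket X Y g"
    using assms by (simp_all add: vbracket_def vfield_add vfield_mult algebra_simps del: plus_fun_apply times_fun_apply)
next
  fix f c assume "f \<in> smooth_funs"
  then show "vbracket X Y (\<lambda>p. c * f p) = (\<lambda>p. c * vbracket X Y f p)"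
    using assms by (simp add: vbracket_def vfield_cmult fun_eq_iff algebra_simps)
qed

text \<open>Coordinate fields and functions are cut off to become global objects that keep their
  usual properties on a smaller set W. The expansion of an arbitrary derivation rests on Hadamard's
  lemma. The clause on logarithms is recorded because the chain rule is calculus for the coordinate
  fields but not an axiom for derivations.\<close>

lemma exists_coordinates:
  obtains W e x where "open W" "p \<in> W" "\<And>i::'n. e i \<in> vfields" "\<And>i. x i \<in> smooth_funs"
    "\<And>i j q. q \<in> W \<Longrightarrow> e i (x j) q = (if i = j then 1 else 0)"
    "\<And>X f q. X \<in> vfields \<Longrightarrow> f \<in> smooth_funs \<Longrightarrow> q \<in> W \<Longrightarrow> X f q = (\<Sum>i\<in>UNIV. X (x i) q * e i f q)"
    "\<And>i g q. g \<in> smooth_funs \<Longrightarrow> (\<And>y. g y > 0) \<Longrightarrow> q \<in> W \<Longrightarrow> e i (\<lambda>y. ln (g y)) q = e i g q / g q"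
proof -
  obtain U \<phi> where U: "(U, \<phi>) \<in> atlas" "p \<in> U" using chart_at .
  let ?T = "\<phi> ` U"
  have T: "open ?T" using chart(2)[OF U(1)] .
  moreover have "\<phi> p \<in> ?T" using U(2) by blast
  ultimately obtain r where r: "r > 0" "cball (\<phi> p) r \<subseteq> ?T" using open_contains_cball by blast
  have r2: "0 < r / 2" "r / 2 < r" using r(1) by auto
  obtain b :: "real^'n \<Rightarrow> real" where b: "smooth_on UNIV b" "\<And>x. x \<in> cball (\<phi> p) (r / 2) \<Longrightarrow> b x = 1"
      "\<And>x. x \<notin> ball (\<phi> p) r \<Longrightarrow> b x = 0"
    using exists_bump_euclidean[OF r2, of "\<phi> p"] by metis
  define B where "B = ball (\<phi> p) (r / 2)"
  define W where "W = {y \<in> U. \<phi> y \<in> B}"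
  have BT: "B \<subseteq> ?T" using r by (auto simp: B_def)
  have bB: "b x = 1" if "x \<in> B" for x using that b(2) by (simp add: B_def)
  let ?F = "\<lambda>f. f \<circ> inv_into U \<phi>"
  define d where "d i f z = frechet_derivative (?F f) (at z) (axis i 1)" for i and f :: "'m scalar" and z
  define e where "e i f = (if f \<in> smooth_funs then chart_ext U \<phi> ?T (\<lambda>z. b z * d i f z) else 0)" for i f
  define x where "x i = chart_ext U \<phi> ?T (\<lambda>z. b z * z $ i)" for i
  have F: "smooth_on ?T (?F f)" if "f \<in> smooth_funs" for f
    using that U(1) by (auto simp: smooth_funs_def)
  have D: "(?F f has_derivative frechet_derivative (?F f) (at z)) (at z)" if "f \<in> smooth_funs" "z \<in> ?T" for f z
    using smooth_on_has_derivative[OF T F[OF that(1)] that(2)] .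
  have ext: "chart_ext U \<phi> ?T (\<lambda>z. b z * h z) \<in> smooth_funs" if "smooth_on ?T h" for h
    by (rule smooth_chart_ext[OF U(1) T order_refl _ compact_cball r(2)])
       (use b smooth_on_subset[OF b(1)] that T in \<open>auto intro!: smooth_on_mult\<close>)
  have x: "x i \<in> smooth_funs" for i
    unfolding x_def by (intro ext smooth_on_bounded_linear T bounded_linear_vec_nth)
  have eW: "e i f q = d i f (\<phi> q)" if "q \<in> W" "f \<in> smooth_funs" for i f q
    using that bB by (auto simp: e_def chart_ext_def W_def)
  have vf: "e i \<in> vfields" for i
    unfolding vfields_def mem_Collect_eq
  proof (intro conjI ballI allI impI)
    show "e i f = 0" if "f \<notin> smooth_funs" for f using that by (simp add: e_def)
    show "e i f \<in> smooth_funs" if "f \<in> smooth_funs" for f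
      using ext[OF smooth_on_frechet_derivative[OF F[OF that]]] that by (simp add: e_def d_def)
    fix f g :: "'m scalar" assume f: "f \<in> smooth_funs" and g: "g \<in> smooth_funs"
    have "d i (f + g) z = d i f z + d i g z" if "z \<in> ?T" for z
      using frechet_derivative_at[OF has_derivative_add[OF D[OF f that] D[OF g that]], symmetric]
      by (simp add: d_def o_def)
    then show "e i (f + g) = e i f + e i g"
      using f g by (auto simp: e_def chart_ext_def algebra_simps)
    have "d i (f * g) z = d i f z * ?F g z + ?F f z * d i g z" if "z \<in> ?T" for z
      using frechet_derivative_at[OF has_derivative_mult[OF D[OF f that] D[OF g that]], symmetric]
      by (simp add: d_def o_def)
    then show "e i (f * g) = e i f * g + f * e i g"
      using f g U(1) by (auto simp: e_def chart_ext_def algebra_simps)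
  next
    fix f :: "'m scalar" and c assume f: "f \<in> smooth_funs"
    have "d i (\<lambda>p. c * f p) z = c * d i f z" if "z \<in> ?T" for z
      using frechet_derivative_at[OF has_derivative_mult_right[OF D[OF f that]], of c, symmetric]
      by (simp add: d_def o_def)
    then show "e i (\<lambda>p. c * f p) = (\<lambda>p. c * e i f p)"
      using f by (auto simp: e_def chart_ext_def algebra_simps)
  qed
  have W: "open W" unfolding W_def B_def by (rule chart_open_preimage[OF U(1) open_ball])
  show thesis
  proof (rule that[of W e x, OF W _ vf x])
    show "p \<in> W" using U(2) r(1) by (simp add: W_def B_def)
  next
    fix i j q assume q: "q \<in> W"
    have "((\<lambda>z. z $ j) has_derivative (\<lambda>v. v $ j)) (at (\<phi> q))"
      by (intro bounded_linear_imp_has_derivative bounded_linear_vec_nth)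
    then have "(?F (x j) has_derivative (\<lambda>v. v $ j)) (at (\<phi> q))"
    proof (rule has_derivative_transform_within_open)
      show "open B" "\<phi> q \<in> B" using q by (auto simp: B_def W_def)
      show "z $ j = ?F (x j) z" if z: "z \<in> B" for z
      proof -
        obtain y where "y \<in> U" "z = \<phi> y" using z BT by blast
        then show ?thesis using U(1) bB[OF z] by (auto simp: x_def chart_ext_def)
      qed
    qed
    from frechet_derivative_at[OF this, symmetric] show "e i (x j) q = (if i = j then 1 else 0)"
      by (simp add: eW[OF q x] d_def axis_def eq_commute[of i j])
  next
    fix i g q assume g: "g \<in> smooth_funs" "\<And>y. g y > 0" and q: "q \<in> W"
    have \<phi>q: "\<phi> q \<in> ?T" using q by (auto simp: W_def)
    have "?F g (\<phi> q) > 0" using g(2) by simp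
    from frechet_derivative_at[OF has_derivative_ln[OF this D[OF g(1) \<phi>q]], symmetric]
    have "d i (\<lambda>y. ln (g y)) (\<phi> q) = d i g (\<phi> q) * inverse (?F g (\<phi> q))"
      by (simp add: d_def o_def)
    moreover have "q \<in> U" using q by (simp add: W_def)
    ultimately show "e i (\<lambda>y. ln (g y)) q = e i g q / g q"
      using q g U(1) smooth_ln[OF g] by (simp add: eW divide_inverse)
  next
    fix X f q assume X: "X \<in> vfields" and f: "f \<in> smooth_funs" and q: "q \<in> W"
    have \<phi>q: "\<phi> q \<in> B" "q \<in> U" using q by (auto simp: W_def)
    obtain s where s: "s > 0" "ball (\<phi> q) s \<subseteq> B"
      using \<phi>q(1) unfolding B_def by (meson open_ball openE)
    let ?S = "ball (\<phi> q) s"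
    have ST: "?S \<subseteq> ?T" using s(2) BT by blast
    \<comment> \<open>The remainders G are smooth on radius s, b' cuts them off within s/2, and
      Hadamard's formula for f survives where b' = 1, on radius s/4.\<close>
    have s4: "0 < s / 4" "s / 4 < s / 2" using s(1) by auto
    obtain b' :: "real^'n \<Rightarrow> real" where b': "smooth_on UNIV b'" "\<And>x. x \<in> cball (\<phi> q) (s / 4) \<Longrightarrow> b' x = 1"
        "\<And>x. x \<notin> ball (\<phi> q) (s / 2) \<Longrightarrow> b' x = 0"
      using exists_bump_euclidean[OF s4, of "\<phi> q"] by metis
    have FS: "smooth_on ?S (?F f)" using smooth_on_subset[OF F[OF f] ST] .
    define G where "G i = ray_integral (\<phi> q) 0 (d i f)" for i
    have G: "smooth_on ?S (G i)" for i
      unfolding G_def d_def by (intro smooth_on_ray_integral smooth_on_frechet_derivative FS)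
    define g where "g i = chart_ext U \<phi> ?S (\<lambda>z. b' z * G i z)" for i
    have g: "g i \<in> smooth_funs" for i
      unfolding g_def
      by (rule smooth_chart_ext[OF U(1) open_ball ST _ compact_cball[of "\<phi> q" "s/2"]])
         (use b' smooth_on_subset[OF b'(1)] G s(1) in \<open>auto intro!: smooth_on_mult\<close>)
    have gq: "g i q = e i f q" for i
      using s(1) \<phi>q b'(2) eW[OF q f] by (simp add: g_def chart_ext_def G_def ray_integral_center)
    let ?x = "\<lambda>i. x i - (\<lambda>_. x i q)"
    \<comment> \<open>f' agrees with f near q and is built from global smooth functions, so X can be
      applied term by term. The factors x_i - x_i(q) vanish at q, which leaves X(x_i) times the
      partial derivatives.\<close>
    define f' where "f' = (\<lambda>_. f q) + (\<Sum>i\<in>UNIV. ?x i * g i)"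
    have f': "f' \<in> smooth_funs" using x g by (simp add: f'_def)
    have "X f q = X f' q"
    proof (rule vfield_local[OF X f f'])
      show "open {y \<in> U. \<phi> y \<in> ball (\<phi> q) (s / 4)}" by (rule chart_open_preimage[OF U(1) open_ball])
      show "q \<in> {y \<in> U. \<phi> y \<in> ball (\<phi> q) (s / 4)}" using \<phi>q s(1) by simp
      fix y assume "y \<in> {y \<in> U. \<phi> y \<in> ball (\<phi> q) (s / 4)}"
      then have y: "y \<in> U" "\<phi> y \<in> ?S" "b' (\<phi> y) = 1" using b'(2) s(1) by auto
      have xB: "x i z = \<phi> z $ i" if "z \<in> U" "\<phi> z \<in> B" for z i
        using that bB by (simp add: x_def chart_ext_def)
      have "f y = ?F f (\<phi> y)" using y U(1) by simp
      also have "\<dots> = ?F f (\<phi> q) + (\<Sum>i\<in>UNIV. (\<phi> y $ i - \<phi> q $ i) * G i (\<phi> y))"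
        unfolding G_def d_def by (rule hadamard[OF FS y(2)])
      also have "\<dots> = f' y"
        using y \<phi>q U(1) xB[OF y(1)] xB[OF \<phi>q(2,1)] s(2)
        by (auto simp: f'_def g_def chart_ext_def intro!: sum.cong)
      finally show "f y = f' y" .
    qed
    also have "X f' = (\<Sum>i\<in>UNIV. X (?x i) * g i + ?x i * X (g i))"
      using X x g by (simp add: f'_def vfield_add vfield_const vfield_sum vfield_mult fun_eq_iff)
    also have "\<dots> q = (\<Sum>i\<in>UNIV. X (x i) q * g i q)"
      using X x by (simp add: vfield_diff vfield_const)
    finally show "X f q = (\<Sum>i\<in>UNIV. X (x i) q * e i f q)" by (simp add: gq)
  qed
qed

text \<open>Both sides expand in the coordinate fields, for which the chain rule is already
  known.\<close>

lemma vfield_ln: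
  assumes "X \<in> vfields" "g \<in> smooth_funs" "\<And>y. g y > 0"
  shows "X (\<lambda>y. ln (g y)) q = X g q / g q"
proof -
  obtain W e x where W: "q \<in> W"
    and c: "\<And>X f q. X \<in> vfields \<Longrightarrow> f \<in> smooth_funs \<Longrightarrow> q \<in> W \<Longrightarrow> X f q = (\<Sum>i\<in>UNIV. X (x (i::'n)) q * e i f q)"
    and l: "\<And>i g q. g \<in> smooth_funs \<Longrightarrow> (\<And>y. g y > 0) \<Longrightarrow> q \<in> W \<Longrightarrow> e i (\<lambda>y. ln (g y)) q = e i g q / g q"
    by (rule exists_coordinates[of q]) blast
  show ?thesis
    using assms W by (simp add: c smooth_ln l sum_divide_distrib)
qed

end

section \<open>Tensors and frames\<close>

lemma fscale_apply: "fscale f v x = f * v x"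
  by (simp add: fscale_def)

lemmas fun_apply = plus_fun_apply times_fun_apply zero_fun_apply one_fun_apply minus_apply uminus_apply
  sum_fun_apply fscale_apply

text \<open>Functions are treated as elements of a ring here, which premature evaluation at points would obstruct.\<close>

declare fun_apply [simp del] One_nat_def [simp del]

lemma length_omit [simp]: "i < length xs \<Longrightarrow> length (omit i xs) = length xs - 1"
  by (simp add: omit_def)

context charted
begin

definition module_on :: "('x \<Rightarrow> 'm scalar) set \<Rightarrow> bool" where
  "module_on D \<longleftrightarrow> (\<forall>x\<in>D. \<forall>y\<in>D. x + y \<in> D) \<and> (\<forall>f\<in>smooth_funs. \<forall>x\<in>D. fscale f x \<in> D)"

text \<open>Frame and coefficients are global; only the expansion is confined to W. Globally smooth
  coefficients can be cut off by a bump function and then pulled out of a multilinear map. The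
  notion serves vector fields and 1-forms alike, \<xi> being whatever the sections take as
  argument.\<close>

definition local_frame ::
    "('x \<Rightarrow> 'm scalar) set \<Rightarrow> 'm set \<Rightarrow> ('n \<Rightarrow> 'x \<Rightarrow> 'm scalar) \<Rightarrow> (('x \<Rightarrow> 'm scalar) \<Rightarrow> 'n \<Rightarrow> 'm scalar) \<Rightarrow> bool" where
  "local_frame D W b c \<longleftrightarrow> open W \<and> (\<forall>i. b i \<in> D) \<and> (\<forall>x\<in>D. \<forall>i. c x i \<in> smooth_funs) \<and>
     (\<forall>x\<in>D. \<forall>q\<in>W. \<forall>\<xi>. x \<xi> q = (\<Sum>i\<in>UNIV. c x i q * b i \<xi> q))"

text \<open>The action of a derivation \<open>T\<close> of the module of vector fields, with symbol \<open>a\<close>, on forms.\<close>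

definition dact :: "'m vfield \<Rightarrow> ('m vfield \<Rightarrow> 'm vfield) \<Rightarrow> 'm form \<Rightarrow> 'm form" where
  "dact a T \<omega> = (\<lambda>Ys. if set Ys \<subseteq> vfields
     then a (\<omega> Ys) - (\<Sum>i<length Ys. \<omega> (Ys[i := T (Ys ! i)])) else 0)"

text \<open>The model is the bracket with a vector field a. For a = 0 these are the endomorphisms of
  TM.\<close>

definition module_derivation :: "'m vfield \<Rightarrow> ('m vfield \<Rightarrow> 'm vfield) \<Rightarrow> bool" where
  "module_derivation a T \<longleftrightarrow> a \<in> vfields \<and> (\<forall>X\<in>vfields. T X \<in> vfields) \<and>
     (\<forall>X\<in>vfields. \<forall>Y\<in>vfields. T (X + Y) = T X + T Y) \<and>
     (\<forall>f\<in>smooth_funs. \<forall>X\<in>vfields. T (fscale f X) = fscale f (T X) + fscale (a f) X)"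

end

context smooth_manifold
begin

section \<open>Alternating maps over the ring of smooth functions\<close>

lemma module_vfields: "module_on vfields"
  unfolding module_on_def by simp

lemma module_sum:
  assumes "module_on D" "x0 \<in> D" "finite I" "\<And>i. i \<in> I \<Longrightarrow> x i \<in> D"
  shows "(\<Sum>i\<in>I. x i) \<in> D"
  using assms(3,4)
proof (induction I rule: finite_induct)
  case empty
  \<comment> \<open>The closure conditions of a module do not mention 0; it is obtained as 0 times
    the member x0.\<close>
  have "fscale 0 x0 \<in> D" using assms(1,2) by (simp add: module_on_def)
  moreover have "fscale 0 x0 = 0" by (simp add: fun_eq_iff fun_apply)
  ultimately show ?case by simp
next
  case (insert i I)
  then show ?case using assms(1) by (simp add: module_on_def)
qed

lemma altI:
  assumes "\<And>xs. \<not> (length xs = k \<and> set xs \<subseteq> D) \<Longrightarrow> \<omega> xs = 0"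
    and "\<And>xs. length xs = k \<Longrightarrow> set xs \<subseteq> D \<Longrightarrow> \<omega> xs \<in> smooth_funs"
    and "\<And>xs i v. length xs = k \<Longrightarrow> set xs \<subseteq> D \<Longrightarrow> i < k \<Longrightarrow> v \<in> D \<Longrightarrow>
      \<omega> (xs[i := xs ! i + v]) = \<omega> xs + \<omega> (xs[i := v])"
    and "\<And>xs i f. length xs = k \<Longrightarrow> set xs \<subseteq> D \<Longrightarrow> i < k \<Longrightarrow> f \<in> smooth_funs \<Longrightarrow>
      \<omega> (xs[i := fscale f (xs ! i)]) = f * \<omega> xs"
    and "\<And>xs i j. length xs = k \<Longrightarrow> set xs \<subseteq> D \<Longrightarrow> i < k \<Longrightarrow> j < i \<Longrightarrow> xs ! i = xs ! j \<Longrightarrow> \<omega> xs = 0"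
  shows "\<omega> \<in> alt k D"
  using assms unfolding alt_def by blast

lemma alt_outside: "\<omega> \<in> alt k D \<Longrightarrow> \<not> (length xs = k \<and> set xs \<subseteq> D) \<Longrightarrow> \<omega> xs = 0"
  unfolding alt_def by blast

lemma alt_smooth [simp]: "\<omega> \<in> alt k D \<Longrightarrow> \<omega> xs \<in> smooth_funs"
  by (cases "length xs = k \<and> set xs \<subseteq> D") (auto simp: alt_def)

lemma alt_addD:
  "\<omega> \<in> alt k D \<Longrightarrow> length xs = k \<Longrightarrow> set xs \<subseteq> D \<Longrightarrow> i < k \<Longrightarrow> v \<in> D \<Longrightarrow>
    \<omega> (xs[i := xs ! i + v]) = \<omega> xs + \<omega> (xs[i := v])"
  and alt_scaleD:
  "\<omega> \<in> alt k D \<Longrightarrow> length xs = k \<Longrightarrow> set xs \<subseteq> D \<Longrightarrow> i < k \<Longrightarrow> f \<in> smooth_funs \<Longrightarrow>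
    \<omega> (xs[i := fscale f (xs ! i)]) = f * \<omega> xs"
  unfolding alt_def by blast+

lemma alt_add:
  assumes "\<omega> \<in> alt k D" "length xs = k" "set xs \<subseteq> D" "i < k" "x \<in> D" "v \<in> D"
  shows "\<omega> (xs[i := x + v]) = \<omega> (xs[i := x]) + \<omega> (xs[i := v])"
proof -
  have "length (xs[i := x]) = k" "set (xs[i := x]) \<subseteq> D" using assms by (simp_all add: set_update_subsetI)
  then have "\<omega> ((xs[i := x])[i := xs[i := x] ! i + v]) = \<omega> (xs[i := x]) + \<omega> ((xs[i := x])[i := v])"
    using assms unfolding alt_def by blast
  then show ?thesis using assms(2,4) by simp
qed

lemma alt_scale:
  assumes "\<omega> \<in> alt k D" "length xs = k" "set xs \<subseteq> D" "i < k" "x \<in> D" "f \<in> smooth_funs"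
  shows "\<omega> (xs[i := fscale f x]) = f * \<omega> (xs[i := x])"
proof -
  have "length (xs[i := x]) = k" "set (xs[i := x]) \<subseteq> D" using assms by (simp_all add: set_update_subsetI)
  then have "\<omega> ((xs[i := x])[i := fscale f (xs[i := x] ! i)]) = f * \<omega> (xs[i := x])"
    using assms unfolding alt_def by blast
  then show ?thesis using assms(2,4) by simp
qed

lemma alt_repeat:
  assumes "\<omega> \<in> alt k D" "i < k" "j < k" "i \<noteq> j" "xs ! i = xs ! j"
  shows "\<omega> xs = 0"
proof (cases "length xs = k \<and> set xs \<subseteq> D")
  case True
  then have "\<forall>i<k. \<forall>j<i. xs ! i = xs ! j \<longrightarrow> \<omega> xs = 0"
    using assms(1) unfolding alt_def by blast
  then show ?thesis using assms(2-5) by (metis linorder_neqE_nat)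
next
  case False
  then show ?thesis by (rule alt_outside[OF assms(1)])
qed

text \<open>Polarization: the vanishing on repeated arguments is applied to x + y in both
  places.\<close>

lemma alt_swap:
  assumes "\<omega> \<in> alt k D" "module_on D" "length xs = k" "set xs \<subseteq> D" "i < k" "j < k" "i \<noteq> j" "x \<in> D" "y \<in> D"
  shows "\<omega> (xs[i := x, j := y]) = - \<omega> (xs[i := y, j := x])"
proof -
  have xy: "x + y \<in> D" using assms by (simp add: module_on_def)
  have sub: "length (xs[i := z]) = k" "set (xs[i := z]) \<subseteq> D" "length (xs[j := z]) = k" "set (xs[j := z]) \<subseteq> D"
    if "z \<in> D" for z using that assms by (simp_all add: set_update_subsetI)
  have rep: "\<omega> (xs[i := z, j := z]) = 0" for z
    by (rule alt_repeat[OF assms(1,5,6,7)]) (use assms in simp)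
  have "0 = \<omega> (xs[i := x + y, j := x + y])" by (rule rep[symmetric])
  also have "\<dots> = \<omega> (xs[i := x + y, j := x]) + \<omega> (xs[i := x + y, j := y])"
    using assms sub xy by (intro alt_add[OF assms(1)]) auto
  also have "\<omega> (xs[i := x + y, j := x]) = \<omega> (xs[i := x, j := x]) + \<omega> (xs[i := y, j := x])"
    using assms(7) alt_add[OF assms(1) sub(3,4)[OF assms(8)] assms(5) assms(8,9)] by (simp add: list_update_swap)
  also have "\<omega> (xs[i := x + y, j := y]) = \<omega> (xs[i := x, j := y]) + \<omega> (xs[i := y, j := y])"
    using assms(7) alt_add[OF assms(1) sub(3,4)[OF assms(9)] assms(5) assms(8,9)] by (simp add: list_update_swap)
  finally show ?thesis unfolding rep by (simp add: eq_neg_iff_add_eq_0 add.commute)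
qed

lemma alt_sum:
  assumes "\<omega> \<in> alt k D" "module_on D" "length xs = k" "set xs \<subseteq> D" "i < k" "finite J" "\<And>j. j \<in> J \<Longrightarrow> x j \<in> D"
  shows "\<omega> (xs[i := (\<Sum>j\<in>J. x j)]) = (\<Sum>j\<in>J. \<omega> (xs[i := x j]))"
  using assms(6,7)
proof (induction J rule: finite_induct)
  case empty
  have i: "xs ! i \<in> D" using assms by auto
  have "\<omega> (xs[i := fscale 0 (xs ! i)]) = 0 * \<omega> (xs[i := xs ! i])"
    using assms(1,3,4,5) i smooth_zero by (rule alt_scale)
  moreover have "fscale 0 (xs ! i) = 0" by (simp add: fun_eq_iff fun_apply)
  ultimately show ?case by simp
next
  case (insert j J)
  have "xs ! i \<in> D" using assms by auto
  then have "(\<Sum>j\<in>J. x j) \<in> D" using module_sum[OF assms(2), of "xs ! i" J x] insert by simp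
  then show ?case using insert alt_add[OF assms(1,3,4,5)] by simp
qed

text \<open>The expansion of x holds on W only, whereas \<omega> takes global sections. Multiplied
  by a bump \<kappa> the expansion holds everywhere, linearity over smooth functions applies, and
  \<kappa> q = 1 removes the bump again. This is the sense in which tensors are pointwise.\<close>

lemma alt_frame:
  assumes \<omega>: "\<omega> \<in> alt k D" and D: "module_on D" and F: "local_frame D W b c" and q: "q \<in> W"
    and xs: "length xs = k" "set xs \<subseteq> D" "i < k" and x: "x \<in> D"
  shows "\<omega> (xs[i := x]) q = (\<Sum>j\<in>UNIV. c x j q * \<omega> (xs[i := b j]) q)"
proof -
  have W: "open W" and b: "\<And>j. b j \<in> D" and c: "\<And>j. c x j \<in> smooth_funs"
    and exp: "\<And>y \<xi>. y \<in> W \<Longrightarrow> x \<xi> y = (\<Sum>j\<in>UNIV. c x j y * b j \<xi> y)"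
    using F x unfolding local_frame_def by blast+
  obtain \<kappa> where \<kappa>: "\<kappa> \<in> smooth_funs" "\<kappa> q = 1" "\<And>y. y \<notin> W \<Longrightarrow> \<kappa> y = 0"
    using exists_bump[OF W q] by metis
  have "fscale \<kappa> x = (\<Sum>j\<in>UNIV. fscale (\<kappa> * c x j) (b j))"
  proof (intro ext)
    fix \<xi> y
    show "fscale \<kappa> x \<xi> y = (\<Sum>j\<in>UNIV. fscale (\<kappa> * c x j) (b j)) \<xi> y"
      using exp \<kappa>(3) by (cases "y \<in> W") (auto simp: fun_apply sum_distrib_left mult.assoc)
  qed
  then have "\<kappa> * \<omega> (xs[i := x]) = (\<Sum>j\<in>UNIV. \<omega> (xs[i := fscale (\<kappa> * c x j) (b j)]))"
    using alt_scale[OF \<omega> xs x \<kappa>(1)] D b c \<kappa>(1)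
      alt_sum[OF \<omega> D xs, of UNIV "\<lambda>j. fscale (\<kappa> * c x j) (b j)"]
    by (simp add: module_on_def)
  also have "\<dots> = (\<Sum>j\<in>UNIV. \<kappa> * c x j * \<omega> (xs[i := b j]))"
    using b c \<kappa>(1) by (intro sum.cong refl alt_scale[OF \<omega> xs]) auto
  finally have "(\<kappa> * \<omega> (xs[i := x])) q = (\<Sum>j\<in>UNIV. \<kappa> * c x j * \<omega> (xs[i := b j])) q" by simp
  then show ?thesis using \<kappa>(2) by (simp add: fun_apply)
qed

lemma module_alt: "module_on (alt k D)"
  unfolding module_on_def
proof (intro conjI ballI)
  fix x y assume x: "x \<in> alt k D" and y: "y \<in> alt k D"
  show "x + y \<in> alt k D"
  proof (rule altI)
    show "(x + y) xs = 0" if "\<not> (length xs = k \<and> set xs \<subseteq> D)" for xs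
      using alt_outside[OF x that] alt_outside[OF y that] by (simp add: fun_apply)
    show "(x + y) xs = 0" if "i < k" "j < i" "xs ! i = xs ! j" for xs i j
      using alt_repeat[OF x, of i j xs] alt_repeat[OF y, of i j xs] that by (simp add: fun_apply)
    show "(x + y) (xs[i := xs ! i + v]) = (x + y) xs + (x + y) (xs[i := v])"
      if "length xs = k" "set xs \<subseteq> D" "i < k" "v \<in> D" for xs i v
      unfolding fun_apply alt_addD[OF x that] alt_addD[OF y that] by (simp add: algebra_simps)
  qed (use x y in \<open>auto simp: fun_apply alt_scaleD[OF x] alt_scaleD[OF y] distrib_left\<close>)
next
  fix f x assume f: "f \<in> smooth_funs" and x: "x \<in> alt k D"
  show "fscale f x \<in> alt k D"
  proof (rule altI)
    show "fscale f x xs = 0" if "\<not> (length xs = k \<and> set xs \<subseteq> D)" for xs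
      using alt_outside[OF x that] by (simp add: fun_apply)
    show "fscale f x xs = 0" if "i < k" "j < i" "xs ! i = xs ! j" for xs i j
      using alt_repeat[OF x, of i j xs] that by (simp add: fun_apply)
  qed (use f x in \<open>auto simp: fun_apply alt_addD[OF x] alt_scaleD[OF x] distrib_left mult.left_commute\<close>)
qed

lemma alt_plus: "x \<in> alt k D \<Longrightarrow> y \<in> alt k D \<Longrightarrow> x + y \<in> alt k D"
  and alt_fscale: "f \<in> smooth_funs \<Longrightarrow> x \<in> alt k D \<Longrightarrow> fscale f x \<in> alt k D"
  using module_alt[of k D] unfolding module_on_def by blast+

lemma alt_minus: 
  assumes "x \<in> alt k D" "y \<in> alt k D"
  shows "x - y \<in> alt k D"
proof -
  have "x - y = x + fscale (\<lambda>_. -1) y" by (simp add: fun_eq_iff fun_apply)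
  then show ?thesis using alt_plus[OF assms(1) alt_fscale[OF smooth_const assms(2)]] by metis
qed

text \<open>Only vanishing at q is tracked, which spares the sign of the permutation; transpositions
  suffice.\<close>

lemma alt_permute_zero:
  assumes \<omega>: "\<omega> \<in> alt k D" and D: "module_on D" and \<sigma>: "\<sigma> permutes {..<k}"
    and xs: "length xs = k" "set xs \<subseteq> D" "\<omega> xs q = 0"
  shows "\<omega> (permute_list \<sigma> xs) q = 0"
  using \<sigma> finite_lessThan xs
proof (induction \<sigma> arbitrary: xs rule: permutes_induct)
  case id
  then show ?case by simp
next
  case (swap a b \<sigma>)
  let ?ys = "permute_list (Transposition.transpose a b) xs"
  have ab: "a < k" "b < k" using swap by auto
  have ys: "?ys = xs[a := xs ! b, b := xs ! a]"
    by (rule nth_equalityI)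
       (use ab swap in \<open>auto simp: permute_list_def nth_list_update Transposition.transpose_def\<close>)
  have D': "xs ! a \<in> D" "xs ! b \<in> D" using swap.prems ab by auto
  have "\<omega> ?ys = - \<omega> (xs[a := xs ! a, b := xs ! b])"
    unfolding ys using swap.prems ab swap.hyps D' by (intro alt_swap[OF \<omega> D]) auto
  then have "\<omega> ?ys q = 0" using swap.prems by (simp add: fun_apply)
  moreover have "length ?ys = k" "set ?ys \<subseteq> D" unfolding ys using swap.prems D' by (simp_all add: set_update_subsetI)
  ultimately have "\<omega> (permute_list \<sigma> ?ys) q = 0" by (rule swap.IH[rotated 2]) 
  then show ?case using swap by (subst permute_list_compose) simp_all
qed

lemma alt_frame_zero:
  assumes \<omega>: "\<omega> \<in> alt k D" and D: "module_on D" and F: "local_frame D W b c" and q: "q \<in> W"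
    and zero: "\<And>js. length js = k \<Longrightarrow> \<omega> (map b js) q = 0"
  shows "\<omega> xs q = 0"
proof -
  have b: "b j \<in> D" for j using F unfolding local_frame_def by blast
  \<comment> \<open>Induction on m: the positions from m on already hold frame members, and each
    step expands the argument at the last remaining position.\<close>
  have "\<omega> xs q = 0" if "m \<le> k" "length xs = k" "set xs \<subseteq> D" "\<And>i. m \<le> i \<Longrightarrow> i < k \<Longrightarrow> xs ! i \<in> range b" for m xs
    using that
  proof (induction m arbitrary: xs)
    case 0
    then have "\<forall>y\<in>set xs. \<exists>j. y = b j" by (fastforce simp: in_set_conv_nth)
    then obtain js where "xs = map b js" by (metis ex_map_conv)
    then show ?case using zero 0 by simp
  next
    case (Suc m)
    have m: "m < k" using Suc.prems by simp
    have "\<omega> (xs[m := b j]) q = 0" for j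
      by (rule Suc.IH) (use Suc.prems b in \<open>auto simp: nth_list_update dest!: set_update_subset_insert[THEN subsetD]\<close>)
    moreover have "xs ! m \<in> D" using Suc.prems m by auto
    ultimately show ?case
      using alt_frame[OF \<omega> D F q Suc.prems(2,3) m, of "xs ! m"] by simp
  qed
  from this[of k xs] show ?thesis
    using alt_outside[OF \<omega>, of xs] by (cases "length xs = k \<and> set xs \<subseteq> D") (auto simp: fun_apply)
qed

text \<open>A list of n frame members either repeats one of them or is a permutation of the
  enumeration ns.\<close>

lemma alt_top_zero:
  fixes ns :: "'n list"
  assumes \<omega>: "\<omega> \<in> alt CARD('n) D" and D: "module_on D" and F: "local_frame D W b c" and q: "q \<in> W"
    and ns: "distinct ns" "set ns = UNIV" and zero: "\<omega> (map b ns) q = 0"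
  shows "\<omega> xs q = 0"
proof (rule alt_frame_zero[OF \<omega> D F q])
  fix js :: "'n list" assume js: "length js = CARD('n)"
  have len: "length ns = CARD('n)" using ns distinct_card by fastforce
  show "\<omega> (map b js) q = 0"
  proof (cases "distinct js")
    case True
    then have "card (set js) = CARD('n)" using js distinct_card by fastforce
    then have "set js = UNIV" by (simp add: card_eq_UNIV_imp_eq_UNIV)
    then have "mset js = mset ns" using True ns by (simp add: set_eq_iff_mset_eq_distinct[symmetric])
    then obtain \<sigma> where \<sigma>: "\<sigma> permutes {..<length ns}" "permute_list \<sigma> ns = js"
      by (rule mset_eq_permutation)
    then have "map b js = permute_list \<sigma> (map b ns)" by (simp add: permute_list_map)
    then show ?thesis
      using alt_permute_zero[OF \<omega> D _ _ _ zero, of \<sigma>] \<sigma>(1) len F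
      by (auto simp: local_frame_def)
  next
    case False
    then obtain i j where "i < length js" "j < length js" "i \<noteq> j" "js ! i = js ! j"
      by (auto simp: distinct_conv_nth)
    then show ?thesis using alt_repeat[OF \<omega>, of i j "map b js"] js by (simp add: fun_apply)
  qed
qed

section \<open>One-forms and dual frames\<close>

lemma df_apply: "X \<in> vfields \<Longrightarrow> ext_d (form0 f) [X] = X f"
  by (simp add: ext_d_def form0_def omit_def psign_def fun_eq_iff fun_apply)

lemma df_form: 
  assumes f: "f \<in> smooth_funs"
  shows "ext_d (form0 f) \<in> forms 1"
  unfolding forms_def
proof (rule altI)
  fix Xs :: "'m vfield list" assume *: "\<not> (length Xs = 1 \<and> set Xs \<subseteq> vfields)"
  show "ext_d (form0 f) Xs = 0"
  proof (cases "set Xs \<subseteq> vfields")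
    case True
    with * have len: "length Xs \<noteq> 1" by simp
    \<comment> \<open>Off length 1 every \<open>omit i Xs\<close> is nonempty, and there
      \<open>form0 f\<close> vanishes.\<close>
    have "psign i * (Xs ! i) (form0 f (omit i Xs)) = 0" if "i < length Xs" for i
    proof -
      have "length (omit i Xs) \<noteq> 0" using that len by (simp; linarith)
      then have "form0 f (omit i Xs) = 0" by (auto simp: form0_def)
      moreover have "(Xs ! i) 0 = 0" using True that by (intro vfield_zero) auto
      ultimately show ?thesis by simp
    qed
    then show ?thesis by (simp add: ext_d_def) (simp add: form0_def)
  next
    case False
    then show ?thesis by (simp add: ext_d_def)
  qed
next
  fix xs :: "'m vfield list" assume "length xs = 1" "set xs \<subseteq> vfields"
  then obtain X where X: "xs = [X]" "X \<in> vfields" by (cases xs) auto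
  show "ext_d (form0 f) xs \<in> smooth_funs" using X f by (simp add: df_apply)
  show "ext_d (form0 f) (xs[i := xs ! i + v]) = ext_d (form0 f) xs + ext_d (form0 f) (xs[i := v])"
    if "i < 1" "v \<in> vfields" for i v using X that by (simp add: df_apply fun_apply fun_eq_iff)
  show "ext_d (form0 f) (xs[i := fscale g (xs ! i)]) = g * ext_d (form0 f) xs"
    if "i < 1" "g \<in> smooth_funs" for i g using X that by (simp add: df_apply fun_apply fun_eq_iff)
qed (auto simp: df_apply)

lemma forms_outside: "\<omega> \<in> forms k \<Longrightarrow> \<not> (length xs = k \<and> set xs \<subseteq> vfields) \<Longrightarrow> \<omega> xs = 0"
  unfolding forms_def by (rule alt_outside)

lemma form_smooth [simp]: "\<omega> \<in> forms k \<Longrightarrow> \<omega> xs \<in> smooth_funs"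
  unfolding forms_def by simp

lemma form1_eqI:
  assumes "\<alpha> \<in> forms 1" "\<beta> \<in> forms 1" "\<And>X. X \<in> vfields \<Longrightarrow> \<alpha> [X] = \<beta> [X]"
  shows "\<alpha> = \<beta>"
proof
  fix xs
  show "\<alpha> xs = \<beta> xs"
  proof (cases "length xs = 1 \<and> set xs \<subseteq> vfields")
    case True
    then show ?thesis using assms(3) by (cases xs) auto
  next
    case False
    then show ?thesis using forms_outside[OF assms(1)] forms_outside[OF assms(2)] by simp
  qed
qed

text \<open>Differentials of functions suffice as test forms.\<close>

lemma vfield_eqI:
  assumes "X \<in> vfields" "Y \<in> vfields" "\<And>\<beta>. \<beta> \<in> forms 1 \<Longrightarrow> \<beta> [X] = \<beta> [Y]"
  shows "X = Y"
proof
  fix f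
  show "X f = Y f"
    using assms(3)[OF df_form, of f] vfield_outside[OF assms(1), of f] vfield_outside[OF assms(2), of f] assms(1,2)
    by (cases "f \<in> smooth_funs") (simp_all add: df_apply)
qed

lemma module_forms: "module_on (forms k)"
  unfolding forms_def by (rule module_alt)

lemma forms_plus [simp]: "x \<in> forms k \<Longrightarrow> y \<in> forms k \<Longrightarrow> x + y \<in> forms k"
  and forms_minus [simp]: "x \<in> forms k \<Longrightarrow> y \<in> forms k \<Longrightarrow> x - y \<in> forms k"
  and forms_fscale [simp]: "f \<in> smooth_funs \<Longrightarrow> x \<in> forms k \<Longrightarrow> fscale f x \<in> forms k"
  unfolding forms_def by (simp_all add: alt_plus alt_minus alt_fscale)

lemma form1_add: "\<alpha> \<in> forms 1 \<Longrightarrow> X \<in> vfields \<Longrightarrow> Y \<in> vfields \<Longrightarrow> \<alpha> [X + Y] = \<alpha> [X] + \<alpha> [Y]"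
  using alt_add[of \<alpha> 1 vfields "[X]" 0 X Y] by (simp add: forms_def)

lemma form1_scale: "\<alpha> \<in> forms 1 \<Longrightarrow> X \<in> vfields \<Longrightarrow> f \<in> smooth_funs \<Longrightarrow> \<alpha> [fscale f X] = f * \<alpha> [X]"
  using alt_scale[of \<alpha> 1 vfields "[X]" 0 X f] by (simp add: forms_def)

definition coframed :: "'m set \<Rightarrow> ('n \<Rightarrow> 'm vfield) \<Rightarrow> ('n \<Rightarrow> 'm form) \<Rightarrow> bool" where
  "coframed W e \<epsilon> \<longleftrightarrow> local_frame vfields W e (\<lambda>X i. \<epsilon> i [X]) \<and> local_frame (forms 1) W \<epsilon> (\<lambda>\<beta> i. \<beta> [e i]) \<and>
     (\<forall>q\<in>W. \<forall>i j. \<epsilon> i [e j] q = (if i = j then 1 else 0))"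

text \<open>The coframe is kept in the exact form dx_i: whatever is known on differentials of
  functions can then be carried over to the coframe, and from there to all 1-forms.\<close>

lemma exists_frame:
  obtains W e x where "p \<in> W" "\<And>i. x i \<in> smooth_funs" "coframed W e (\<lambda>i. ext_d (form0 (x i)))"
proof -
  obtain W e x where W: "open W" "p \<in> W" and e: "\<And>i::'n. e i \<in> vfields" and x: "\<And>i. x i \<in> smooth_funs"
    and ex: "\<And>i j q. q \<in> W \<Longrightarrow> e i (x j) q = (if i = j then 1 else 0)"
    and exp: "\<And>X f q. X \<in> vfields \<Longrightarrow> f \<in> smooth_funs \<Longrightarrow> q \<in> W \<Longrightarrow> X f q = (\<Sum>i\<in>UNIV. X (x i) q * e i f q)"
    by (rule exists_coordinates[of p]) blast
  define \<epsilon> where "\<epsilon> i = ext_d (form0 (x i))" for i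
  have \<epsilon>: "\<epsilon> i \<in> forms 1" for i using df_form[OF x] by (simp add: \<epsilon>_def)
  have 1: "local_frame vfields W e (\<lambda>X i. \<epsilon> i [X])"
    unfolding local_frame_def
  proof (intro conjI ballI allI)
    fix X q f assume X: "X \<in> vfields" and q: "q \<in> W"
    show "X f q = (\<Sum>i\<in>UNIV. \<epsilon> i [X] q * e i f q)"
    proof (cases "f \<in> smooth_funs")
      case True
      then show ?thesis using exp[OF X _ q] X by (simp add: \<epsilon>_def df_apply)
    next
      case False
      then show ?thesis using vfield_outside[OF X] vfield_outside[OF e] by (simp add: fun_apply)
    qed
  qed (use W e \<epsilon> form_smooth in blast)+
  have "local_frame (forms 1) W \<epsilon> (\<lambda>\<beta> i. \<beta> [e i])"
    unfolding local_frame_def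
  proof (intro conjI ballI allI)
    fix \<beta> q xs assume \<beta>: "\<beta> \<in> forms 1" and q: "q \<in> W"
    show "\<beta> xs q = (\<Sum>i\<in>UNIV. \<beta> [e i] q * \<epsilon> i xs q)"
    proof (cases "length xs = 1 \<and> set xs \<subseteq> vfields")
      case True
      then obtain X where X: "xs = [X]" "X \<in> vfields" by (cases xs) auto
      then show ?thesis
        using alt_frame[OF \<beta>[unfolded forms_def] module_vfields 1 q, of "[X]" 0 X] by (simp add: mult.commute)
    next
      case False
      then show ?thesis using forms_outside[OF \<beta>] forms_outside[OF \<epsilon>] by (simp add: fun_apply)
    qed
  qed (use W e \<epsilon> form_smooth in blast)+
  with 1 have "coframed W e \<epsilon>"
    unfolding coframed_def using ex e by (auto simp: \<epsilon>_def df_apply)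
  then show thesis using that W x unfolding \<epsilon>_def by blast
qed

lemma exists_coframe:
  obtains W e \<epsilon> where "p \<in> W" "coframed W e \<epsilon>"
  by (rule exists_frame[of p]) blast

lemma coframedD:
  assumes "coframed W e \<epsilon>"
  shows "open W" "e i \<in> vfields" "\<epsilon> i \<in> forms 1"
    "q \<in> W \<Longrightarrow> \<epsilon> i [e j] q = (if i = j then 1 else 0)"
    "local_frame vfields W e (\<lambda>X i. \<epsilon> i [X])" "local_frame (forms 1) W \<epsilon> (\<lambda>\<beta> i. \<beta> [e i])"
  using assms unfolding coframed_def local_frame_def by auto

lemma coframed_pairing:
  assumes "coframed W e \<epsilon>" "q \<in> W" "\<beta> \<in> forms 1" "X \<in> vfields"
  shows "\<beta> [X] q = (\<Sum>i\<in>UNIV. \<beta> [e i] q * \<epsilon> i [X] q)"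
  using coframedD(6)[OF assms(1)] assms(2,3) unfolding local_frame_def by blast

lemma coframed_apply:
  assumes "coframed W e \<epsilon>" "q \<in> W" "X \<in> vfields"
  shows "X f q = (\<Sum>i\<in>UNIV. \<epsilon> i [X] q * e i f q)"
  using coframedD(5)[OF assms(1)] assms(2,3) unfolding local_frame_def by blast

text \<open>On exact forms T gives the derivation that takes f to T(df). Near each point some exact
  forms make up a coframe and T is pointwise, so the equation extends to all 1-forms. Vector fields
  defined below by their pairings, such as \<open>sharp\<close>, \<open>mod_X\<close> and
  \<open>dual_tensor\<close>, exist by this lemma.\<close>

lemma vfield_of_functional:
  assumes T: "\<And>\<beta>. \<beta> \<in> forms 1 \<Longrightarrow> T \<beta> \<in> smooth_funs"
    "\<And>\<alpha> \<beta>. \<alpha> \<in> forms 1 \<Longrightarrow> \<beta> \<in> forms 1 \<Longrightarrow> T (\<alpha> + \<beta>) = T \<alpha> + T \<beta>"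
    "\<And>f \<beta>. f \<in> smooth_funs \<Longrightarrow> \<beta> \<in> forms 1 \<Longrightarrow> T (fscale f \<beta>) = f * T \<beta>"
  shows "\<exists>!X. X \<in> vfields \<and> (\<forall>\<beta>\<in>forms 1. \<beta> [X] = T \<beta>)"
proof (rule ex_ex1I)
  let ?d = "\<lambda>f. ext_d (form0 f)"
  define X where "X f = (if f \<in> smooth_funs then T (?d f) else 0)" for f
  have dadd: "?d (f + g) = ?d f + ?d g" if "f \<in> smooth_funs" "g \<in> smooth_funs" for f g
    using that by (intro form1_eqI forms_plus df_form smooth_add) (auto simp: df_apply vfield_add fun_apply)
  have dmult: "?d (f * g) = fscale g (?d f) + fscale f (?d g)" if "f \<in> smooth_funs" "g \<in> smooth_funs" for f g
    using that by (intro form1_eqI forms_plus forms_fscale df_form smooth_mult) (auto simp: df_apply vfield_mult fun_apply algebra_simps)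
  have dcmult: "?d (\<lambda>p. c * f p) = fscale (\<lambda>_. c) (?d f)" if "f \<in> smooth_funs" for f c
    using that by (intro form1_eqI forms_fscale df_form smooth_cmult smooth_const) (auto simp: df_apply vfield_cmult fun_eq_iff fun_apply)
  have X: "X \<in> vfields"
    unfolding vfields_def mem_Collect_eq
  proof (intro conjI ballI allI impI)
    show "X f = 0" if "f \<notin> smooth_funs" for f using that by (simp add: X_def)
    show "X f \<in> smooth_funs" if "f \<in> smooth_funs" for f using that by (simp add: X_def T df_form)
    fix f g assume "f \<in> smooth_funs" "g \<in> smooth_funs"
    then show "X (f + g) = X f + X g" "X (f * g) = X f * g + f * X g"
      by (simp_all add: X_def dadd dmult T df_form fun_eq_iff fun_apply algebra_simps)
  next
    fix f c assume "f \<in> smooth_funs"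
    then show "X (\<lambda>p. c * f p) = (\<lambda>p. c * X f p)"
      by (simp add: X_def dcmult T df_form fun_eq_iff fun_apply)
  qed
  have "\<beta> [X] = T \<beta>" if \<beta>: "\<beta> \<in> forms 1" for \<beta>
  proof
    fix p
    \<comment> \<open>T is repackaged as an alternating map of degree 1, to which the frame
      expansion applies.\<close>
    define P where "P \<alpha>s = (if length \<alpha>s = 1 \<and> set \<alpha>s \<subseteq> forms 1 then T (hd \<alpha>s) else 0)" for \<alpha>s
    have P: "P \<in> alt 1 (forms 1)"
    proof (rule altI)
      fix \<alpha>s :: "'m form list" assume "length \<alpha>s = 1" "set \<alpha>s \<subseteq> forms 1"
      then obtain \<alpha> where \<alpha>: "\<alpha>s = [\<alpha>]" "\<alpha> \<in> forms 1" by (cases \<alpha>s) auto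
      show "P \<alpha>s \<in> smooth_funs" using \<alpha> T by (simp add: P_def)
      show "P (\<alpha>s[i := \<alpha>s ! i + v]) = P \<alpha>s + P (\<alpha>s[i := v])" if "i < 1" "v \<in> forms 1" for i v
        using \<alpha> T that by (simp add: P_def)
      show "P (\<alpha>s[i := fscale f (\<alpha>s ! i)]) = f * P \<alpha>s" if "i < 1" "f \<in> smooth_funs" for i f
        using \<alpha> T that by (simp add: P_def)
    qed (auto simp: P_def T)
    obtain W e \<epsilon> where W: "p \<in> W" and fr: "coframed W e \<epsilon>"
      and X\<epsilon>: "\<And>i. \<epsilon> i [X] = T (\<epsilon> i)"
    proof -
      obtain W e x where "p \<in> W" and x: "\<And>i. x i \<in> smooth_funs"
        and fr: "coframed W e (\<lambda>i. ext_d (form0 (x i)))" by (rule exists_frame[of p]) blast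
      then show thesis using that[of W e "\<lambda>i. ext_d (form0 (x i))"] by (simp add: df_apply X) (simp add: X_def)
    qed
    have "\<beta> [X] p = (\<Sum>i\<in>UNIV. \<beta> [e i] p * T (\<epsilon> i) p)"
      using coframed_pairing[OF fr W \<beta> X] by (simp add: X\<epsilon>)
    also have "\<dots> = T \<beta> p"
      using alt_frame[OF P module_forms coframedD(6)[OF fr] W, of "[\<beta>]" 0 \<beta>] \<beta> coframedD(3)[OF fr]
      by (simp add: P_def)
    finally show "\<beta> [X] p = T \<beta> p" .
  qed
  then show "\<exists>X. X \<in> vfields \<and> (\<forall>\<beta>\<in>forms 1. \<beta> [X] = T \<beta>)" using X by blast
qed (metis vfield_eqI)

section \<open>Derivations acting on forms\<close>

lemma form_add:
  "\<omega> \<in> forms k \<Longrightarrow> length xs = k \<Longrightarrow> set xs \<subseteq> vfields \<Longrightarrow> i < k \<Longrightarrow> x \<in> vfields \<Longrightarrow> v \<in> vfields \<Longrightarrow>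
    \<omega> (xs[i := x + v]) = \<omega> (xs[i := x]) + \<omega> (xs[i := v])"
  and form_scale:
  "\<omega> \<in> forms k \<Longrightarrow> length xs = k \<Longrightarrow> set xs \<subseteq> vfields \<Longrightarrow> i < k \<Longrightarrow> x \<in> vfields \<Longrightarrow> f \<in> smooth_funs \<Longrightarrow>
    \<omega> (xs[i := fscale f x]) = f * \<omega> (xs[i := x])"
  unfolding forms_def by (rule alt_add alt_scale; assumption)+

text \<open>When an argument is multiplied by f, the term a(f) \<omega> from differentiating the
  value cancels the one from the Leibniz rule of T. On equal arguments only two summands can be
  nonzero, and they cancel by antisymmetry.\<close>

lemma dact_form:
  assumes T: "module_derivation a T" and \<omega>: "\<omega> \<in> forms k"
  shows "dact a T \<omega> \<in> forms k"
proof -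
  let ?S = "\<lambda>Ys. \<Sum>i<k. \<omega> (Ys[i := T (Ys ! i)])"
  have a: "a \<in> vfields" and TV: "\<And>X. X \<in> vfields \<Longrightarrow> T X \<in> vfields"
    and Tadd: "\<And>X Y. X \<in> vfields \<Longrightarrow> Y \<in> vfields \<Longrightarrow> T (X + Y) = T X + T Y"
    and Tscale: "\<And>f X. f \<in> smooth_funs \<Longrightarrow> X \<in> vfields \<Longrightarrow> T (fscale f X) = fscale f (T X) + fscale (a f) X"
    using T unfolding module_derivation_def by blast+
  have split: "?S (Ys[i := u]) = \<omega> (Ys[i := T u]) + (\<Sum>j\<in>{..<k} - {i}. \<omega> (Ys[j := T (Ys ! j), i := u]))"
    if "length Ys = k" "i < k" for Ys i u
  proof -
    have "?S (Ys[i := u]) = \<omega> (Ys[i := u, i := T (Ys[i := u] ! i)])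
        + (\<Sum>j\<in>{..<k} - {i}. \<omega> (Ys[i := u, j := T (Ys[i := u] ! j)]))"
      using that by (simp add: sum.remove[of _ i])
    moreover have "(\<Sum>j\<in>{..<k} - {i}. \<omega> (Ys[i := u, j := T (Ys[i := u] ! j)]))
        = (\<Sum>j\<in>{..<k} - {i}. \<omega> (Ys[j := T (Ys ! j), i := u]))"
      by (intro sum.cong refl) (auto simp: list_update_swap)
    ultimately show ?thesis using that by simp
  qed
  have split0: "?S Ys = \<omega> (Ys[i := T (Ys ! i)]) + (\<Sum>j\<in>{..<k} - {i}. \<omega> (Ys[j := T (Ys ! j)]))"
    if "i < k" for Ys i
    using that by (simp add: sum.remove[of _ i])
  show ?thesis
    unfolding forms_def
  proof (rule altI)
    fix Ys :: "'m vfield list" assume *: "\<not> (length Ys = k \<and> set Ys \<subseteq> vfields)"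
    then have "\<omega> Ys = 0" "length Ys \<noteq> k \<Longrightarrow> \<omega> (Ys[i := u]) = 0" for i u
      using forms_outside[OF \<omega>] by auto
    then show "dact a T \<omega> Ys = 0" using * a by (auto simp: dact_def)
  next
    fix Ys :: "'m vfield list" assume len: "length Ys = k" and Ys: "set Ys \<subseteq> vfields"
    have D: "dact a T \<omega> Zs = a (\<omega> Zs) - ?S Zs" if "length Zs = k" "set Zs \<subseteq> vfields" for Zs
      using that by (simp add: dact_def)
    have upd: "set (Ys[j := T (Ys ! j)]) \<subseteq> vfields" if "j < k" for j
      using that Ys len by (intro set_update_subsetI TV) auto
    show "dact a T \<omega> Ys \<in> smooth_funs"
      using \<omega> a by (simp add: D[OF len Ys])
    fix i assume i: "i < k"
    have Yi: "Ys ! i \<in> vfields" using i len Ys by auto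
    have rest: "\<omega> (Ys[j := T (Ys ! j), i := Ys ! i]) = \<omega> (Ys[j := T (Ys ! j)])" if "j \<in> {..<k} - {i}" for j
      using that by (metis DiffD2 list_update_id list_update_swap nth_list_update_neq singletonI)
    show "dact a T \<omega> (Ys[i := Ys ! i + v]) = dact a T \<omega> Ys + dact a T \<omega> (Ys[i := v])"
      if v: "v \<in> vfields" for v
    proof -
      have "?S (Ys[i := Ys ! i + v]) = \<omega> (Ys[i := T (Ys ! i)]) + \<omega> (Ys[i := T v])
          + (\<Sum>j\<in>{..<k} - {i}. \<omega> (Ys[j := T (Ys ! j)]) + \<omega> (Ys[j := T (Ys ! j), i := v]))"
        using len upd rest Yi v
        by (simp add: split[OF len i] Tadd form_add[OF \<omega> len Ys i TV[OF Yi] TV[OF v]]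
            form_add[OF \<omega> _ _ i Yi v])
      also have "\<dots> = ?S Ys + ?S (Ys[i := v])"
        unfolding split[OF len i] split0[OF i, of Ys] by (simp add: sum.distrib algebra_simps)
      finally have "?S (Ys[i := Ys ! i + v]) = ?S Ys + ?S (Ys[i := v])" .
      moreover have "a (\<omega> (Ys[i := Ys ! i + v])) = a (\<omega> Ys) + a (\<omega> (Ys[i := v]))"
        using form_add[OF \<omega> len Ys i Yi v] a \<omega> by (simp add: vfield_add)
      ultimately show ?thesis
        using len Ys Yi v by (simp add: D set_update_subsetI)
    qed
    show "dact a T \<omega> (Ys[i := fscale f (Ys ! i)]) = f * dact a T \<omega> Ys"
      if f: "f \<in> smooth_funs" for f
    proof -
      have fi: "fscale f (T (Ys ! i)) \<in> vfields" "fscale (a f) (Ys ! i) \<in> vfields" "a f \<in> smooth_funs"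
        using f a Yi TV by auto
      have "?S (Ys[i := fscale f (Ys ! i)]) = f * \<omega> (Ys[i := T (Ys ! i)]) + a f * \<omega> Ys
          + (\<Sum>j\<in>{..<k} - {i}. f * \<omega> (Ys[j := T (Ys ! j)]))"
        using len upd rest Yi f fi
        by (simp add: split[OF len i] Tscale form_add[OF \<omega> len Ys i fi(1,2)]
            form_scale[OF \<omega> len Ys i TV[OF Yi] f] form_scale[OF \<omega> len Ys i Yi fi(3)]
            form_scale[OF \<omega> _ _ i Yi f])
      also have "\<dots> = f * ?S Ys + a f * \<omega> Ys"
        unfolding split0[OF i, of Ys] by (simp add: sum_distrib_left algebra_simps)
      finally have "?S (Ys[i := fscale f (Ys ! i)]) = f * ?S Ys + a f * \<omega> Ys" .
      moreover have "a (\<omega> (Ys[i := fscale f (Ys ! i)])) = a f * \<omega> Ys + f * a (\<omega> Ys)"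
        using form_scale[OF \<omega> len Ys i Yi f] a \<omega> f by (simp add: vfield_mult)
      ultimately show ?thesis
        using len Ys Yi f by (simp add: D set_update_subsetI) (simp only: algebra_simps)
    qed
    show "dact a T \<omega> Ys = 0" if ji: "j < i" and eq: "Ys ! i = Ys ! j" for j
    proof -
      have j: "j < k" "i \<noteq> j" using i ji by auto
      have rep: "\<omega> Zs = 0" if "Zs ! i = Zs ! j" for Zs
        using alt_repeat[OF \<omega>[unfolded forms_def] i j that] .
      have "(\<Sum>l\<in>{..<k} - {i} - {j}. \<omega> (Ys[l := T (Ys ! l)])) = 0"
        by (intro sum.neutral ballI rep) (auto simp: eq)
      then have "?S Ys = \<omega> (Ys[i := T (Ys ! i)]) + \<omega> (Ys[j := T (Ys ! j)])"
        using i j by (simp add: sum.remove[of _ i] sum.remove[of _ j])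
      moreover have "Ys[i := T (Ys ! i)] = Ys[i := T (Ys ! i), j := Ys ! i]"
          "Ys[j := T (Ys ! j)] = Ys[i := Ys ! i, j := T (Ys ! i)]"
        using j eq by (metis list_update_id nth_list_update_neq)+
      ultimately have "?S Ys = 0"
        using alt_swap[OF \<omega>[unfolded forms_def] module_vfields len Ys i j TV[OF Yi] Yi] by simp
      then show ?thesis using rep[OF eq] a by (simp add: D[OF len Ys])
    qed
  qed
qed

lemma lie_d_dact: "lie_d X = dact X (vbracket X)"
  by (simp add: lie_d_def dact_def fun_eq_iff)

lemma vbracket_fscale_right:
  assumes "X \<in> vfields" "Y \<in> vfields" "f \<in> smooth_funs"
  shows "vbracket X (fscale f Y) = fscale f (vbracket X Y) + fscale (X f) Y"
proof
  fix g
  show "vbracket X (fscale f Y) g = (fscale f (vbracket X Y) + fscale (X f) Y) g"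
  proof (cases "g \<in> smooth_funs")
    case True
    then show ?thesis using assms
      by (simp add: vbracket_def vfield_mult fun_apply fun_eq_iff algebra_simps)
  next
    case False
    have "vbracket X (fscale f Y) \<in> vfields" "fscale f (vbracket X Y) + fscale (X f) Y \<in> vfields"
      using assms by auto
    then show ?thesis using False by (metis vfield_outside)
  qed
qed

lemma vbracket_add_right:
  assumes "X \<in> vfields" "Y \<in> vfields" "Z \<in> vfields"
  shows "vbracket X (Y + Z) = vbracket X Y + vbracket X Z"
proof
  fix g
  show "vbracket X (Y + Z) g = (vbracket X Y + vbracket X Z) g"
  proof (cases "g \<in> smooth_funs")
    case True
    then show ?thesis using assms
      by (simp add: vbracket_def vfield_add fun_apply fun_eq_iff algebra_simps)
  next
    case False
    have "vbracket X (Y + Z) \<in> vfields" "vbracket X Y + vbracket X Z \<in> vfields"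
      using assms by auto
    then show ?thesis using False by (metis vfield_outside)
  qed
qed

lemma vbracket_swap: "vbracket X Y = - vbracket Y X"
  by (simp add: vbracket_def fun_eq_iff fun_apply)

lemma module_derivation_vbracket: "X \<in> vfields \<Longrightarrow> module_derivation X (vbracket X)"
  unfolding module_derivation_def by (auto simp: vbracket_fscale_right vbracket_add_right)

lemma lie_d_form [simp]: "X \<in> vfields \<Longrightarrow> \<omega> \<in> forms k \<Longrightarrow> lie_d X \<omega> \<in> forms k"
  unfolding lie_d_dact using dact_form[OF module_derivation_vbracket] .

lemma dact_fscale:
  assumes "a \<in> vfields" "\<omega> \<in> forms k" "f \<in> smooth_funs"
  shows "dact a T (fscale f \<omega>) = fscale (a f) \<omega> + fscale f (dact a T \<omega>)"
proof
  fix Ys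
  show "dact a T (fscale f \<omega>) Ys = (fscale (a f) \<omega> + fscale f (dact a T \<omega>)) Ys"
    using assms forms_outside[OF assms(2), of Ys]
    by (simp add: dact_def vfield_mult fun_apply fun_eq_iff sum_distrib_left algebra_simps)
qed

text \<open>\<open>dact\<close> is additive in symbol and operator together; with one symbol 0 this
  splits off the action of an endomorphism.\<close>

lemma dact_add:
  assumes "\<omega> \<in> forms k" "\<And>X. X \<in> vfields \<Longrightarrow> T X \<in> vfields" "\<And>X. X \<in> vfields \<Longrightarrow> T' X \<in> vfields"
  shows "dact (a + a') (\<lambda>X. T X + T' X) \<omega> = dact a T \<omega> + dact a' T' \<omega>"
proof
  fix Ys
  show "dact (a + a') (\<lambda>X. T X + T' X) \<omega> Ys = (dact a T \<omega> + dact a' T' \<omega>) Ys"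
  proof (cases "length Ys = k \<and> set Ys \<subseteq> vfields")
    case True
    then have "\<omega> (Ys[i := T (Ys ! i) + T' (Ys ! i)]) = \<omega> (Ys[i := T (Ys ! i)]) + \<omega> (Ys[i := T' (Ys ! i)])"
      if "i < k" for i
    proof -
      have "Ys ! i \<in> vfields" using True that by auto
      then show ?thesis using True that assms by (intro form_add[OF assms(1)]) auto
    qed
    then show ?thesis using True by (simp add: dact_def fun_apply fun_eq_iff sum.distrib algebra_simps)
  next
    case False
    show ?thesis
    proof (cases "set Ys \<subseteq> vfields")
      case True
      then have "\<omega> (Ys[i := u]) = 0" "\<omega> Ys = 0" for i u
        using False forms_outside[OF assms(1)] by auto
      then show ?thesis by (simp add: dact_def fun_apply fun_eq_iff)
    qed (simp add: dact_def fun_apply fun_eq_iff)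
  qed
qed

text \<open>Operators are compared on actual vector fields only, which is as far as identities such
  as the Leibniz rule of the bracket reach.\<close>

lemma dact_cong:
  assumes "\<And>f. a f = a' f" "\<And>X. X \<in> vfields \<Longrightarrow> T X = T' X"
  shows "dact a T \<omega> = dact a' T' \<omega>"
proof
  fix Ys
  have "T (Ys ! i) = T' (Ys ! i)" if "set Ys \<subseteq> vfields" "i < length Ys" for i
    using that assms(2)[OF subsetD[OF _ nth_mem]] by blast
  then show "dact a T \<omega> Ys = dact a' T' \<omega> Ys" using assms(1) by (simp add: dact_def)
qed

section \<open>Top forms\<close>

lemma open_nonzero:
  assumes "f \<in> smooth_funs"
  shows "open {y. f y \<noteq> 0}"
proof (subst open_subopen, safe)
  fix p assume p: "f p \<noteq> 0"
  obtain U \<phi> where U: "(U, \<phi>) \<in> atlas" "p \<in> U" using chart_at .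
  have "smooth_on (\<phi> ` U) (f \<circ> inv_into U \<phi>)"
    using assms U(1) unfolding smooth_funs_def by blast
  then have "continuous_on (\<phi> ` U) (f \<circ> inv_into U \<phi>)"
    unfolding smooth_on_def using Ck_on.simps(1) by blast
  then have "open (\<phi> ` U \<inter> (f \<circ> inv_into U \<phi>) -` (- {0}))"
    by (rule continuous_open_preimage[OF _ chart(2)[OF U(1)]]) auto
  note T = chart_open_preimage[OF U(1) this]
  show "\<exists>T. open T \<and> p \<in> T \<and> T \<subseteq> {y. f y \<noteq> 0}"
    by (rule exI, rule conjI, rule T) (use p U chart_inj[OF U(1)] in fastforce)
qed

text \<open>With a bump \<kappa> that vanishes wherever h does, k = (\<kappa> h)^2 + (1 -
  \<kappa>)^2 has no zeros on M and equals h^2 where \<kappa> = 1. So h / k is smooth on M and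
  equals 1/h there.\<close>

lemma smooth_local_inverse:
  assumes "h \<in> smooth_funs" "h p \<noteq> 0"
  obtains g N where "g \<in> smooth_funs" "open N" "p \<in> N" "\<And>y. y \<in> N \<Longrightarrow> g y = inverse (h y)"
proof -
  obtain \<kappa> N where \<kappa>: "\<kappa> \<in> smooth_funs" "open N" "p \<in> N" "\<And>y. y \<in> N \<Longrightarrow> \<kappa> y = 1"
      "\<And>y. y \<notin> {y. h y \<noteq> 0} \<Longrightarrow> \<kappa> y = 0" "N \<subseteq> {y. h y \<noteq> 0}"
    by (rule exists_bump[OF open_nonzero[OF assms(1)], of p]) (use assms(2) in auto)
  define k where "k = \<kappa> * h * (\<kappa> * h) + ((\<lambda>_. 1) - \<kappa>) * ((\<lambda>_. 1) - \<kappa>)"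
  have k: "k \<in> smooth_funs" using \<kappa> assms by (simp add: k_def)
  have "k y \<noteq> 0" for y
  proof (cases "\<kappa> y * h y = 0")
    case True
    then have "\<kappa> y = 0" using \<kappa>(5) by auto
    then show ?thesis by (simp add: k_def fun_apply)
  next
    case False
    then have "0 < (\<kappa> y * h y) * (\<kappa> y * h y)" using not_real_square_gt_zero by blast
    moreover have "0 \<le> (1 - \<kappa> y) * (1 - \<kappa> y)" by simp
    moreover have "k y = (\<kappa> y * h y) * (\<kappa> y * h y) + (1 - \<kappa> y) * (1 - \<kappa> y)"
      by (simp add: k_def fun_apply)
    ultimately show ?thesis by linarith
  qed
  from smooth_inverse[OF k this] assms(1) have "h * (\<lambda>p. inverse (k p)) \<in> smooth_funs" by simp
  moreover have "(h * (\<lambda>p. inverse (k p))) y = inverse (h y)" if "y \<in> N" for y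
    using \<kappa>(4)[OF that] \<kappa>(6) that by (auto simp: k_def fun_apply)
  ultimately show thesis using that \<kappa> by blast
qed

text \<open>For a top form \<mu> and a volume form the chosen arguments do not influence the
  quotient, since top forms are proportional at each point. The choice avoids fixing a
  frame.\<close>

definition ratio :: "'m form \<Rightarrow> 'm form \<Rightarrow> 'm scalar" where
  "ratio \<mu> vol p = (let Ys = (SOME Ys. vol Ys p \<noteq> 0) in \<mu> Ys p / vol Ys p)"

lemma volume_formD: "volume_form vol \<Longrightarrow> vol \<in> forms CARD('n)" "volume_form vol \<Longrightarrow> \<exists>Ys. vol Ys p \<noteq> 0"
  unfolding volume_form_def by blast+

lemma exists_enum: obtains ns :: "'n list" where "distinct ns" "set ns = UNIV" "length ns = CARD('n)"
  using finite_distinct_list[of "UNIV :: 'n set"] distinct_card by fastforce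

context
  fixes W e \<epsilon> and ns :: "'n list"
  assumes fr: "coframed W e \<epsilon>" and ns: "distinct ns" "set ns = UNIV"
begin

lemma top_form_frame_zero:
  "\<mu> \<in> forms CARD('n) \<Longrightarrow> q \<in> W \<Longrightarrow> \<mu> (map e ns) q = 0 \<Longrightarrow> \<mu> Ys q = 0"
  unfolding forms_def by (rule alt_top_zero[OF _ module_vfields coframedD(5)[OF fr] _ ns])

lemma volume_frame_nonzero: "volume_form vol \<Longrightarrow> q \<in> W \<Longrightarrow> vol (map e ns) q \<noteq> 0"
  using top_form_frame_zero volume_formD by blast

text \<open>The difference of the two sides is, as a function of Ys, a top form that vanishes on the
  frame.\<close>

lemma top_form_frame:
  assumes "\<mu> \<in> forms CARD('n)" "\<nu> \<in> forms CARD('n)" "q \<in> W"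
  shows "\<nu> (map e ns) q * \<mu> Ys q = \<mu> (map e ns) q * \<nu> Ys q"
proof -
  let ?\<eta> = "fscale (\<nu> (map e ns)) \<mu> - fscale (\<mu> (map e ns)) \<nu>"
  have "?\<eta> \<in> forms CARD('n)" using assms by simp
  from top_form_frame_zero[OF this assms(3), of Ys] show ?thesis by (simp add: fun_apply)
qed

lemma ratio_frame:
  assumes "volume_form vol" "\<mu> \<in> forms CARD('n)" "q \<in> W"
  shows "ratio \<mu> vol q = \<mu> (map e ns) q * inverse (vol (map e ns) q)"
proof -
  define Ys where "Ys = (SOME Ys. vol Ys q \<noteq> 0)"
  have "vol Ys q \<noteq> 0" unfolding Ys_def using volume_formD(2)[OF assms(1)] by (rule someI_ex)
  then show ?thesis
    using top_form_frame[OF assms(2) volume_formD(1)[OF assms(1)] assms(3), of Ys]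
      volume_frame_nonzero[OF assms(1,3)]
    by (simp add: ratio_def Ys_def[symmetric] field_simps)
qed

lemma sum_enum: "(\<Sum>i<length ns. f (ns ! i)) = (\<Sum>i\<in>UNIV. f i)"
  by (rule sum.reindex_bij_betw) (use bij_betw_nth[OF ns(1)] ns(2) in auto)

text \<open>When V e_i replaces e_i among the arguments, all its components except the one along e_i
  repeat a frame vector and drop out. So endomorphisms act on top forms as minus the trace, the sign
  being that of a dual action.\<close>

lemma dact_linear_frame:
  assumes V: "module_derivation 0 V" and \<mu>: "\<mu> \<in> forms CARD('n)" and q: "q \<in> W"
  shows "dact 0 V \<mu> (map e ns) q = - (\<Sum>i\<in>UNIV. \<epsilon> i [V (e i)] q) * \<mu> (map e ns) q"
proof -
  have len: "length ns = CARD('n)" using ns distinct_card by fastforce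
  have e: "e i \<in> vfields" for i by (rule coframedD(2)[OF fr])
  have Ve: "V (e i) \<in> vfields" for i using V e by (simp add: module_derivation_def)
  have "\<mu> ((map e ns)[i := V (e (ns ! i))]) q = \<epsilon> (ns ! i) [V (e (ns ! i))] q * \<mu> (map e ns) q"
    if i: "i < length ns" for i
  proof -
    have zero: "\<mu> ((map e ns)[i := e j]) q = 0" if j: "j \<noteq> ns ! i" for j
    proof -
      obtain l where l: "l < length ns" "ns ! l = j" using ns(2) by (metis UNIV_I in_set_conv_nth)
      then have "l \<noteq> i" using j by blast
      then have "\<mu> ((map e ns)[i := e j]) = 0"
        using alt_repeat[OF \<mu>[unfolded forms_def], of l i "(map e ns)[i := e j]"] l i len by simp
      then show ?thesis by (simp add: fun_apply)
    qed
    have "\<mu> ((map e ns)[i := V (e (ns ! i))]) q =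
        (\<Sum>j\<in>UNIV. \<epsilon> j [V (e (ns ! i))] q * \<mu> ((map e ns)[i := e j]) q)"
      using i len e Ve by (intro alt_frame[OF \<mu>[unfolded forms_def] module_vfields coframedD(5)[OF fr] q]) auto
    also have "\<dots> = (\<Sum>j\<in>UNIV. if j = ns ! i then \<epsilon> j [V (e (ns ! i))] q * \<mu> (map e ns) q else 0)"
      using zero i by (intro sum.cong refl) (auto simp: map_update[symmetric] simp del: map_update)
    finally show ?thesis by simp
  qed
  then have "dact 0 V \<mu> (map e ns) q = - (\<Sum>i<length ns. \<epsilon> (ns ! i) [V (e (ns ! i))] q * \<mu> (map e ns) q)"
    using e by (auto simp: dact_def fun_apply image_subset_iff)
  also have "\<dots> = - (\<Sum>i\<in>UNIV. \<epsilon> i [V (e i)] q) * \<mu> (map e ns) q"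
    using sum_enum[of "\<lambda>i. \<epsilon> i [V (e i)] q * \<mu> (map e ns) q"] by (simp add: sum_distrib_right)
  finally show ?thesis .
qed

end

lemma ratio_eq:
  assumes "volume_form vol" "\<mu> \<in> forms CARD('n)"
  shows "\<mu> = fscale (ratio \<mu> vol) vol"
proof (intro ext)
  fix Ys p
  obtain W e \<epsilon> where W: "p \<in> W" and fr: "coframed W e \<epsilon>" by (rule exists_coframe[of p])
  obtain ns :: "'n list" where ns: "distinct ns" "set ns = UNIV" using exists_enum by metis
  show "\<mu> Ys p = fscale (ratio \<mu> vol) vol Ys p"
    using top_form_frame[OF fr ns assms(2) volume_formD(1)[OF assms(1)] W, of Ys]
      volume_frame_nonzero[OF fr ns assms(1) W]
    by (simp add: fun_apply ratio_frame[OF fr ns assms W] field_simps)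
qed

lemma ratio_unique:
  assumes "volume_form vol" "\<mu> = fscale g vol"
  shows "ratio \<mu> vol = g"
proof
  fix p
  have "vol (SOME Ys. vol Ys p \<noteq> 0) p \<noteq> 0" using volume_formD(2)[OF assms(1)] by (rule someI_ex)
  then show "ratio \<mu> vol p = g p" by (simp add: ratio_def assms(2) fun_apply)
qed

lemma ratio_smooth:
  assumes "volume_form vol" "\<mu> \<in> forms CARD('n)"
  shows "ratio \<mu> vol \<in> smooth_funs"
proof (rule smooth_funs_local)
  fix p
  obtain W e \<epsilon> where W: "p \<in> W" and fr: "coframed W e \<epsilon>" by (rule exists_coframe[of p])
  obtain ns :: "'n list" where ns: "distinct ns" "set ns = UNIV" using exists_enum by metis
  have "vol (map e ns) \<in> smooth_funs" using volume_formD(1)[OF assms(1)] by simp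
  from smooth_local_inverse[OF this volume_frame_nonzero[OF fr ns assms(1) W]]
  obtain g N where g: "g \<in> smooth_funs" "open N" "p \<in> N" "\<And>y. y \<in> N \<Longrightarrow> g y = inverse (vol (map e ns) y)"
    by blast
  show "\<exists>W g. open W \<and> p \<in> W \<and> g \<in> smooth_funs \<and> (\<forall>y\<in>W. ratio \<mu> vol y = g y)"
    by (rule exI[of _ "W \<inter> N"], rule exI[of _ "\<mu> (map e ns) * g"])
       (use g W coframedD(1)[OF fr] assms(2) in \<open>auto simp: ratio_frame[OF fr ns assms] fun_apply\<close>)
qed

lemma ratio_linear_frame:
  assumes "coframed W e \<epsilon>" "q \<in> W" "volume_form vol" "module_derivation 0 V"
  shows "ratio (dact 0 V vol) vol q = - (\<Sum>i\<in>UNIV. \<epsilon> i [V (e i)] q)"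
proof -
  obtain ns :: "'n list" where ns: "distinct ns" "set ns = UNIV" using exists_enum by metis
  note vol = volume_formD(1)[OF assms(3)]
  show ?thesis
    using volume_frame_nonzero[OF assms(1) ns assms(3,2)]
    by (simp add: ratio_frame[OF assms(1) ns assms(3) dact_form[OF assms(4) vol] assms(2)]
        dact_linear_frame[OF assms(1) ns assms(4) vol assms(2)])
qed

lemma ratio_add:
  assumes "volume_form vol" "\<mu> \<in> forms CARD('n)" "\<nu> \<in> forms CARD('n)"
  shows "ratio (\<mu> + \<nu>) vol = ratio \<mu> vol + ratio \<nu> vol"
proof (rule ratio_unique[OF assms(1)])
  have "\<mu> + \<nu> = fscale (ratio \<mu> vol) vol + fscale (ratio \<nu> vol) vol"
    using ratio_eq[OF assms(1)] assms(2,3) by metis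
  then show "\<mu> + \<nu> = fscale (ratio \<mu> vol + ratio \<nu> vol) vol"
    by (simp add: fun_eq_iff fun_apply algebra_simps)
qed

lemma ratio_fscale:
  assumes "volume_form vol" "\<mu> \<in> forms CARD('n)"
  shows "ratio (fscale f \<mu>) vol = f * ratio \<mu> vol"
proof (rule ratio_unique[OF assms(1)])
  have "fscale f \<mu> = fscale f (fscale (ratio \<mu> vol) vol)"
    using ratio_eq[OF assms] by simp
  then show "fscale f \<mu> = fscale (f * ratio \<mu> vol) vol"
    by (simp add: fun_eq_iff fun_apply algebra_simps)
qed

definition divergence :: "'m form \<Rightarrow> 'm vfield \<Rightarrow> 'm scalar" where
  "divergence vol X = ratio (lie_d X vol) vol"

lemma divergence_smooth: "volume_form vol \<Longrightarrow> X \<in> vfields \<Longrightarrow> divergence vol X \<in> smooth_funs"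
  unfolding divergence_def using ratio_smooth volume_formD(1) by simp

lemma lie_d_vol: "volume_form vol \<Longrightarrow> X \<in> vfields \<Longrightarrow> lie_d X vol = fscale (divergence vol X) vol"
  unfolding divergence_def using ratio_eq volume_formD(1) by simp

lemma divergence_add:
  assumes "volume_form vol" "X \<in> vfields" "Y \<in> vfields"
  shows "divergence vol (X + Y) = divergence vol X + divergence vol Y"
proof -
  note vol = volume_formD(1)[OF assms(1)]
  have "lie_d (X + Y) vol = dact (X + Y) (\<lambda>Z. vbracket X Z + vbracket Y Z) vol"
    unfolding lie_d_dact
  proof (rule dact_cong[OF refl])
    fix Z assume "Z \<in> vfields"
    then have "vbracket Z (X + Y) = vbracket Z X + vbracket Z Y" using assms by (simp add: vbracket_add_right)
    then show "vbracket (X + Y) Z = vbracket X Z + vbracket Y Z"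
      by (simp add: vbracket_swap[of _ Z])
  qed
  also have "\<dots> = lie_d X vol + lie_d Y vol"
    unfolding lie_d_dact using assms by (intro dact_add[OF vol]) auto
  finally show ?thesis
    unfolding divergence_def using ratio_add[OF assms(1)] vol assms by simp
qed

text \<open>[fX, Z] = f [X, Z] - Z(f) X. The last term is an endomorphism V in Z of trace -X(f),
  which acts on vol as multiplication by X(f).\<close>

lemma divergence_fscale:
  assumes "volume_form vol" "X \<in> vfields" "f \<in> smooth_funs"
  shows "divergence vol (fscale f X) = f * divergence vol X + X f"
proof -
  note vol = volume_formD(1)[OF assms(1)]
  define V where "V Y = - fscale (Y f) X" for Y :: "'m vfield"
  have V: "module_derivation 0 V"
    unfolding module_derivation_def V_def using assms
    by (auto simp: fun_eq_iff fun_apply algebra_simps)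
  have "lie_d (fscale f X) vol = dact (fscale f X + 0) (\<lambda>Z. fscale f (vbracket X Z) + V Z) vol"
    unfolding lie_d_dact
  proof (rule dact_cong)
    fix Z assume "Z \<in> vfields"
    then have "vbracket Z (fscale f X) = fscale f (vbracket Z X) + fscale (Z f) X"
      using assms by (simp add: vbracket_fscale_right)
    then show "vbracket (fscale f X) Z = fscale f (vbracket X Z) + V Z"
      by (simp add: vbracket_swap[of _ Z] V_def fun_eq_iff fun_apply)
  qed simp
  also have "\<dots> = dact (fscale f X) (\<lambda>Z. fscale f (vbracket X Z)) vol + dact 0 V vol"
    using assms V by (intro dact_add[OF vol]) (auto simp: module_derivation_def)
  also have "dact (fscale f X) (\<lambda>Z. fscale f (vbracket X Z)) vol = fscale f (lie_d X vol)"
  proof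
    fix Ys
    have "vol (Ys[i := fscale f (vbracket X (Ys ! i))]) = f * vol (Ys[i := vbracket X (Ys ! i)])"
      if "set Ys \<subseteq> vfields" "i < length Ys" for i
    proof (cases "length Ys = CARD('n)")
      case True
      have "Ys ! i \<in> vfields" using that by auto
      then show ?thesis using True that assms by (intro form_scale[OF vol]) auto
    next
      case False
      then show ?thesis using forms_outside[OF vol] by simp
    qed
    then show "dact (fscale f X) (\<lambda>Z. fscale f (vbracket X Z)) vol Ys = fscale f (lie_d X vol) Ys"
      by (simp add: lie_d_dact dact_def fscale_apply sum_distrib_left algebra_simps)
  qed
  finally have "divergence vol (fscale f X) = f * divergence vol X + ratio (dact 0 V vol) vol"
    unfolding divergence_def
    using assms vol dact_form[OF V vol] by (simp add: ratio_add ratio_fscale)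
  moreover have "ratio (dact 0 V vol) vol = X f"
  proof
    fix q
    obtain W e \<epsilon> where q: "q \<in> W" and fr: "coframed W e \<epsilon>" by (rule exists_coframe[of q])
    have "- \<epsilon> i [V (e i)] q = \<epsilon> i [X] q * e i f q" for i
    proof -
      have "V (e i) = fscale (- e i f) X" by (simp add: V_def fun_eq_iff fun_apply)
      then have "\<epsilon> i [V (e i)] = (- e i f) * \<epsilon> i [X]"
        using assms coframedD(2,3)[OF fr] by (simp add: form1_scale)
      then show ?thesis by (simp add: fun_apply)
    qed
    then show "ratio (dact 0 V vol) vol q = X f q"
      unfolding ratio_linear_frame[OF fr q assms(1) V] coframed_apply[OF fr q assms(2), of f]
      by (simp add: sum_negf[symmetric])
  qed
  ultimately show ?thesis by simp
qed

end

section \<open>Bivectors, contractions and traces\<close>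

lemma sum_list_sum_swap:
  "(\<Sum>x\<leftarrow>xs. \<Sum>i\<in>I. f x i) = (\<Sum>i\<in>I. \<Sum>x\<leftarrow>xs. f x i :: 'b::comm_monoid_add)"
  by (induction xs) (simp_all add: sum.distrib)

text \<open>\<open>One_nat_def\<close> is no longer a simp rule, so list positions 1 and 2 need
  rules of their own.\<close>

lemma list_index_simps [simp]:
  "(x # y # ys)[1 := z] = x # z # ys" "(x # y # z # ys)[2 := w] = x # y # w # ys"
  "(x # y # ys) ! 1 = y" "take 1 (x # ys) = [x]" "(case 1 of 0 \<Rightarrow> a | Suc j \<Rightarrow> h j) = h 0"
  by (simp_all add: One_nat_def numeral_2_eq_2)

text \<open>The type confines the rule to sums of forms and the like; sums of scalar functions are
  left alone and remain ring elements.\<close>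

lemma plus_fun_apply2: "(f + g) x = f x + (g x :: 'a \<Rightarrow> real)"
  by (rule plus_fun_apply)

lemma wedge_single:
  "wedge E [x] \<xi>s = (if length \<xi>s = 1 \<and> set \<xi>s \<subseteq> dsec E then pairing E x (hd \<xi>s) else 0)"
proof -
  have "{\<sigma>. \<sigma> permutes {..<Suc 0}} = {id}"
    by (auto simp: lessThan_Suc)
  then show ?thesis by (cases \<xi>s) (auto simp: wedge_def One_nat_def)
qed

lemma wedge_pair:
  assumes "\<xi> \<in> dsec E" "\<eta> \<in> dsec E"
  shows "wedge E [x, y] [\<xi>, \<eta>] p = pairing E x \<xi> p * pairing E y \<eta> p - pairing E x \<eta> p * pairing E y \<xi> p"
proof -
  have *: "{..<2} = {0, 1 :: nat}" by auto
  have "{\<sigma>. \<sigma> permutes {..<2::nat}} = {id, Transposition.transpose 0 1}"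
    unfolding * by (auto simp: permutes_doubleton_iff)
  moreover have "id \<noteq> Transposition.transpose 0 (1::nat)"
    by (metis id_apply transpose_apply_first zero_neq_one)
  ultimately show ?thesis using assms
    by (simp add: wedge_def * numeral_2_eq_2[symmetric] sign_swap_id)
qed

context smooth_manifold
begin

definition linear_functional :: "('m form \<Rightarrow> 'm scalar) \<Rightarrow> bool" where
  "linear_functional T \<longleftrightarrow> (\<forall>\<beta>\<in>forms 1. T \<beta> \<in> smooth_funs) \<and>
     (\<forall>\<alpha>\<in>forms 1. \<forall>\<beta>\<in>forms 1. T (\<alpha> + \<beta>) = T \<alpha> + T \<beta>) \<and>
     (\<forall>f\<in>smooth_funs. \<forall>\<beta>\<in>forms 1. T (fscale f \<beta>) = f * T \<beta>)"

lemma linear_functional_vfield: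
  "linear_functional T \<Longrightarrow> \<exists>!X. X \<in> vfields \<and> (\<forall>\<beta>\<in>forms 1. \<beta> [X] = T \<beta>)"
  unfolding linear_functional_def by (rule vfield_of_functional) auto

lemma linear_functional_the:
  assumes "linear_functional T"
  shows "(THE X. X \<in> vfields \<and> (\<forall>\<beta>\<in>forms 1. \<beta> [X] = T \<beta>)) \<in> vfields"
    "\<beta> \<in> forms 1 \<Longrightarrow> \<beta> [THE X. X \<in> vfields \<and> (\<forall>\<beta>\<in>forms 1. \<beta> [X] = T \<beta>)] = T \<beta>"
  using theI'[OF linear_functional_vfield[OF assms]] by blast+

text \<open>A functional is the pairing with a vector field and inherits the expansion of
  pairings.\<close>

lemma functional_frame:
  assumes "linear_functional T" "coframed W e \<epsilon>" "q \<in> W" "\<beta> \<in> forms 1"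
  shows "T \<beta> q = (\<Sum>i\<in>UNIV. \<beta> [e i] q * T (\<epsilon> i) q)"
proof -
  obtain X where X: "X \<in> vfields" "\<And>\<beta>. \<beta> \<in> forms 1 \<Longrightarrow> \<beta> [X] = T \<beta>"
    using linear_functional_vfield[OF assms(1)] by blast
  then show ?thesis
    using coframed_pairing[OF assms(2-4) X(1)] coframedD(3)[OF assms(2)] assms(4) by simp
qed

lemma ext_d_pair:
  assumes "X \<in> vfields" "Y \<in> vfields"
  shows "ext_d \<alpha> [X, Y] = X (\<alpha> [Y]) - Y (\<alpha> [X]) - \<alpha> [vbracket X Y]"
proof -
  have *: "{..<2} = {0, 1 :: nat}" "{..<1} = {0::nat}" by auto
  show ?thesis using assms
    by (simp add: ext_d_def numeral_2_eq_2[symmetric] * omit_def psign_def fun_eq_iff fun_apply One_nat_def[symmetric])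
qed

lemma form1_zero: "\<alpha> \<in> forms 1 \<Longrightarrow> \<alpha> [0] = 0"
proof -
  assume "\<alpha> \<in> forms 1"
  then have "\<alpha> [fscale 0 0] = 0 * \<alpha> [0]" by (intro form1_scale) auto
  moreover have "fscale 0 0 = (0 :: 'm vfield)" by (simp add: fun_eq_iff fun_apply)
  ultimately show "\<alpha> [0] = 0" by simp
qed

text \<open>The derivatives of a coefficient f that come from X(\<alpha>(Y)) and Y(\<alpha>(X))
  cancel against those from \<alpha>([X, Y]).\<close>

lemma ext_d_form2:
  assumes \<alpha>: "\<alpha> \<in> forms 1"
  shows "ext_d \<alpha> \<in> forms 2"
  unfolding forms_def
proof (rule altI)
  fix Xs :: "'m vfield list" assume *: "\<not> (length Xs = 2 \<and> set Xs \<subseteq> vfields)"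
  show "ext_d \<alpha> Xs = 0"
  proof (cases "set Xs \<subseteq> vfields")
    case True
    with * have len: "length Xs \<noteq> 2" by simp
    have out: "\<alpha> Zs = 0" if "length Zs \<noteq> 1" for Zs using forms_outside[OF \<alpha>] that by blast
    have "\<alpha> (omit i Xs) = 0" if "i < length Xs" for i
      using that len by (intro out) auto
    moreover have "(Xs ! i) 0 = 0" if "i < length Xs" for i
      using that True by (intro vfield_zero) auto
    moreover have "\<alpha> (vbracket (Xs ! i) (Xs ! j) # omit i (omit j Xs)) = 0" if "j < length Xs" "i < j" for i j
      using that len by (intro out) auto
    ultimately show ?thesis by (simp add: ext_d_def)
  qed (simp add: ext_d_def)
next
  fix xs :: "'m vfield list" assume len: "length xs = 2" and xs: "set xs \<subseteq> vfields"
  then obtain X Y where XY: "xs = [X, Y]" "X \<in> vfields" "Y \<in> vfields"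
    by (auto simp: numeral_2_eq_2 length_Suc_conv)
  show "ext_d \<alpha> xs \<in> smooth_funs" using XY \<alpha> by (simp add: ext_d_pair)
  fix i :: nat assume "i < 2"
  then have i: "i = 0 \<or> i = 1" by auto
  show "ext_d \<alpha> (xs[i := xs ! i + v]) = ext_d \<alpha> xs + ext_d \<alpha> (xs[i := v])" if v: "v \<in> vfields" for v
  proof -
    have "vbracket (Z + Z') U = vbracket Z U + vbracket Z' U"
      if "Z \<in> vfields" "Z' \<in> vfields" "U \<in> vfields" for Z Z' U
      using vbracket_add_right[OF that(3,1,2)] by (simp add: vbracket_swap[of _ U])
    then show ?thesis using i XY v \<alpha>
      by (auto simp: ext_d_pair form1_add vbracket_add_right vfield_add plus_fun_apply2 algebra_simps)
  qed
  show "ext_d \<alpha> (xs[i := fscale f (xs ! i)]) = f * ext_d \<alpha> xs" if f: "f \<in> smooth_funs" for f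
  proof -
    have "\<alpha> [vbracket (fscale f Z) U] = f * \<alpha> [vbracket Z U] - U f * \<alpha> [Z]"
      if "Z \<in> vfields" "U \<in> vfields" for Z U
    proof -
      have "vbracket (fscale f Z) U = fscale f (vbracket Z U) + fscale (- U f) Z"
        using vbracket_fscale_right[OF that(2,1) f]
        by (simp add: vbracket_swap[of _ U] fun_eq_iff fun_apply)
      then show ?thesis using that f \<alpha> by (simp add: form1_add form1_scale)
    qed
    then show ?thesis using i XY f \<alpha>
      by (auto simp: ext_d_pair form1_add form1_scale vbracket_fscale_right vfield_mult fscale_apply algebra_simps)
  qed
  show "ext_d \<alpha> xs = 0" if "j < i" "xs ! i = xs ! j" for j
  proof -
    have "vbracket X X = 0" by (simp add: vbracket_def fun_eq_iff fun_apply)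
    moreover have "X = Y" using that i XY by auto
    ultimately show ?thesis using XY \<alpha> form1_zero by (simp add: ext_d_pair)
  qed
qed

lemma ext_d_add:
  assumes "\<alpha> \<in> forms 1" "\<beta> \<in> forms 1" "X \<in> vfields" "Y \<in> vfields"
  shows "ext_d (\<alpha> + \<beta>) [X, Y] = ext_d \<alpha> [X, Y] + ext_d \<beta> [X, Y]"
  using assms by (simp add: ext_d_pair plus_fun_apply[of \<alpha> \<beta>] vfield_add algebra_simps)

lemma ext_d_fscale:
  assumes "\<alpha> \<in> forms 1" "f \<in> smooth_funs" "X \<in> vfields" "Y \<in> vfields"
  shows "ext_d (fscale f \<alpha>) [X, Y] = f * ext_d \<alpha> [X, Y] + X f * \<alpha> [Y] - Y f * \<alpha> [X]"
  using assms by (simp add: ext_d_pair fscale_apply vfield_mult algebra_simps)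

lemma form2_frame:
  assumes \<omega>: "\<omega> \<in> forms 2" and fr: "coframed W e \<epsilon>" and q: "q \<in> W" and X: "X \<in> vfields" "Y \<in> vfields"
  shows "\<omega> [X, Y] q = (\<Sum>i\<in>UNIV. \<Sum>j\<in>UNIV. \<epsilon> i [X] q * \<epsilon> j [Y] q * \<omega> [e i, e j] q)"
proof -
  note e = coframedD(2)[OF fr]
  have "\<omega> [X, Y] q = (\<Sum>i\<in>UNIV. \<epsilon> i [X] q * \<omega> [e i, Y] q)"
    using alt_frame[OF \<omega>[unfolded forms_def] module_vfields coframedD(5)[OF fr] q, of "[X, Y]" 0 X] X by simp
  moreover have "\<omega> [e i, Y] q = (\<Sum>j\<in>UNIV. \<epsilon> j [Y] q * \<omega> [e i, e j] q)" for i
    using alt_frame[OF \<omega>[unfolded forms_def] module_vfields coframedD(5)[OF fr] q, of "[e i, Y]" 1 Y] X e by simp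
  ultimately show ?thesis by (simp add: sum_distrib_left mult.assoc)
qed

lemma form2_swap: "\<omega> \<in> forms 2 \<Longrightarrow> X \<in> vfields \<Longrightarrow> Y \<in> vfields \<Longrightarrow> \<omega> [X, Y] = - \<omega> [Y, X]"
  using alt_swap[of \<omega> 2 vfields "[X, Y]" 0 1 X Y] module_vfields by (simp add: forms_def)

text \<open>A competing dual pair (\<eta>, X) is related to (\<epsilon>, e) at q by the matrices A
  and B. Duality says A B = 1, while invariance of the trace needs B A = 1.\<close>

lemma trace_frame:
  assumes fr: "coframed W e \<epsilon>" and q: "q \<in> W"
    and \<Phi>: "\<And>\<alpha> X. \<alpha> \<in> forms 1 \<Longrightarrow> X \<in> vfields \<Longrightarrow>
      \<Phi> \<alpha> [X] q = (\<Sum>j\<in>UNIV. \<Sum>k\<in>UNIV. \<alpha> [e j] q * \<epsilon> k [X] q * \<Phi> (\<epsilon> j) [e k] q)"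
  shows "trace \<Phi> q = (\<Sum>i\<in>UNIV. \<Phi> (\<epsilon> i) [e i] q)"
  unfolding trace_def
proof (rule the_equality)
  show "\<exists>\<eta> X. (\<forall>i::'n. \<eta> i \<in> forms 1 \<and> X i \<in> vfields) \<and> (\<forall>i j. \<eta> i [X j] q = (if i = j then 1 else 0)) \<and>
      (\<Sum>i\<in>UNIV. \<Phi> (\<epsilon> i) [e i] q) = (\<Sum>i\<in>UNIV. \<Phi> (\<eta> i) [X i] q)"
    using coframedD(2-4)[OF fr] q by (intro exI[of _ \<epsilon>] exI[of _ e]) simp
next
  fix t
  assume "\<exists>\<eta> X. (\<forall>i::'n. \<eta> i \<in> forms 1 \<and> X i \<in> vfields) \<and> (\<forall>i j. \<eta> i [X j] q = (if i = j then 1 else 0)) \<and>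
      t = (\<Sum>i\<in>UNIV. \<Phi> (\<eta> i) [X i] q)"
  then obtain \<eta> X where \<eta>: "\<And>i. \<eta> i \<in> forms 1" and X: "\<And>i::'n. X i \<in> vfields"
    and dual: "\<And>i j. \<eta> i [X j] q = (if i = j then 1 else 0)" and t: "t = (\<Sum>i\<in>UNIV. \<Phi> (\<eta> i) [X i] q)"
    by blast
  define A :: "real^'n^'n" where "A = (\<chi> i j. \<eta> i [e j] q)"
  define B :: "real^'n^'n" where "B = (\<chi> k i. \<epsilon> k [X i] q)"
  have "A ** B = mat 1"
    using coframed_pairing[OF fr q \<eta> X] dual
    by (simp add: vec_eq_iff matrix_matrix_mult_def A_def B_def mat_def)
  then have "B ** A = mat 1" by (rule matrix_left_right_inverse[THEN iffD1])
  then have BA: "(\<Sum>i\<in>UNIV. \<epsilon> k [X i] q * \<eta> i [e j] q) = (if k = j then 1 else 0)" for k j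
    by (simp add: vec_eq_iff matrix_matrix_mult_def A_def B_def mat_def)
  have "t = (\<Sum>i\<in>UNIV. \<Sum>j\<in>UNIV. \<Sum>k\<in>UNIV. \<eta> i [e j] q * \<epsilon> k [X i] q * \<Phi> (\<epsilon> j) [e k] q)"
    unfolding t using \<Phi>[OF \<eta> X] by simp
  also have "\<dots> = (\<Sum>j\<in>UNIV. \<Sum>k\<in>UNIV. \<Sum>i\<in>UNIV. \<eta> i [e j] q * \<epsilon> k [X i] q * \<Phi> (\<epsilon> j) [e k] q)"
    by (subst sum.swap, rule sum.cong[OF refl], rule sum.swap)
  also have "\<dots> = (\<Sum>j\<in>UNIV. \<Sum>k\<in>UNIV. (\<Sum>i\<in>UNIV. \<epsilon> k [X i] q * \<eta> i [e j] q) * \<Phi> (\<epsilon> j) [e k] q)"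
    by (intro sum.cong refl, subst sum_distrib_right, intro sum.cong refl) (simp add: mult_ac)
  also have "\<dots> = (\<Sum>i\<in>UNIV. \<Phi> (\<epsilon> i) [e i] q)"
    unfolding BA by (simp add: if_distrib[of "\<lambda>x. x * _"] cong: if_cong)
  finally show "t = (\<Sum>i\<in>UNIV. \<Phi> (\<epsilon> i) [e i] q)" .
qed

end

section \<open>The bivector field: sharp map, contraction, modular vector fields\<close>

locale bivector_manifold = smooth_manifold atlas
  for atlas :: "('m::{t2_space,second_countable_topology} set \<times> ('m \<Rightarrow> real^'n)) set" +
  fixes \<pi> :: "'m mvector" and \<psi> :: "'m form"
  assumes bivector: "\<pi> \<in> mvectors 2" and three_form: "\<psi> \<in> forms 3"
begin

lemma dsec_tangent: "dsec tangent = forms 1" and sec_tangent: "sec tangent = vfields"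
  by (simp_all add: tangent_def)

lemma pi_alt: "\<pi> \<in> alt 2 (forms 1)"
  using bivector by (simp add: mvectors_def)

lemma pi_swap: "\<alpha> \<in> forms 1 \<Longrightarrow> \<beta> \<in> forms 1 \<Longrightarrow> \<pi> [\<alpha>, \<beta>] = - \<pi> [\<beta>, \<alpha>]"
  using alt_swap[OF pi_alt module_forms, of "[\<alpha>, \<beta>]" 0 1 \<alpha> \<beta>] by simp

lemma pi_add_right: "\<alpha> \<in> forms 1 \<Longrightarrow> \<beta> \<in> forms 1 \<Longrightarrow> \<gamma> \<in> forms 1 \<Longrightarrow> \<pi> [\<alpha>, \<beta> + \<gamma>] = \<pi> [\<alpha>, \<beta>] + \<pi> [\<alpha>, \<gamma>]"
  using alt_add[OF pi_alt, of "[\<alpha>, \<beta>]" 1 \<beta> \<gamma>] by simp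

lemma pi_scale_right: "\<alpha> \<in> forms 1 \<Longrightarrow> \<beta> \<in> forms 1 \<Longrightarrow> f \<in> smooth_funs \<Longrightarrow> \<pi> [\<alpha>, fscale f \<beta>] = f * \<pi> [\<alpha>, \<beta>]"
  using alt_scale[OF pi_alt, of "[\<alpha>, \<beta>]" 1 \<beta> f] by simp

lemma pi_smooth [simp]: "\<pi> \<alpha>s \<in> smooth_funs"
  using pi_alt by simp

lemma linear_functional_pi: "\<alpha> \<in> forms 1 \<Longrightarrow> linear_functional (\<lambda>\<beta>. \<pi> [\<alpha>, \<beta>])"
  unfolding linear_functional_def by (simp add: pi_add_right pi_scale_right)

lemma sharp_vfield [simp]: "\<alpha> \<in> forms 1 \<Longrightarrow> sharp \<pi> \<alpha> \<in> vfields"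
  and sharp_pairing: "\<alpha> \<in> forms 1 \<Longrightarrow> \<beta> \<in> forms 1 \<Longrightarrow> \<beta> [sharp \<pi> \<alpha>] = \<pi> [\<alpha>, \<beta>]"
  unfolding sharp_def using linear_functional_the[OF linear_functional_pi] by auto

lemma sharp_add:
  assumes "\<alpha> \<in> forms 1" "\<beta> \<in> forms 1"
  shows "sharp \<pi> (\<alpha> + \<beta>) = sharp \<pi> \<alpha> + sharp \<pi> \<beta>"
proof (rule vfield_eqI)
  show "\<gamma> [sharp \<pi> (\<alpha> + \<beta>)] = \<gamma> [sharp \<pi> \<alpha> + sharp \<pi> \<beta>]" if "\<gamma> \<in> forms 1" for \<gamma>
    using assms that pi_swap[of _ \<gamma>] by (simp add: form1_add sharp_pairing pi_add_right)
qed (use assms in auto)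

lemma sharp_fscale:
  assumes "\<alpha> \<in> forms 1" "f \<in> smooth_funs"
  shows "sharp \<pi> (fscale f \<alpha>) = fscale f (sharp \<pi> \<alpha>)"
proof (rule vfield_eqI)
  show "\<gamma> [sharp \<pi> (fscale f \<alpha>)] = \<gamma> [fscale f (sharp \<pi> \<alpha>)]" if "\<gamma> \<in> forms 1" for \<gamma>
    using assms that pi_swap[of _ \<gamma>] by (simp add: form1_scale sharp_pairing pi_scale_right)
qed (use assms in auto)

lemma sharp_apply: "\<alpha> \<in> forms 1 \<Longrightarrow> f \<in> smooth_funs \<Longrightarrow> sharp \<pi> \<alpha> f = \<pi> [\<alpha>, ext_d (form0 f)]"
  using sharp_pairing[OF _ df_form] df_apply[OF sharp_vfield] by metis

text \<open>Serves both to define vector fields by their pairings with \<beta> and to expand \<beta>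
  in a coframe inside a form.\<close>

lemma linear_functional_form_sharp:
  assumes "\<omega> \<in> forms k" "length xs = k" "set xs \<subseteq> vfields" "i < k"
  shows "linear_functional (\<lambda>\<beta>. \<omega> (xs[i := sharp \<pi> \<beta>]))"
  unfolding linear_functional_def using assms
  by (auto simp: sharp_add sharp_fscale form_add form_scale)

lemma pi_frame:
  assumes fr: "coframed W e \<epsilon>" and q: "q \<in> W" and \<alpha>: "\<alpha> \<in> forms 1" "\<beta> \<in> forms 1"
  shows "\<pi> [\<alpha>, \<beta>] q = (\<Sum>i\<in>UNIV. \<Sum>j\<in>UNIV. \<alpha> [e i] q * \<beta> [e j] q * \<pi> [\<epsilon> i, \<epsilon> j] q)"
proof -
  note \<epsilon> = coframedD(3)[OF fr]
  have "\<pi> [\<alpha>, \<beta>] q = (\<Sum>i\<in>UNIV. \<alpha> [e i] q * \<pi> [\<epsilon> i, \<beta>] q)"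
    using alt_frame[OF pi_alt module_forms coframedD(6)[OF fr] q, of "[\<alpha>, \<beta>]" 0 \<alpha>] \<alpha> by simp
  moreover have "\<pi> [\<epsilon> i, \<beta>] q = (\<Sum>j\<in>UNIV. \<beta> [e j] q * \<pi> [\<epsilon> i, \<epsilon> j] q)" for i
    using alt_frame[OF pi_alt module_forms coframedD(6)[OF fr] q, of "[\<epsilon> i, \<beta>]" 1 \<beta>] \<alpha> \<epsilon> by simp
  ultimately show ?thesis by (simp add: sum_distrib_left mult.assoc)
qed

text \<open>\<pi> is half the sum of \<pi>(\<epsilon>_i, \<epsilon>_j) e_i \<and> e_j over all
  ordered pairs; the half compensates for each unordered pair occurring twice, and avoids an order
  on the index type. The coefficient goes into the first factor because \<open>decomp\<close> sums
  decomposables without coefficients.\<close>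

lemma exists_decomp_pi: "\<exists>Xss. decomp tangent 2 \<pi> p Xss"
proof -
  obtain W e \<epsilon> where p: "p \<in> W" and fr: "coframed W e \<epsilon>" by (rule exists_coframe[of p])
  obtain ns :: "'n list" where ns: "distinct ns" "set ns = UNIV" using exists_enum by metis
  note e = coframedD(2)[OF fr] and \<epsilon> = coframedD(3)[OF fr]
  define g where "g i j = (\<lambda>_. 1 / 2) * \<pi> [\<epsilon> i, \<epsilon> j]" for i j
  define Xss where "Xss = map (\<lambda>(i, j). [fscale (g i j) (e i), e j]) (List.product ns ns)"
  have g: "g i j \<in> smooth_funs" for i j by (simp add: g_def)
  have "\<pi> \<xi>s y = (\<Sum>Xs\<leftarrow>Xss. wedge tangent Xs \<xi>s y)" if y: "y \<in> W" for \<xi>s y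
  proof (cases "length \<xi>s = 2 \<and> set \<xi>s \<subseteq> forms 1")
    case True
    then obtain \<xi> \<eta> where \<xi>s: "\<xi>s = [\<xi>, \<eta>]" "\<xi> \<in> forms 1" "\<eta> \<in> forms 1"
      by (auto simp: numeral_2_eq_2 length_Suc_conv)
    have w: "wedge tangent [fscale (g i j) (e i), e j] \<xi>s y =
        g i j y * (\<xi> [e i] y * \<eta> [e j] y) - g i j y * (\<eta> [e i] y * \<xi> [e j] y)" for i j
      using \<xi>s e g by (simp add: wedge_pair tangent_def form1_scale fun_apply algebra_simps)
    have "(\<Sum>Xs\<leftarrow>Xss. wedge tangent Xs \<xi>s y) =
        (\<Sum>i\<in>UNIV. \<Sum>j\<in>UNIV. wedge tangent [fscale (g i j) (e i), e j] \<xi>s y)"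
      using ns by (simp add: Xss_def comp_def case_prod_unfold sum_list_distinct_conv_sum_set distinct_product
          sum.cartesian_product)
    also have "\<dots> = (\<Sum>i\<in>UNIV. \<Sum>j\<in>UNIV. g i j y * (\<xi> [e i] y * \<eta> [e j] y))
        - (\<Sum>i\<in>UNIV. \<Sum>j\<in>UNIV. g i j y * (\<eta> [e i] y * \<xi> [e j] y))"
      unfolding w by (simp add: sum_subtractf)
    also have "(\<Sum>i\<in>UNIV. \<Sum>j\<in>UNIV. g i j y * (\<eta> [e i] y * \<xi> [e j] y))
        = (\<Sum>i\<in>UNIV. \<Sum>j\<in>UNIV. g j i y * (\<eta> [e j] y * \<xi> [e i] y))"
      by (rule sum.swap)
    also have "\<dots> = - (\<Sum>i\<in>UNIV. \<Sum>j\<in>UNIV. g i j y * (\<xi> [e i] y * \<eta> [e j] y))"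
    proof -
      have "g j i y * (\<eta> [e j] y * \<xi> [e i] y) = - (g i j y * (\<xi> [e i] y * \<eta> [e j] y))" for i j
        using pi_swap[OF \<epsilon> \<epsilon>, of j i] by (simp add: g_def fun_apply)
      then show ?thesis by (simp only: sum_negf)
    qed
    finally show ?thesis
      unfolding \<xi>s(1) pi_frame[OF fr y \<xi>s(2,3)]
      by (simp add: g_def fun_apply sum.distrib[symmetric] algebra_simps)
  next
    case False
    moreover have "length Xs = 2" if "Xs \<in> set Xss" for Xs using that by (auto simp: Xss_def)
    ultimately have "wedge tangent Xs \<xi>s = 0" if "Xs \<in> set Xss" for Xs
      using that unfolding wedge_def dsec_tangent by auto
    then have "(\<Sum>Xs\<leftarrow>Xss. wedge tangent Xs \<xi>s y) = (\<Sum>Xs\<leftarrow>Xss. 0)"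
      by (intro arg_cong[of _ _ sum_list] map_cong) (simp_all add: zero_fun_apply)
    then show ?thesis using alt_outside[OF pi_alt False] by (simp add: fun_apply)
  qed
  then have "decomp tangent 2 \<pi> p Xss"
    unfolding decomp_def using coframedD(1)[OF fr] p e g
    by (intro conjI exI[of _ W]) (auto simp: Xss_def tangent_def)
  then show ?thesis by blast
qed

text \<open>For one decomposable, \<omega>(Y, X) is half the sum of (X \<and> Y)(\<epsilon>_j,
  \<epsilon>_i) \<omega>(e_i, e_j), since both terms of the determinant contribute equally. Summed
  over a decomposition only the components of \<pi> remain, so the contraction is well defined. The
  half becomes the 2 in front of i_\<pi> d\<alpha> in the trace.\<close>

lemma contract_frame:
  assumes \<omega>: "\<omega> \<in> forms 2" and fr: "coframed W e \<epsilon>" and q: "q \<in> W"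
  shows "contract 2 \<pi> \<omega> [] q = 1 / 2 * (\<Sum>j\<in>UNIV. \<omega> [sharp \<pi> (\<epsilon> j), e j] q)"
proof -
  note e = coframedD(2)[OF fr] and \<epsilon> = coframedD(3)[OF fr]
  let ?w = "\<lambda>i j. \<omega> [e i, e j] q"
  let ?c = "1 / 2 * (\<Sum>j\<in>UNIV. \<Sum>i\<in>UNIV. \<pi> [\<epsilon> j, \<epsilon> i] q * ?w i j)"
  have key: "(\<Sum>Xs\<leftarrow>Xss. \<omega> (rev Xs @ []) q) = ?c" if D: "decomp tangent 2 \<pi> q Xss" for Xss
  proof -
    have 1: "\<omega> (rev Xs @ []) q = 1 / 2 * (\<Sum>j\<in>UNIV. \<Sum>i\<in>UNIV. wedge tangent Xs [\<epsilon> j, \<epsilon> i] q * ?w i j)"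
      if Xs: "Xs \<in> set Xss" for Xs
    proof -
      obtain X Y where XY: "Xs = [X, Y]" "X \<in> vfields" "Y \<in> vfields"
        using D Xs by (fastforce simp: decomp_def tangent_def numeral_2_eq_2 length_Suc_conv)
      let ?S = "\<Sum>j\<in>UNIV. \<Sum>i\<in>UNIV. \<epsilon> j [X] q * \<epsilon> i [Y] q * ?w i j"
      have "wedge tangent Xs [\<epsilon> j, \<epsilon> i] q * ?w i j =
          \<epsilon> j [X] q * \<epsilon> i [Y] q * ?w i j + \<epsilon> i [X] q * \<epsilon> j [Y] q * ?w j i" for i j
        using \<epsilon> XY form2_swap[OF \<omega> e e, of i j]
        by (simp add: wedge_pair tangent_def uminus_apply algebra_simps)
      then have "(\<Sum>j\<in>UNIV. \<Sum>i\<in>UNIV. wedge tangent Xs [\<epsilon> j, \<epsilon> i] q * ?w i j) =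
          ?S + (\<Sum>j\<in>UNIV. \<Sum>i\<in>UNIV. \<epsilon> i [X] q * \<epsilon> j [Y] q * ?w j i)"
        by (simp add: sum.distrib)
      also have "(\<Sum>j\<in>UNIV. \<Sum>i\<in>UNIV. \<epsilon> i [X] q * \<epsilon> j [Y] q * ?w j i) = ?S"
        by (rule sum.swap)
      finally have "1 / 2 * (\<Sum>j\<in>UNIV. \<Sum>i\<in>UNIV. wedge tangent Xs [\<epsilon> j, \<epsilon> i] q * ?w i j) = ?S" by simp
      also have "?S = \<omega> [Y, X] q"
        unfolding form2_frame[OF \<omega> fr q XY(3,2)] by (subst sum.swap) (simp add: mult_ac)
      finally show ?thesis using XY by simp
    qed
    have "(\<Sum>Xs\<leftarrow>Xss. \<omega> (rev Xs @ []) q) =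
        (\<Sum>Xs\<leftarrow>Xss. 1 / 2 * (\<Sum>j\<in>UNIV. \<Sum>i\<in>UNIV. wedge tangent Xs [\<epsilon> j, \<epsilon> i] q * ?w i j))"
      using 1 by (intro arg_cong[of _ _ sum_list] map_cong) auto
    also have "\<dots> = 1 / 2 * (\<Sum>j\<in>UNIV. \<Sum>i\<in>UNIV. (\<Sum>Xs\<leftarrow>Xss. wedge tangent Xs [\<epsilon> j, \<epsilon> i] q) * ?w i j)"
      unfolding sum_list_const_mult sum_list_sum_swap sum_list_mult_const ..
    also have "\<dots> = ?c"
      using D q unfolding decomp_def by auto
    finally show ?thesis .
  qed
  have "(\<Sum>i\<in>UNIV. \<pi> [\<epsilon> j, \<epsilon> i] q * ?w i j) = \<omega> [sharp \<pi> (\<epsilon> j), e j] q" for j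
    using alt_frame[OF \<omega>[unfolded forms_def] module_vfields coframedD(5)[OF fr] q, of "[sharp \<pi> (\<epsilon> j), e j]" 0 "sharp \<pi> (\<epsilon> j)"]
      e \<epsilon> by (simp add: sharp_pairing)
  moreover have "contract 2 \<pi> \<omega> [] q = ?c"
    unfolding contract_def using exists_decomp_pi[of q] key by (intro the_equality) auto
  ultimately show ?thesis by simp
qed

text \<open>For a decomposable a \<and> b the defining sum is b(f) a - a(f) b, whose value on \<xi>
  is -(a \<and> b)(df, \<xi>). Hence [\<pi>, f](\<xi>) = -\<pi>(df, \<xi>) = \<pi>(\<xi>, df), the
  derivative of f along \<pi>^#\<xi>.\<close>

lemma gerst_fun_pi:
  assumes "f \<in> smooth_funs"
  shows "gerst_fun tangent 2 \<pi> f \<xi>s =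
    (if length \<xi>s = 1 \<and> set \<xi>s \<subseteq> forms 1 then sharp \<pi> (hd \<xi>s) f else 0)" (is "_ = ?r")
proof
  fix p
  let ?d = "ext_d (form0 f)"
  let ?c = "\<lambda>as k. (-1) ^ (2 - 1 - k) * anchor tangent (as ! k) f p * wedge tangent (omit k as) \<xi>s p"
  have key: "(\<Sum>as\<leftarrow>ass. \<Sum>k<2. ?c as k) = ?r p" if D: "decomp tangent 2 \<pi> p ass" for ass
  proof -
    have as: "\<exists>a b. as = [a, b] \<and> a \<in> vfields \<and> b \<in> vfields" if "as \<in> set ass" for as
      using D that by (fastforce simp: decomp_def tangent_def numeral_2_eq_2 length_Suc_conv)
    have two: "(\<Sum>k<2. h k) = h 0 + h 1" for h :: "nat \<Rightarrow> real"
      by (simp add: numeral_2_eq_2 One_nat_def)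
    show ?thesis
    proof (cases "length \<xi>s = 1 \<and> set \<xi>s \<subseteq> forms 1")
      case True
      then obtain \<xi> where \<xi>: "\<xi>s = [\<xi>]" "\<xi> \<in> forms 1" by (cases \<xi>s) auto
      have "(\<Sum>k<2. ?c as k) = - wedge tangent as [?d, \<xi>] p" if "as \<in> set ass" for as
        using as[OF that] \<xi> df_form[OF assms]
        by (auto simp: two wedge_pair wedge_single tangent_def omit_def df_apply)
      then have "(\<Sum>as\<leftarrow>ass. \<Sum>k<2. ?c as k) = - (\<Sum>as\<leftarrow>ass. wedge tangent as [?d, \<xi>] p)"
        by (subst uminus_sum_list_map) (intro arg_cong[of _ _ sum_list] map_cong, auto)
      also have "\<dots> = - \<pi> [?d, \<xi>] p"
        using D unfolding decomp_def by auto
      also have "\<dots> = sharp \<pi> \<xi> f p"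
        using pi_swap[OF df_form[OF assms] \<xi>(2)] \<xi> assms by (simp add: sharp_apply uminus_apply)
      finally show ?thesis using \<xi> by simp
    next
      case False
      then have "wedge tangent [c] \<xi>s p = 0" for c
        unfolding wedge_single dsec_tangent by (simp only: if_False zero_fun_apply)
      then have "(\<Sum>k<2. ?c as k) = 0" if "as \<in> set ass" for as
        using as[OF that] by (auto simp: two omit_def)
      then have "(\<Sum>as\<leftarrow>ass. \<Sum>k<2. ?c as k) = (\<Sum>as\<leftarrow>ass. 0)"
        by (intro arg_cong[of _ _ sum_list] map_cong) auto
      then show ?thesis using False by (auto simp: fun_apply)
    qed
  qed
  show "gerst_fun tangent 2 \<pi> f \<xi>s p = ?r p"
    unfolding gerst_fun_def
  proof (rule the_equality)
    obtain ass where D: "decomp tangent 2 \<pi> p ass" using exists_decomp_pi by blast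
    show "\<exists>ass. decomp tangent 2 \<pi> p ass \<and> ?r p = (\<Sum>as\<leftarrow>ass. \<Sum>k<2. ?c as k)"
      using D key[OF D, symmetric] by (intro exI[of _ ass]) (rule conjI)
    show "c = ?r p" if "\<exists>ass. decomp tangent 2 \<pi> p ass \<and> c = (\<Sum>as\<leftarrow>ass. \<Sum>k<2. ?c as k)" for c
      using that key by (elim exE conjE) (simp only:)
  qed
qed

text \<open>Brings the class into the form of \<open>algebroid_class\<close>, where the differential
  of f is likewise described by its pairings with 1-forms.\<close>

lemma twisted_class_eq:
  assumes "Z \<in> vfields"
  shows "twisted_class \<pi> Z =
    {Y \<in> vfields. \<exists>f\<in>smooth_funs. \<forall>\<xi>\<in>forms 1. \<xi> [Y] = \<xi> [Z] + sharp \<pi> \<xi> f}"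
proof -
  have "wedge tangent [Y] = wedge tangent [Z] + gerst_fun tangent 2 \<pi> f \<longleftrightarrow>
      (\<forall>\<xi>\<in>forms 1. \<xi> [Y] = \<xi> [Z] + sharp \<pi> \<xi> f)" if "f \<in> smooth_funs" for Y f
  proof
    assume *: "wedge tangent [Y] = wedge tangent [Z] + gerst_fun tangent 2 \<pi> f"
    show "\<forall>\<xi>\<in>forms 1. \<xi> [Y] = \<xi> [Z] + sharp \<pi> \<xi> f"
    proof
      fix \<xi> assume "\<xi> \<in> forms 1"
      then show "\<xi> [Y] = \<xi> [Z] + sharp \<pi> \<xi> f"
        using fun_cong[OF *, of "[\<xi>]"] that
        by (simp add: wedge_single gerst_fun_pi plus_fun_apply[of _ _ "[\<xi>]"]) (simp add: tangent_def)
    qed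
  next
    assume *: "\<forall>\<xi>\<in>forms 1. \<xi> [Y] = \<xi> [Z] + sharp \<pi> \<xi> f"
    show "wedge tangent [Y] = wedge tangent [Z] + gerst_fun tangent 2 \<pi> f"
    proof
      fix \<xi>s
      show "wedge tangent [Y] \<xi>s = (wedge tangent [Z] + gerst_fun tangent 2 \<pi> f) \<xi>s"
        unfolding plus_fun_apply[of _ _ \<xi>s] wedge_single gerst_fun_pi[OF that]
        using * by (cases \<xi>s) (auto simp: tangent_def)
    qed
  qed
  then show ?thesis unfolding twisted_class_def by blast
qed

lemma contract_d_smooth:
  assumes "\<alpha> \<in> forms 1"
  shows "contract 2 \<pi> (ext_d \<alpha>) [] \<in> smooth_funs"
proof (rule smooth_funs_local)
  fix p
  obtain W e \<epsilon> where p: "p \<in> W" and fr: "coframed W e \<epsilon>" by (rule exists_coframe[of p])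
  have "(\<lambda>_. 1 / 2) * (\<Sum>j\<in>UNIV. ext_d \<alpha> [sharp \<pi> (\<epsilon> j), e j]) \<in> smooth_funs"
    using ext_d_form2[OF assms] by (intro smooth_mult smooth_const smooth_sum) simp
  then show "\<exists>W g. open W \<and> p \<in> W \<and> g \<in> smooth_funs \<and> (\<forall>y\<in>W. contract 2 \<pi> (ext_d \<alpha>) [] y = g y)"
    using p coframedD(1)[OF fr] contract_frame[OF ext_d_form2[OF assms] fr]
    by (intro exI[of _ W] exI[of _ "(\<lambda>_. 1 / 2) * (\<Sum>j\<in>UNIV. ext_d \<alpha> [sharp \<pi> (\<epsilon> j), e j])"]) (simp add: fun_apply)
qed

text \<open>Neither term is linear over functions by itself. Passing from \<alpha> to f \<alpha>
  adds the derivative of f along \<pi>^#\<alpha> to the divergence and, through df \<and> \<alpha>,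
  the same to the contraction; the two cancel.\<close>

lemma linear_functional_X:
  assumes vol: "volume_form vol"
  shows "linear_functional (\<lambda>\<alpha>. divergence vol (sharp \<pi> \<alpha>) - contract 2 \<pi> (ext_d \<alpha>) [])"
  unfolding linear_functional_def
proof (intro conjI ballI)
  fix \<alpha> assume "\<alpha> \<in> forms 1"
  then show "divergence vol (sharp \<pi> \<alpha>) - contract 2 \<pi> (ext_d \<alpha>) [] \<in> smooth_funs"
    using vol by (simp add: divergence_smooth contract_d_smooth)
next
  fix \<alpha> \<beta> assume \<alpha>: "\<alpha> \<in> forms 1" and \<beta>: "\<beta> \<in> forms 1"
  have "contract 2 \<pi> (ext_d (\<alpha> + \<beta>)) [] = contract 2 \<pi> (ext_d \<alpha>) [] + contract 2 \<pi> (ext_d \<beta>) []"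
  proof
    fix q
    obtain W e \<epsilon> where q: "q \<in> W" and fr: "coframed W e \<epsilon>" by (rule exists_coframe[of q])
    show "contract 2 \<pi> (ext_d (\<alpha> + \<beta>)) [] q = (contract 2 \<pi> (ext_d \<alpha>) [] + contract 2 \<pi> (ext_d \<beta>) []) q"
      using \<alpha> \<beta> coframedD(2,3)[OF fr]
      by (simp add: contract_frame[OF ext_d_form2 fr q] ext_d_add fun_apply sum.distrib algebra_simps)
  qed
  then show "divergence vol (sharp \<pi> (\<alpha> + \<beta>)) - contract 2 \<pi> (ext_d (\<alpha> + \<beta>)) [] =
      divergence vol (sharp \<pi> \<alpha>) - contract 2 \<pi> (ext_d \<alpha>) [] +
      (divergence vol (sharp \<pi> \<beta>) - contract 2 \<pi> (ext_d \<beta>) [])"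
    using vol \<alpha> \<beta> by (simp add: sharp_add divergence_add)
next
  fix f \<alpha> assume f: "f \<in> smooth_funs" and \<alpha>: "\<alpha> \<in> forms 1"
  let ?d = "ext_d (form0 f)"
  have "contract 2 \<pi> (ext_d (fscale f \<alpha>)) [] = f * contract 2 \<pi> (ext_d \<alpha>) [] + sharp \<pi> \<alpha> f"
  proof
    fix q
    obtain W e \<epsilon> where q: "q \<in> W" and fr: "coframed W e \<epsilon>" by (rule exists_coframe[of q])
    note e = coframedD(2)[OF fr] and \<epsilon> = coframedD(3)[OF fr]
    have pf: "(\<Sum>j\<in>UNIV. \<alpha> [e j] q * \<pi> [\<epsilon> j, \<beta>] q) = \<pi> [\<alpha>, \<beta>] q"
      if "\<alpha> \<in> forms 1" "\<beta> \<in> forms 1" for \<alpha> \<beta>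
      using alt_frame[OF pi_alt module_forms coframedD(6)[OF fr] q, of "[\<alpha>, \<beta>]" 0 \<alpha>] that by simp
    have "(\<Sum>j\<in>UNIV. ext_d (fscale f \<alpha>) [sharp \<pi> (\<epsilon> j), e j] q) =
        (\<Sum>j\<in>UNIV. f q * ext_d \<alpha> [sharp \<pi> (\<epsilon> j), e j] q
           + \<alpha> [e j] q * \<pi> [\<epsilon> j, ?d] q - ?d [e j] q * \<pi> [\<epsilon> j, \<alpha>] q)"
      using e \<epsilon> f \<alpha> by (simp add: ext_d_fscale sharp_apply sharp_pairing df_apply plus_fun_apply minus_apply times_fun_apply mult_ac)
    also have "\<dots> = f q * (\<Sum>j\<in>UNIV. ext_d \<alpha> [sharp \<pi> (\<epsilon> j), e j] q) + \<pi> [\<alpha>, ?d] q - \<pi> [?d, \<alpha>] q"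
      using \<alpha> df_form[OF f] by (simp add: sum.distrib sum_subtractf pf sum_distrib_left)
    also have "\<pi> [?d, \<alpha>] q = - \<pi> [\<alpha>, ?d] q"
      using pi_swap[OF df_form[OF f] \<alpha>] by (simp add: uminus_apply)
    finally show "contract 2 \<pi> (ext_d (fscale f \<alpha>)) [] q = (f * contract 2 \<pi> (ext_d \<alpha>) [] + sharp \<pi> \<alpha> f) q"
      using f \<alpha> by (simp add: contract_frame[OF ext_d_form2 fr q] sharp_apply plus_fun_apply times_fun_apply algebra_simps)
  qed
  then show "divergence vol (sharp \<pi> (fscale f \<alpha>)) - contract 2 \<pi> (ext_d (fscale f \<alpha>)) [] =
      f * (divergence vol (sharp \<pi> \<alpha>) - contract 2 \<pi> (ext_d \<alpha>) [])"
    using vol f \<alpha> by (simp add: sharp_fscale divergence_fscale algebra_simps)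
qed

text \<open>Cancelling vol in the defining equation turns it into a condition on the pairings of X,
  to which the representation of functionals applies.\<close>

lemma mod_X:
  assumes vol: "volume_form vol"
  shows "mod_X \<pi> vol \<in> vfields"
    "\<alpha> \<in> forms 1 \<Longrightarrow> \<alpha> [mod_X \<pi> vol] = divergence vol (sharp \<pi> \<alpha>) - contract 2 \<pi> (ext_d \<alpha>) []"
proof -
  have "fscale (\<alpha> [X]) vol = lie_d (sharp \<pi> \<alpha>) vol - fscale (contract 2 \<pi> (ext_d \<alpha>) []) vol \<longleftrightarrow>
      \<alpha> [X] = divergence vol (sharp \<pi> \<alpha>) - contract 2 \<pi> (ext_d \<alpha>) []" if "\<alpha> \<in> forms 1" for \<alpha> X
  proof -
    have "lie_d (sharp \<pi> \<alpha>) vol - fscale (contract 2 \<pi> (ext_d \<alpha>) []) vol =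
        fscale (divergence vol (sharp \<pi> \<alpha>) - contract 2 \<pi> (ext_d \<alpha>) []) vol"
      using that by (simp add: lie_d_vol[OF vol] fun_eq_iff fun_apply algebra_simps)
    then show ?thesis using ratio_unique[OF vol refl] by metis
  qed
  then have "mod_X \<pi> vol = (THE X. X \<in> vfields \<and> (\<forall>\<alpha>\<in>forms 1.
      \<alpha> [X] = divergence vol (sharp \<pi> \<alpha>) - contract 2 \<pi> (ext_d \<alpha>) []))"
    unfolding mod_X_def by (intro arg_cong[of _ _ The] ext) blast
  then show "mod_X \<pi> vol \<in> vfields"
    "\<alpha> \<in> forms 1 \<Longrightarrow> \<alpha> [mod_X \<pi> vol] = divergence vol (sharp \<pi> \<alpha>) - contract 2 \<pi> (ext_d \<alpha>) []"
    using linear_functional_the[OF linear_functional_X[OF vol]] by auto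
qed

text \<open>The tensoriality at q that \<open>trace_frame\<close> asks of an endomorphism.\<close>

lemma psi_frame:
  assumes fr: "coframed W e \<epsilon>" and q: "q \<in> W" and A: "A \<in> vfields"
  shows "\<beta> \<in> forms 1 \<Longrightarrow> X \<in> vfields \<Longrightarrow> \<psi> [A, sharp \<pi> \<beta>, X] q =
    (\<Sum>j\<in>UNIV. \<Sum>k\<in>UNIV. \<beta> [e j] q * \<epsilon> k [X] q * \<psi> [A, sharp \<pi> (\<epsilon> j), e k] q)"
proof -
  assume \<beta>: "\<beta> \<in> forms 1" and X: "X \<in> vfields"
  note e = coframedD(2)[OF fr] and \<epsilon> = coframedD(3)[OF fr]
  have "\<psi> [A, sharp \<pi> \<beta>, X] q = (\<Sum>j\<in>UNIV. \<beta> [e j] q * \<psi> [A, sharp \<pi> (\<epsilon> j), X] q)"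
    using functional_frame[OF linear_functional_form_sharp[OF three_form, of "[A, A, X]" 1] fr q \<beta>] A X
    by simp
  moreover have "\<psi> [A, sharp \<pi> (\<epsilon> j), X] q = (\<Sum>k\<in>UNIV. \<epsilon> k [X] q * \<psi> [A, sharp \<pi> (\<epsilon> j), e k] q)" for j
    using alt_frame[OF three_form[unfolded forms_def] module_vfields coframedD(5)[OF fr] q,
        of "[A, sharp \<pi> (\<epsilon> j), X]" 2 X] A X \<epsilon> by simp
  ultimately show ?thesis by (simp add: sum_distrib_left mult.assoc)
qed

lemma trace_psi2:
  assumes "coframed W e \<epsilon>" "q \<in> W" "\<alpha> \<in> forms 1"
  shows "trace (psi2 \<pi> \<psi> \<alpha>) q = (\<Sum>i\<in>UNIV. \<psi> [sharp \<pi> \<alpha>, sharp \<pi> (\<epsilon> i), e i] q)"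
  using trace_frame[OF assms(1,2), of "psi2 \<pi> \<psi> \<alpha>"] psi_frame[OF assms(1,2) sharp_vfield[OF assms(3)]]
  unfolding psi2_def by blast

lemma linear_functional_Y: "linear_functional (\<lambda>\<alpha> p. 1 / 2 * trace (psi2 \<pi> \<psi> \<alpha>) p)"
  unfolding linear_functional_def
proof (intro conjI ballI)
  fix \<alpha> assume \<alpha>: "\<alpha> \<in> forms 1"
  show "(\<lambda>p. 1 / 2 * trace (psi2 \<pi> \<psi> \<alpha>) p) \<in> smooth_funs"
  proof (rule smooth_cmult, rule smooth_funs_local)
    fix p
    obtain W e \<epsilon> where p: "p \<in> W" and fr: "coframed W e \<epsilon>" by (rule exists_coframe[of p])
    have "(\<Sum>i\<in>UNIV. \<psi> [sharp \<pi> \<alpha>, sharp \<pi> (\<epsilon> i), e i]) \<in> smooth_funs"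
      using three_form by (intro smooth_sum) simp
    then show "\<exists>W g. open W \<and> p \<in> W \<and> g \<in> smooth_funs \<and> (\<forall>y\<in>W. trace (psi2 \<pi> \<psi> \<alpha>) y = g y)"
      using p coframedD(1)[OF fr] trace_psi2[OF fr _ \<alpha>]
      by (intro exI[of _ W] exI[of _ "\<Sum>i\<in>UNIV. \<psi> [sharp \<pi> \<alpha>, sharp \<pi> (\<epsilon> i), e i]"]) (simp add: fun_apply)
  qed
next
  fix \<alpha> \<beta> assume \<alpha>: "\<alpha> \<in> forms 1" and \<beta>: "\<beta> \<in> forms 1"
  show "(\<lambda>p. 1 / 2 * trace (psi2 \<pi> \<psi> (\<alpha> + \<beta>)) p) =
      (\<lambda>p. 1 / 2 * trace (psi2 \<pi> \<psi> \<alpha>) p) + (\<lambda>p. 1 / 2 * trace (psi2 \<pi> \<psi> \<beta>) p)"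
  proof
    fix q
    obtain W e \<epsilon> where q: "q \<in> W" and fr: "coframed W e \<epsilon>" by (rule exists_coframe[of q])
    have "\<psi> [sharp \<pi> \<alpha> + sharp \<pi> \<beta>, sharp \<pi> (\<epsilon> i), e i] =
        \<psi> [sharp \<pi> \<alpha>, sharp \<pi> (\<epsilon> i), e i] + \<psi> [sharp \<pi> \<beta>, sharp \<pi> (\<epsilon> i), e i]" for i
      using form_add[OF three_form, of "[sharp \<pi> \<alpha>, sharp \<pi> (\<epsilon> i), e i]" 0 "sharp \<pi> \<alpha>" "sharp \<pi> \<beta>"]
        \<alpha> \<beta> coframedD(2,3)[OF fr] by simp
    then show "1 / 2 * trace (psi2 \<pi> \<psi> (\<alpha> + \<beta>)) q =
        ((\<lambda>p. 1 / 2 * trace (psi2 \<pi> \<psi> \<alpha>) p) + (\<lambda>p. 1 / 2 * trace (psi2 \<pi> \<psi> \<beta>) p)) q"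
      using \<alpha> \<beta> by (simp add: trace_psi2[OF fr q] sharp_add fun_apply sum.distrib algebra_simps)
  qed
next
  fix f \<alpha> assume f: "f \<in> smooth_funs" and \<alpha>: "\<alpha> \<in> forms 1"
  show "(\<lambda>p. 1 / 2 * trace (psi2 \<pi> \<psi> (fscale f \<alpha>)) p) = f * (\<lambda>p. 1 / 2 * trace (psi2 \<pi> \<psi> \<alpha>) p)"
  proof
    fix q
    obtain W e \<epsilon> where q: "q \<in> W" and fr: "coframed W e \<epsilon>" by (rule exists_coframe[of q])
    have "\<psi> [fscale f (sharp \<pi> \<alpha>), sharp \<pi> (\<epsilon> i), e i] = f * \<psi> [sharp \<pi> \<alpha>, sharp \<pi> (\<epsilon> i), e i]" for i
      using form_scale[OF three_form, of "[sharp \<pi> \<alpha>, sharp \<pi> (\<epsilon> i), e i]" 0 "sharp \<pi> \<alpha>" f]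
        f \<alpha> coframedD(2,3)[OF fr] by simp
    then show "1 / 2 * trace (psi2 \<pi> \<psi> (fscale f \<alpha>)) q = (f * (\<lambda>p. 1 / 2 * trace (psi2 \<pi> \<psi> \<alpha>) p)) q"
      using f \<alpha> by (simp add: trace_psi2[OF fr q] sharp_fscale fun_apply sum_distrib_left algebra_simps)
  qed
qed

lemma mod_Y:
  "mod_Y \<pi> \<psi> \<in> vfields"
  "\<alpha> \<in> forms 1 \<Longrightarrow> \<alpha> [mod_Y \<pi> \<psi>] = (\<lambda>p. 1 / 2 * trace (psi2 \<pi> \<psi> \<alpha>) p)"
  unfolding mod_Y_def using linear_functional_the[OF linear_functional_Y] by auto

end

section \<open>Wedge products\<close>

lemma wedge_apply:
  assumes "length \<xi>s = length xs" "set \<xi>s \<subseteq> dsec E"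
  shows "wedge E xs \<xi>s p = (\<Sum>\<sigma> | \<sigma> permutes {..<length xs}.
    of_int (sign \<sigma>) * (\<Prod>i<length xs. pairing E (xs ! i) (\<xi>s ! \<sigma> i) p))"
  using assms by (simp add: wedge_def)

lemma wedge_outside: "\<not> (length \<xi>s = length xs \<and> set \<xi>s \<subseteq> dsec E) \<Longrightarrow> wedge E xs \<xi>s = 0"
  by (auto simp: wedge_def)

lemma sign_transpose_compose:
  fixes n :: nat
  assumes "\<sigma> permutes {..<n}" "i < n" "j < n" "i \<noteq> j"
  shows "sign (\<sigma> \<circ> Transposition.transpose i j) = - sign \<sigma>"
    "sign (Transposition.transpose i j \<circ> \<sigma>) = - sign \<sigma>"
proof -
  have "permutation \<sigma>" "permutation (Transposition.transpose i j)"
    by (rule permutes_imp_permutation[OF finite_lessThan assms(1)], rule permutation_swap_id)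
  then show "sign (\<sigma> \<circ> Transposition.transpose i j) = - sign \<sigma>"
    "sign (Transposition.transpose i j \<circ> \<sigma>) = - sign \<sigma>"
    using assms(4) by (simp_all add: sign_compose sign_swap_id)
qed

text \<open>Reindexing the permutations by the transposition \<tau> reverses every sign and
  exchanges the two factors.\<close>

lemma wedge_swap_adjacent:
  "wedge E (ws @ x # y # zs) \<xi>s p = - wedge E (ws @ y # x # zs) \<xi>s p"
proof (cases "length \<xi>s = length (ws @ x # y # zs) \<and> set \<xi>s \<subseteq> dsec E")
  case True
  define n where "n = length (ws @ x # y # zs)"
  define a where "a = length ws"
  define \<tau> where "\<tau> = Transposition.transpose a (Suc a)"
  let ?xs = "ws @ x # y # zs" and ?ys = "ws @ y # x # zs"
  let ?P = "\<lambda>us \<sigma>. \<Prod>i<n. pairing E (us ! i) (\<xi>s ! \<sigma> i) p"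
  have a: "a < n" "Suc a < n" by (simp_all add: a_def n_def)
  have \<tau>: "\<tau> permutes {..<n}" unfolding \<tau>_def using a by (intro permutes_swap_id) auto
  have nth: "?ys ! \<tau> i = ?xs ! i" for i
    by (auto simp: \<tau>_def a_def Transposition.transpose_def nth_append nth_Cons split: nat.split)
  have "wedge E ?ys \<xi>s p = (\<Sum>\<sigma> | \<sigma> permutes {..<n}. of_int (sign \<sigma>) * ?P ?ys \<sigma>)"
    using True by (subst wedge_apply) (simp_all add: n_def)
  also have "\<dots> = (\<Sum>\<sigma> | \<sigma> permutes {..<n}. of_int (sign (\<sigma> \<circ> \<tau>)) * ?P ?ys (\<sigma> \<circ> \<tau>))"
    by (rule sum_permutations_compose_right[OF \<tau>])
  also have "\<dots> = (\<Sum>\<sigma> | \<sigma> permutes {..<n}. - (of_int (sign \<sigma>) * ?P ?xs \<sigma>))"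
  proof (rule sum.cong[OF refl], clarify)
    fix \<sigma> assume \<sigma>: "\<sigma> permutes {..<n}"
    have "?P ?ys (\<sigma> \<circ> \<tau>) = (\<Prod>i<n. pairing E (?ys ! \<tau> i) (\<xi>s ! (\<sigma> \<circ> \<tau>) (\<tau> i)) p)"
      using prod.permute[OF \<tau>, of "\<lambda>i. pairing E (?ys ! i) (\<xi>s ! (\<sigma> \<circ> \<tau>) i) p"] by (simp add: o_def)
    also have "\<dots> = ?P ?xs \<sigma>" unfolding nth by (simp add: \<tau>_def)
    finally show "of_int (sign (\<sigma> \<circ> \<tau>)) * ?P ?ys (\<sigma> \<circ> \<tau>) = - (of_int (sign \<sigma>) * ?P ?xs \<sigma>)"
      using sign_transpose_compose(1)[OF \<sigma> a(1,2)] by (simp add: \<tau>_def)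
  qed
  also have "\<dots> = - wedge E ?xs \<xi>s p"
    using True by (subst wedge_apply) (simp_all add: n_def sum_negf)
  finally show ?thesis by simp
next
  case False
  then show ?thesis by (subst (1 2) wedge_outside) (auto simp: fun_apply)
qed

lemma wedge_move:
  "wedge E (ws @ c # ys @ zs) \<xi>s p = (-1) ^ length ys * wedge E (ws @ ys @ c # zs) \<xi>s p"
proof (induction ys arbitrary: ws)
  case (Cons y ys)
  have "wedge E (ws @ c # (y # ys) @ zs) \<xi>s p = - wedge E ((ws @ [y]) @ c # ys @ zs) \<xi>s p"
    using wedge_swap_adjacent[of E ws c y "ys @ zs"] by simp
  also have "\<dots> = - ((-1) ^ length ys * wedge E ((ws @ [y]) @ ys @ c # zs) \<xi>s p)"
    unfolding Cons.IH ..
  finally show ?case by simp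
qed simp

text \<open>The sign in the bracket formula is exactly what moves the new factor from the front to
  the place of the one it replaces. The bracket with a section of degree 1 thereby becomes a Leibniz
  sum.\<close>

lemma wedge_Cons_omit:
  assumes "l < length bs"
  shows "(-1) ^ l * wedge E (c # omit l bs) \<xi>s p = wedge E (bs[l := c]) \<xi>s p"
proof -
  have "wedge E (c # omit l bs) \<xi>s p = (-1) ^ l * wedge E (bs[l := c]) \<xi>s p"
    using wedge_move[of E "[]" c "take l bs" "drop (Suc l) bs" \<xi>s p] assms
    by (simp add: omit_def upd_conv_take_nth_drop)
  then show ?thesis by (simp add: power_add[symmetric] mult.assoc[symmetric])
qed

lemma wedge_update_left:
  assumes "length \<xi>s = length bs" "set \<xi>s \<subseteq> dsec E" "l < length bs"
  shows "wedge E (bs[l := c]) \<xi>s p = (\<Sum>\<sigma> | \<sigma> permutes {..<length bs}. of_int (sign \<sigma>) *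
    (pairing E c (\<xi>s ! \<sigma> l) p * (\<Prod>i\<in>{..<length bs} - {l}. pairing E (bs ! i) (\<xi>s ! \<sigma> i) p)))"
  using assms by (simp add: wedge_apply prod.remove[of "{..<length bs}" l])

text \<open>In the summand of \<sigma> the argument in slot j meets the factor at
  \<open>inv \<sigma> j\<close>; splitting this off leaves a product free of u.\<close>

lemma wedge_update_right:
  assumes len: "length \<xi>s = length bs" and "set \<xi>s \<subseteq> dsec E" "u \<in> dsec E" and j: "j < length bs"
  shows "wedge E bs (\<xi>s[j := u]) p = (\<Sum>\<sigma> | \<sigma> permutes {..<length bs}. of_int (sign \<sigma>) *
    (pairing E (bs ! inv \<sigma> j) u p * (\<Prod>i\<in>{..<length bs} - {inv \<sigma> j}. pairing E (bs ! i) (\<xi>s ! \<sigma> i) p)))"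
proof -
  have "(\<Prod>i<length bs. pairing E (bs ! i) (\<xi>s[j := u] ! \<sigma> i) p) =
      pairing E (bs ! inv \<sigma> j) u p * (\<Prod>i\<in>{..<length bs} - {inv \<sigma> j}. pairing E (bs ! i) (\<xi>s ! \<sigma> i) p)"
    if \<sigma>: "\<sigma> permutes {..<length bs}" for \<sigma>
  proof -
    have 1: "inv \<sigma> j < length bs" using permutes_in_image[OF permutes_inv[OF \<sigma>], of j] j by simp
    have 2: "\<sigma> (inv \<sigma> j) = j" using permutes_inverses(1)[OF \<sigma>] by simp
    have "\<sigma> i \<noteq> j" if "i \<noteq> inv \<sigma> j" for i using that permutes_inverses(2)[OF \<sigma>] by metis
    then have "(\<Prod>i\<in>{..<length bs} - {inv \<sigma> j}. pairing E (bs ! i) (\<xi>s[j := u] ! \<sigma> i) p) =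
        (\<Prod>i\<in>{..<length bs} - {inv \<sigma> j}. pairing E (bs ! i) (\<xi>s ! \<sigma> i) p)"
      by (intro prod.cong refl) (metis DiffD2 nth_list_update_neq singletonI)
    then show ?thesis using 1 2 j len by (simp add: prod.remove[of "{..<length bs}" "inv \<sigma> j"])
  qed
  then show ?thesis using assms set_update_subsetI[OF assms(2,3)] by (simp add: wedge_apply)
qed

text \<open>Composing on the left with the transposition of i and j reverses the sign of each
  summand and changes nothing else, so the sum equals its negative.\<close>

lemma wedge_repeat:
  assumes ij: "i < length xs" "j < length xs" "i \<noteq> j" "\<xi>s ! i = \<xi>s ! j"
  shows "wedge E xs \<xi>s p = 0"
proof (cases "length \<xi>s = length xs \<and> set \<xi>s \<subseteq> dsec E")
  case True
  define \<tau> where "\<tau> = Transposition.transpose i j"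
  let ?n = "length xs"
  let ?P = "\<lambda>\<sigma>. \<Prod>i<?n. pairing E (xs ! i) (\<xi>s ! \<sigma> i) p"
  have \<tau>: "\<tau> permutes {..<?n}" unfolding \<tau>_def using ij by (intro permutes_swap_id) auto
  have "wedge E xs \<xi>s p = (\<Sum>\<sigma> | \<sigma> permutes {..<?n}. of_int (sign \<sigma>) * ?P \<sigma>)"
    using True by (simp add: wedge_apply)
  also have "\<dots> = (\<Sum>\<sigma> | \<sigma> permutes {..<?n}. of_int (sign (\<tau> \<circ> \<sigma>)) * ?P (\<tau> \<circ> \<sigma>))"
    by (rule setum_permutations_compose_left[OF \<tau>])
  also have "\<dots> = (\<Sum>\<sigma> | \<sigma> permutes {..<?n}. - (of_int (sign \<sigma>) * ?P \<sigma>))"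
  proof (rule sum.cong[OF refl], clarify)
    fix \<sigma> assume \<sigma>: "\<sigma> permutes {..<?n}"
    have "\<xi>s ! \<tau> l = \<xi>s ! l" for l using ij(4) by (auto simp: \<tau>_def Transposition.transpose_def)
    then show "of_int (sign (\<tau> \<circ> \<sigma>)) * ?P (\<tau> \<circ> \<sigma>) = - (of_int (sign \<sigma>) * ?P \<sigma>)"
      using sign_transpose_compose(2)[OF \<sigma> ij(1-3)] by (simp add: \<tau>_def)
  qed
  also have "\<dots> = - wedge E xs \<xi>s p" using True by (simp add: wedge_apply sum_negf)
  finally show ?thesis by simp
next
  case False
  then show ?thesis by (subst wedge_outside) (auto simp: fun_apply)
qed

context smooth_manifold
begin

lemma vfield_prod:
  assumes X: "X \<in> vfields" and "finite I" "\<And>i. i \<in> I \<Longrightarrow> f i \<in> smooth_funs"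
  shows "X (\<lambda>p. \<Prod>i\<in>I. f i p) q = (\<Sum>l\<in>I. X (f l) q * (\<Prod>i\<in>I - {l}. f i q))"
  using assms(2,3)
proof (induction I rule: finite_induct)
  case empty
  show ?case using vfield_const[OF X, of 1] by (simp add: fun_apply)
next
  case (insert i I)
  have sm: "(\<lambda>p. \<Prod>i\<in>I. f i p) \<in> smooth_funs" using insert.prems by (intro smooth_prod) auto
  have "(\<lambda>p. \<Prod>i\<in>insert i I. f i p) = f i * (\<lambda>p. \<Prod>i\<in>I. f i p)"
    using insert.hyps by (simp add: times_fun_def)
  then have "X (\<lambda>p. \<Prod>i\<in>insert i I. f i p) q = X (f i * (\<lambda>p. \<Prod>i\<in>I. f i p)) q" by simp
  also have "\<dots> = X (f i) q * (\<Prod>i\<in>I. f i q) + f i q * X (\<lambda>p. \<Prod>i\<in>I. f i p) q"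
    using X sm insert.prems by (simp add: vfield_mult fun_apply)
  also have "X (\<lambda>p. \<Prod>i\<in>I. f i p) q = (\<Sum>l\<in>I. X (f l) q * (\<Prod>i\<in>I - {l}. f i q))"
    using insert by simp
  also have "f i q * (\<Sum>l\<in>I. X (f l) q * (\<Prod>i\<in>I - {l}. f i q)) =
      (\<Sum>l\<in>I. X (f l) q * (\<Prod>i\<in>insert i I - {l}. f i q))"
    unfolding sum_distrib_left
  proof (rule sum.cong[OF refl])
    fix l assume "l \<in> I"
    then have "insert i I - {l} = insert i (I - {l})" "i \<notin> I - {l}" using insert.hyps by auto
    then show "f i q * (X (f l) q * (\<Prod>i\<in>I - {l}. f i q)) = X (f l) q * (\<Prod>i\<in>insert i I - {l}. f i q)"
      using insert.hyps by simp
  qed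
  finally show ?case using insert.hyps by simp
qed

text \<open>The values on coordinate functions are the components of the vector field in a frame,
  since the differentials of these functions form the coframe.\<close>

lemma form1_pointwise:
  assumes "\<beta> \<in> forms 1" "D \<in> vfields" "D' \<in> vfields" "\<And>f. f \<in> smooth_funs \<Longrightarrow> D f p = D' f p"
  shows "\<beta> [D] p = \<beta> [D'] p"
proof -
  obtain W e x where "p \<in> W" "\<And>i. x i \<in> smooth_funs" "coframed W e (\<lambda>i. ext_d (form0 (x i)))"
    by (rule exists_frame[of p]) blast
  then show ?thesis using assms by (simp add: coframed_pairing[of W e _ p \<beta>] df_apply)
qed

lemma form_pointwise:
  assumes "\<omega> \<in> forms k" "length xs = k" "set xs \<subseteq> vfields" "i < k"
    and D: "D \<in> vfields" "D' \<in> vfields" "\<And>f. f \<in> smooth_funs \<Longrightarrow> D f p = D' f p"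
  shows "\<omega> (xs[i := D]) p = \<omega> (xs[i := D']) p"
proof -
  obtain W e \<epsilon> where q: "p \<in> W" and fr: "coframed W e \<epsilon>" by (rule exists_coframe[of p])
  have "\<epsilon> j [D] p = \<epsilon> j [D'] p" for j using form1_pointwise[OF coframedD(3)[OF fr] D] .
  then show ?thesis
    using alt_frame[OF assms(1)[unfolded forms_def] module_vfields coframedD(5)[OF fr] q assms(2-4)] D by simp
qed

end

section \<open>The cotangent Lie algebroid\<close>

context bivector_manifold
begin

abbreviation "E \<equiv> cotangent_algebroid \<pi> \<psi>"

lemma cotangent_simps [simp]:
  "sec E = forms 1" "dsec E = vfields" "pairing E = (\<lambda>\<alpha> X. \<alpha> [X])" "rk E = CARD('n)"
  "anchor E = sharp \<pi>" "brk E = cotangent_bracket \<pi> \<psi>"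
  by (simp_all add: cotangent_algebroid_def cotangent_bundle_def vbundle.defs algebroid.defs)

lemma minus_fun_apply2: "(f - g) x = f x - (g x :: 'a \<Rightarrow> real)"
  by (rule minus_apply)

lemma bracket_pairing:
  assumes "\<alpha> \<in> forms 1" "\<beta> \<in> forms 1" "X \<in> vfields"
  shows "cotangent_bracket \<pi> \<psi> \<alpha> \<beta> [X] = sharp \<pi> \<alpha> (\<beta> [X]) - \<beta> [vbracket (sharp \<pi> \<alpha>) X]
    - ext_d \<alpha> [sharp \<pi> \<beta>, X] + \<psi> [sharp \<pi> \<alpha>, sharp \<pi> \<beta>, X]"
proof -
  have lie: "lie_d A \<gamma> [X] = A (\<gamma> [X]) - \<gamma> [vbracket A X]" for A \<gamma>
    using assms(3) by (simp add: lie_d_def)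
  \<comment> \<open>Through this sign the term X(\<alpha>(\<pi>^#\<beta>)) of
    d\<alpha>(\<pi>^#\<beta>, X) accounts for the term d(\<pi>(\<alpha>, \<beta>)) of the
    bracket.\<close>
  have "\<alpha> [sharp \<pi> \<beta>] = - \<pi> [\<alpha>, \<beta>]"
    using assms pi_swap[of \<beta> \<alpha>] by (simp add: sharp_pairing)
  then have "X (\<alpha> [sharp \<pi> \<beta>]) = - X (\<pi> [\<alpha>, \<beta>])" using assms by (simp add: vfield_uminus)
  then show ?thesis
    using assms unfolding cotangent_bracket_def plus_fun_apply2 minus_fun_apply2
    by (simp add: lie df_apply ext_d_pair psi2_def)
qed

text \<open>The tensorial part of the dual Lie derivative along \<open>\<alpha>\<close>; its trace is \<open>2 i\<^sub>\<pi> d\<alpha> - Tr \<Psi>\<^sub>\<alpha>\<close>.\<close>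

definition dual_tensor :: "'m form \<Rightarrow> 'm vfield \<Rightarrow> 'm vfield" where
  "dual_tensor \<alpha> X = (THE Y. Y \<in> vfields \<and>
     (\<forall>\<beta>\<in>forms 1. \<beta> [Y] = ext_d \<alpha> [sharp \<pi> \<beta>, X] - \<psi> [sharp \<pi> \<alpha>, sharp \<pi> \<beta>, X]))"

text \<open>The Lie derivative along \<alpha> on TM, the dual bundle of the algebroid: the transpose
  of the bracket with \<alpha> under the pairing.\<close>

definition dual_lie :: "'m form \<Rightarrow> 'm vfield \<Rightarrow> 'm vfield" where
  "dual_lie \<alpha> X = vbracket (sharp \<pi> \<alpha>) X + dual_tensor \<alpha> X"

lemma dual_tensor:
  assumes "\<alpha> \<in> forms 1" "X \<in> vfields"
  shows "dual_tensor \<alpha> X \<in> vfields"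
    "\<beta> \<in> forms 1 \<Longrightarrow> \<beta> [dual_tensor \<alpha> X] = ext_d \<alpha> [sharp \<pi> \<beta>, X] - \<psi> [sharp \<pi> \<alpha>, sharp \<pi> \<beta>, X]"
proof -
  have 1: "linear_functional (\<lambda>\<beta>. ext_d \<alpha> [sharp \<pi> \<beta>, X])"
    using linear_functional_form_sharp[OF ext_d_form2[OF assms(1)], of "[X, X]" 0] assms by simp
  have 2: "linear_functional (\<lambda>\<beta>. \<psi> [sharp \<pi> \<alpha>, sharp \<pi> \<beta>, X])"
    using linear_functional_form_sharp[OF three_form, of "[sharp \<pi> \<alpha>, X, X]" 1] assms by simp
  have "linear_functional (\<lambda>\<beta>. ext_d \<alpha> [sharp \<pi> \<beta>, X] - \<psi> [sharp \<pi> \<alpha>, sharp \<pi> \<beta>, X])"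
    using 1 2 unfolding linear_functional_def by (auto simp: algebra_simps)
  from linear_functional_the[OF this] show "dual_tensor \<alpha> X \<in> vfields"
    "\<beta> \<in> forms 1 \<Longrightarrow> \<beta> [dual_tensor \<alpha> X] = ext_d \<alpha> [sharp \<pi> \<beta>, X] - \<psi> [sharp \<pi> \<alpha>, sharp \<pi> \<beta>, X]"
    unfolding dual_tensor_def by auto
qed

lemma dual_lie_vfield [simp]: "\<alpha> \<in> forms 1 \<Longrightarrow> X \<in> vfields \<Longrightarrow> dual_lie \<alpha> X \<in> vfields"
  by (simp add: dual_lie_def dual_tensor)

lemma dual_lie_pairing:
  "\<alpha> \<in> forms 1 \<Longrightarrow> X \<in> vfields \<Longrightarrow> \<beta> \<in> forms 1 \<Longrightarrow> \<beta> [dual_lie \<alpha> X] =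
    \<beta> [vbracket (sharp \<pi> \<alpha>) X] + (ext_d \<alpha> [sharp \<pi> \<beta>, X] - \<psi> [sharp \<pi> \<alpha>, sharp \<pi> \<beta>, X])"
  by (simp add: dual_lie_def dual_tensor form1_add)

lemma bracket_dual_lie:
  "\<alpha> \<in> forms 1 \<Longrightarrow> \<beta> \<in> forms 1 \<Longrightarrow> X \<in> vfields \<Longrightarrow>
    cotangent_bracket \<pi> \<psi> \<alpha> \<beta> [X] = sharp \<pi> \<alpha> (\<beta> [X]) - \<beta> [dual_lie \<alpha> X]"
  by (simp add: bracket_pairing dual_lie_pairing)

lemma dual_tensor_derivation:
  assumes \<alpha>: "\<alpha> \<in> forms 1"
  shows "module_derivation 0 (dual_tensor \<alpha>)"
  unfolding module_derivation_def
proof (intro conjI ballI)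
  fix X Y assume X: "X \<in> vfields" and Y: "Y \<in> vfields"
  show "dual_tensor \<alpha> (X + Y) = dual_tensor \<alpha> X + dual_tensor \<alpha> Y"
  proof (rule vfield_eqI)
    fix \<beta> assume \<beta>: "\<beta> \<in> forms 1"
    have "ext_d \<alpha> [sharp \<pi> \<beta>, X + Y] = ext_d \<alpha> [sharp \<pi> \<beta>, X] + ext_d \<alpha> [sharp \<pi> \<beta>, Y]"
      using form_add[OF ext_d_form2[OF \<alpha>], of "[sharp \<pi> \<beta>, X]" 1 X Y] \<beta> X Y by simp
    moreover have "\<psi> [sharp \<pi> \<alpha>, sharp \<pi> \<beta>, X + Y] = \<psi> [sharp \<pi> \<alpha>, sharp \<pi> \<beta>, X] + \<psi> [sharp \<pi> \<alpha>, sharp \<pi> \<beta>, Y]"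
      using form_add[OF three_form, of "[sharp \<pi> \<alpha>, sharp \<pi> \<beta>, X]" 2 X Y] \<alpha> \<beta> X Y by simp
    ultimately show "\<beta> [dual_tensor \<alpha> (X + Y)] = \<beta> [dual_tensor \<alpha> X + dual_tensor \<alpha> Y]"
      using \<alpha> \<beta> X Y by (simp add: dual_tensor form1_add)
  qed (use \<alpha> X Y in \<open>simp_all add: dual_tensor\<close>)
next
  fix f X assume f: "f \<in> smooth_funs" and X: "X \<in> vfields"
  have "dual_tensor \<alpha> (fscale f X) = fscale f (dual_tensor \<alpha> X)"
  proof (rule vfield_eqI)
    fix \<beta> assume \<beta>: "\<beta> \<in> forms 1"
    have "ext_d \<alpha> [sharp \<pi> \<beta>, fscale f X] = f * ext_d \<alpha> [sharp \<pi> \<beta>, X]"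
      using form_scale[OF ext_d_form2[OF \<alpha>], of "[sharp \<pi> \<beta>, X]" 1 X f] \<beta> X f by simp
    moreover have "\<psi> [sharp \<pi> \<alpha>, sharp \<pi> \<beta>, fscale f X] = f * \<psi> [sharp \<pi> \<alpha>, sharp \<pi> \<beta>, X]"
      using form_scale[OF three_form, of "[sharp \<pi> \<alpha>, sharp \<pi> \<beta>, X]" 2 X f] \<alpha> \<beta> X f by simp
    ultimately show "\<beta> [dual_tensor \<alpha> (fscale f X)] = \<beta> [fscale f (dual_tensor \<alpha> X)]"
      using \<alpha> \<beta> X f by (simp add: dual_tensor form1_scale algebra_simps)
  qed (use \<alpha> f X in \<open>simp_all add: dual_tensor\<close>)
  moreover have "fscale ((0 :: 'm vfield) f) X = 0" by (simp add: fun_eq_iff fun_apply)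
  ultimately show "dual_tensor \<alpha> (fscale f X) = fscale f (dual_tensor \<alpha> X) + fscale ((0 :: 'm vfield) f) X"
    by simp
qed (use \<alpha> in \<open>simp_all add: dual_tensor\<close>)

lemma dual_lie_derivation:
  assumes "\<alpha> \<in> forms 1"
  shows "module_derivation (sharp \<pi> \<alpha>) (dual_lie \<alpha>)"
proof -
  have zero: "fscale ((0 :: 'm vfield) f) X = 0" for f and X :: "'m vfield"
    by (simp add: fun_eq_iff fun_apply)
  show ?thesis
    using module_derivation_vbracket[OF sharp_vfield[OF assms]] dual_tensor_derivation[OF assms]
    unfolding module_derivation_def dual_lie_def zero
    by (auto simp: fun_eq_iff fun_apply algebra_simps)
qed

lemma vbracket_add_left:
  "X \<in> vfields \<Longrightarrow> Y \<in> vfields \<Longrightarrow> Z \<in> vfields \<Longrightarrow> vbracket (X + Y) Z = vbracket X Z + vbracket Y Z"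
  using vbracket_add_right[of Z X Y] by (simp add: vbracket_swap[of _ Z])

lemma dual_lie_add:
  assumes "\<alpha> \<in> forms 1" "\<beta> \<in> forms 1" "X \<in> vfields"
  shows "dual_lie (\<alpha> + \<beta>) X = dual_lie \<alpha> X + dual_lie \<beta> X"
proof (rule vfield_eqI)
  fix \<gamma> assume \<gamma>: "\<gamma> \<in> forms 1"
  have "\<psi> [sharp \<pi> \<alpha> + sharp \<pi> \<beta>, sharp \<pi> \<gamma>, X] = \<psi> [sharp \<pi> \<alpha>, sharp \<pi> \<gamma>, X] + \<psi> [sharp \<pi> \<beta>, sharp \<pi> \<gamma>, X]"
    using form_add[OF three_form, of "[sharp \<pi> \<alpha>, sharp \<pi> \<gamma>, X]" 0 "sharp \<pi> \<alpha>" "sharp \<pi> \<beta>"] assms \<gamma> by simp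
  then show "\<gamma> [dual_lie (\<alpha> + \<beta>) X] = \<gamma> [dual_lie \<alpha> X + dual_lie \<beta> X]"
    using assms \<gamma> by (simp add: dual_lie_pairing form1_add sharp_add vbracket_add_left ext_d_add)
qed (use assms in simp_all)

lemma dual_lie_local:
  assumes \<alpha>: "\<alpha> \<in> forms 1" "\<beta> \<in> forms 1" and U: "open U" "p \<in> U"
    and eq: "\<And>X y. X \<in> vfields \<Longrightarrow> y \<in> U \<Longrightarrow> \<alpha> [X] y = \<beta> [X] y"
  shows "y \<in> U \<Longrightarrow> f \<in> smooth_funs \<Longrightarrow> sharp \<pi> \<alpha> f y = sharp \<pi> \<beta> f y"
    "X \<in> vfields \<Longrightarrow> f \<in> smooth_funs \<Longrightarrow> dual_lie \<alpha> X f p = dual_lie \<beta> X f p"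
proof -
  show sh: "sharp \<pi> \<alpha> f y = sharp \<pi> \<beta> f y" if "y \<in> U" "f \<in> smooth_funs" for f y
  proof -
    \<comment> \<open>By antisymmetry \<gamma> enters only through its pairing with the fixed vector
      field \<pi>^# df.\<close>
    have "\<pi> [\<gamma>, ext_d (form0 f)] y = - \<gamma> [sharp \<pi> (ext_d (form0 f))] y" if "\<gamma> \<in> forms 1" for \<gamma>
      using that \<open>f \<in> smooth_funs\<close> pi_swap[OF that df_form] by (simp add: sharp_pairing df_form uminus_apply)
    then show ?thesis using that \<alpha> eq by (simp add: sharp_apply df_form)
  qed
  assume X: "X \<in> vfields" and f: "f \<in> smooth_funs"
  let ?A = "sharp \<pi> \<alpha>" and ?B = "sharp \<pi> \<beta>" and ?d = "ext_d (form0 f)"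
  let ?C = "sharp \<pi> ?d"
  have d: "?d \<in> forms 1" using df_form[OF f] .
  have C: "?C \<in> vfields" using d by simp
  have br: "vbracket ?A X g p = vbracket ?B X g p" if g: "g \<in> smooth_funs" for g
  proof -
    \<comment> \<open>Here agreement on all of U is used, since X differentiates once more at
      p.\<close>
    have "X (?A g) p = X (?B g) p"
      using vfield_local[OF X _ _ U] sh g \<alpha> by simp
    then show ?thesis using sh[OF U(2)] X g by (simp add: vbracket_def minus_apply)
  qed
  have "?d [vbracket ?A X] p = ?d [vbracket ?B X] p"
    using br f \<alpha> X by (simp add: df_apply)
  moreover have "ext_d \<alpha> [?C, X] p = ext_d \<beta> [?C, X] p"
  proof -
    have "?C (\<alpha> [X]) p = ?C (\<beta> [X]) p" "X (\<alpha> [?C]) p = X (\<beta> [?C]) p"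
      using vfield_local[OF C _ _ U] vfield_local[OF X _ _ U] eq \<alpha> X C by simp_all
    then show ?thesis using C X U(2) eq by (simp add: ext_d_pair minus_apply)
  qed
  moreover have "\<psi> [?A, ?C, X] p = \<psi> [?B, ?C, X] p"
    using form_pointwise[OF three_form, of "[?A, ?C, X]" 0 ?A ?B p] sh[OF U(2)] \<alpha> C X by simp
  ultimately have "?d [dual_lie \<alpha> X] p = ?d [dual_lie \<beta> X] p"
    using \<alpha> X d by (simp add: dual_lie_pairing plus_fun_apply minus_apply)
  then show "dual_lie \<alpha> X f p = dual_lie \<beta> X f p"
    using \<alpha> X by (simp add: df_apply)
qed

abbreviation "D_top \<alpha> \<omega> \<equiv> dact (sharp \<pi> \<alpha>) (dual_lie \<alpha>) \<omega>"

lemma D_top_form: "\<alpha> \<in> forms 1 \<Longrightarrow> \<omega> \<in> forms k \<Longrightarrow> D_top \<alpha> \<omega> \<in> forms k"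
  using dact_form[OF dual_lie_derivation] .

lemma D_top_local:
  assumes \<alpha>: "\<alpha> \<in> forms 1" "\<beta> \<in> forms 1" and U: "open U" "p \<in> U"
    and eq: "\<And>X y. X \<in> vfields \<Longrightarrow> y \<in> U \<Longrightarrow> \<alpha> [X] y = \<beta> [X] y" and \<omega>: "\<omega> \<in> forms k"
  shows "D_top \<alpha> \<omega> \<xi>s p = D_top \<beta> \<omega> \<xi>s p"
proof (cases "length \<xi>s = k \<and> set \<xi>s \<subseteq> vfields")
  case True
  have "\<omega> (\<xi>s[i := dual_lie \<alpha> (\<xi>s ! i)]) p = \<omega> (\<xi>s[i := dual_lie \<beta> (\<xi>s ! i)]) p" if "i < k" for i
  proof -
    have X: "\<xi>s ! i \<in> vfields" using True that by auto
    show ?thesis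
      using True that X \<alpha> by (intro form_pointwise[OF \<omega>] dual_lie_local(2)[OF \<alpha> U eq]) auto
  qed
  moreover have "sharp \<pi> \<alpha> (\<omega> \<xi>s) p = sharp \<pi> \<beta> (\<omega> \<xi>s) p"
    using \<omega> U(2) by (intro dual_lie_local(1)[OF \<alpha> U eq]) auto
  ultimately show ?thesis using True by (simp add: dact_def fun_apply)
next
  case False
  then show ?thesis
    using forms_outside[OF D_top_form[OF \<alpha>(1) \<omega>]] forms_outside[OF D_top_form[OF \<alpha>(2) \<omega>]] by simp
qed

lemma D_top_add:
  assumes "\<alpha> \<in> forms 1" "\<beta> \<in> forms 1" "\<omega> \<in> forms k"
  shows "D_top (\<alpha> + \<beta>) \<omega> = D_top \<alpha> \<omega> + D_top \<beta> \<omega>"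
proof -
  have "D_top (\<alpha> + \<beta>) \<omega> = dact (sharp \<pi> \<alpha> + sharp \<pi> \<beta>) (\<lambda>X. dual_lie \<alpha> X + dual_lie \<beta> X) \<omega>"
    using assms by (intro dact_cong) (simp_all add: sharp_add dual_lie_add)
  also have "\<dots> = D_top \<alpha> \<omega> + D_top \<beta> \<omega>"
    using assms by (intro dact_add[OF assms(3)]) auto
  finally show ?thesis .
qed

lemma forms_zero [simp]: "0 \<in> forms k"
  unfolding forms_def by (rule altI) (simp_all add: zero_fun_apply)

lemma D_top_zero:
  assumes "\<omega> \<in> forms k"
  shows "D_top 0 \<omega> = 0"
proof -
  have "D_top (0 + 0) \<omega> = D_top 0 \<omega> + D_top 0 \<omega>" by (rule D_top_add[OF forms_zero forms_zero assms])
  then show ?thesis by (metis add_0 add_cancel_right_right)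
qed

lemma D_top_sum_list:
  assumes "\<omega> \<in> forms k" "set as \<subseteq> forms 1"
  shows "sum_list as \<in> forms 1 \<and> D_top (sum_list as) \<omega> = (\<Sum>a\<leftarrow>as. D_top a \<omega>)"
  using assms(2)
proof (induction as)
  case Nil
  then show ?case using D_top_zero[OF assms(1)] by simp
next
  case (Cons a as)
  then show ?case using D_top_add[OF _ _ assms(1)] by simp
qed

lemma wedge_form:
  assumes "set bs \<subseteq> forms 1"
  shows "wedge E bs \<in> forms (length bs)"
  unfolding forms_def
proof (rule altI)
  let ?n = "length bs"
  have b: "bs ! i \<in> forms 1" if "i < ?n" for i using assms that by auto
  fix \<xi>s :: "'m vfield list" 
  show "wedge E bs \<xi>s = 0" if "\<not> (length \<xi>s = ?n \<and> set \<xi>s \<subseteq> vfields)"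
    using that by (intro wedge_outside) simp
  assume len: "length \<xi>s = ?n" and \<xi>s: "set \<xi>s \<subseteq> vfields"
  have "wedge E bs \<xi>s = (\<Sum>\<sigma> | \<sigma> permutes {..<?n}.
      (\<lambda>_. of_int (sign \<sigma>)) * (\<lambda>p. \<Prod>i<?n. (bs ! i) [\<xi>s ! \<sigma> i] p))"
    using len \<xi>s by (intro ext) (simp add: wedge_apply fun_apply)
  also have "\<dots> \<in> smooth_funs"
    using form_smooth[OF b] by (intro smooth_sum smooth_mult smooth_const smooth_prod) auto
  finally show "wedge E bs \<xi>s \<in> smooth_funs" .
  fix i assume i: "i < ?n"
  have X: "\<xi>s ! i \<in> vfields" using i \<xi>s len by auto
  have inv: "bs ! inv \<sigma> i \<in> forms 1" if "\<sigma> permutes {..<?n}" for \<sigma>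
    using permutes_in_image[OF permutes_inv[OF that], of i] i b by simp
  have upd: "wedge E bs (\<xi>s[i := u]) p = (\<Sum>\<sigma> | \<sigma> permutes {..<?n}. of_int (sign \<sigma>) *
      ((bs ! inv \<sigma> i) [u] p * (\<Prod>j\<in>{..<?n} - {inv \<sigma> i}. (bs ! j) [\<xi>s ! \<sigma> j] p)))"
    if "u \<in> vfields" for u p
    using wedge_update_right[of \<xi>s bs E u i p] len \<xi>s i that by simp
  have upd0: "wedge E bs \<xi>s = wedge E bs (\<xi>s[i := \<xi>s ! i])" by simp
  show "wedge E bs (\<xi>s[i := \<xi>s ! i + v]) = wedge E bs \<xi>s + wedge E bs (\<xi>s[i := v])"
    if v: "v \<in> vfields" for v
  proof
    fix p
    show "wedge E bs (\<xi>s[i := \<xi>s ! i + v]) p = (wedge E bs \<xi>s + wedge E bs (\<xi>s[i := v])) p"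
      unfolding upd0 plus_fun_apply[of _ _ p] upd[OF vfields_add[OF X v]] upd[OF X] upd[OF v] sum.distrib[symmetric]
      using inv form1_add[OF _ X v] by (intro sum.cong refl) (simp add: fun_apply algebra_simps)
  qed
  show "wedge E bs (\<xi>s[i := fscale f (\<xi>s ! i)]) = f * wedge E bs \<xi>s" if f: "f \<in> smooth_funs" for f
  proof
    fix p
    show "wedge E bs (\<xi>s[i := fscale f (\<xi>s ! i)]) p = (f * wedge E bs \<xi>s) p"
      unfolding upd0 times_fun_apply[of _ _ p] upd[OF vfields_fscale[OF f X]] upd[OF X] sum_distrib_left
      using inv form1_scale[OF _ X f] by (intro sum.cong refl) (simp add: fun_apply algebra_simps)
  qed
  show "wedge E bs \<xi>s = 0" if "j < i" "\<xi>s ! i = \<xi>s ! j" for j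
    using wedge_repeat[of i bs j \<xi>s E] that i by (auto simp: fun_eq_iff fun_apply)
qed

text \<open>With the bracket transposed, each changed factor contributes the derivative of a pairing
  minus a pairing with \<open>dual_lie\<close>. The derivatives assemble to the derivative of the
  determinant. In the rest, changing the factor l amounts, in the summand of \<sigma>, to changing
  the argument \<sigma> l.\<close>

lemma wedge_derivation:
  assumes \<alpha>: "\<alpha> \<in> forms 1" and bs: "set bs \<subseteq> forms 1" and \<xi>s: "length \<xi>s = length bs" "set \<xi>s \<subseteq> vfields"
  shows "(\<Sum>l<length bs. wedge E (bs[l := cotangent_bracket \<pi> \<psi> \<alpha> (bs ! l)]) \<xi>s p) = D_top \<alpha> (wedge E bs) \<xi>s p"
proof -
  let ?n = "length bs" and ?A = "sharp \<pi> \<alpha>" and ?L = "dual_lie \<alpha>" and ?P = "{\<sigma>. \<sigma> permutes {..<length bs}}"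
  let ?R = "\<lambda>\<sigma> l. \<Prod>i\<in>{..<?n} - {l}. (bs ! i) [\<xi>s ! \<sigma> i] p"
  have A: "?A \<in> vfields" using \<alpha> by simp
  have b: "bs ! i \<in> forms 1" if "i < ?n" for i using bs that by auto
  have X: "\<xi>s ! i \<in> vfields" if "i < ?n" for i using \<xi>s that by auto
  have \<sigma>n: "\<sigma> i < ?n" if "\<sigma> permutes {..<?n}" "i < ?n" for \<sigma> i
    using permutes_in_image[OF that(1), of i] that(2) by simp
  have "(\<Sum>l<?n. wedge E (bs[l := cotangent_bracket \<pi> \<psi> \<alpha> (bs ! l)]) \<xi>s p) =
      (\<Sum>l<?n. \<Sum>\<sigma>\<in>?P. of_int (sign \<sigma>) * (cotangent_bracket \<pi> \<psi> \<alpha> (bs ! l) [\<xi>s ! \<sigma> l] p * ?R \<sigma> l))"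
    using \<xi>s wedge_update_left[of \<xi>s bs E] by simp
  also have "\<dots> = (\<Sum>l<?n. \<Sum>\<sigma>\<in>?P. of_int (sign \<sigma>) * (?A ((bs ! l) [\<xi>s ! \<sigma> l]) p * ?R \<sigma> l)
      - of_int (sign \<sigma>) * ((bs ! l) [?L (\<xi>s ! \<sigma> l)] p * ?R \<sigma> l))"
  proof (intro sum.cong refl)
    fix l \<sigma> assume "l \<in> {..<?n}" "\<sigma> \<in> ?P"
    then have "cotangent_bracket \<pi> \<psi> \<alpha> (bs ! l) [\<xi>s ! \<sigma> l] p =
        ?A ((bs ! l) [\<xi>s ! \<sigma> l]) p - (bs ! l) [?L (\<xi>s ! \<sigma> l)] p"
      using bracket_dual_lie[OF \<alpha> b X[OF \<sigma>n]] by (simp add: minus_apply)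
    then show "of_int (sign \<sigma>) * (cotangent_bracket \<pi> \<psi> \<alpha> (bs ! l) [\<xi>s ! \<sigma> l] p * ?R \<sigma> l) =
        of_int (sign \<sigma>) * (?A ((bs ! l) [\<xi>s ! \<sigma> l]) p * ?R \<sigma> l)
        - of_int (sign \<sigma>) * ((bs ! l) [?L (\<xi>s ! \<sigma> l)] p * ?R \<sigma> l)"
      by (simp only: left_diff_distrib right_diff_distrib)
  qed
  also have "\<dots> = (\<Sum>\<sigma>\<in>?P. of_int (sign \<sigma>) * (\<Sum>l<?n. ?A ((bs ! l) [\<xi>s ! \<sigma> l]) p * ?R \<sigma> l))
      - (\<Sum>\<sigma>\<in>?P. of_int (sign \<sigma>) * (\<Sum>l<?n. (bs ! l) [?L (\<xi>s ! \<sigma> l)] p * ?R \<sigma> l))"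
    by (subst sum.swap) (simp add: sum_subtractf sum_distrib_left)
  also have "(\<Sum>\<sigma>\<in>?P. of_int (sign \<sigma>) * (\<Sum>l<?n. ?A ((bs ! l) [\<xi>s ! \<sigma> l]) p * ?R \<sigma> l)) =
      ?A (wedge E bs \<xi>s) p"
  proof -
    have "wedge E bs \<xi>s = (\<Sum>\<sigma>\<in>?P. (\<lambda>p. of_int (sign \<sigma>) * (\<Prod>i<?n. (bs ! i) [\<xi>s ! \<sigma> i] p)))"
      using \<xi>s by (intro ext) (simp add: wedge_apply fun_apply)
    moreover have sm: "(\<lambda>p. \<Prod>i<?n. (bs ! i) [\<xi>s ! \<sigma> i] p) \<in> smooth_funs" for \<sigma>
      using form_smooth[OF b] by (intro smooth_prod) auto
    ultimately have "?A (wedge E bs \<xi>s) p =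
        (\<Sum>\<sigma>\<in>?P. of_int (sign \<sigma>) * ?A (\<lambda>p. \<Prod>i<?n. (bs ! i) [\<xi>s ! \<sigma> i] p) p)"
      using A by (simp add: vfield_sum vfield_cmult[OF A sm] fun_apply)
    moreover have "?A (\<lambda>p. \<Prod>i<?n. (bs ! i) [\<xi>s ! \<sigma> i] p) p =
        (\<Sum>l<?n. ?A ((bs ! l) [\<xi>s ! \<sigma> l]) p * ?R \<sigma> l)" for \<sigma>
      using form_smooth[OF b] by (intro vfield_prod[OF A]) auto
    ultimately show ?thesis by simp
  qed
  also have "(\<Sum>\<sigma>\<in>?P. of_int (sign \<sigma>) * (\<Sum>l<?n. (bs ! l) [?L (\<xi>s ! \<sigma> l)] p * ?R \<sigma> l)) =
      (\<Sum>j<?n. wedge E bs (\<xi>s[j := ?L (\<xi>s ! j)]) p)"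
  proof -
    have "(\<Sum>j<?n. wedge E bs (\<xi>s[j := ?L (\<xi>s ! j)]) p) =
        (\<Sum>j<?n. \<Sum>\<sigma>\<in>?P. of_int (sign \<sigma>) * ((bs ! inv \<sigma> j) [?L (\<xi>s ! j)] p * ?R \<sigma> (inv \<sigma> j)))"
      using \<xi>s \<alpha> X by (intro sum.cong refl) (subst wedge_update_right, auto)
    also have "\<dots> = (\<Sum>\<sigma>\<in>?P. of_int (sign \<sigma>) * (\<Sum>j<?n. (bs ! inv \<sigma> j) [?L (\<xi>s ! j)] p * ?R \<sigma> (inv \<sigma> j)))"
      by (subst sum.swap) (simp add: sum_distrib_left)
    also have "\<dots> = (\<Sum>\<sigma>\<in>?P. of_int (sign \<sigma>) * (\<Sum>l<?n. (bs ! l) [?L (\<xi>s ! \<sigma> l)] p * ?R \<sigma> l))"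
    proof (rule sum.cong[OF refl])
      fix \<sigma> assume "\<sigma> \<in> ?P"
      then have \<sigma>: "\<sigma> permutes {..<?n}" by simp
      have "(\<Sum>j<?n. (bs ! inv \<sigma> j) [?L (\<xi>s ! j)] p * ?R \<sigma> (inv \<sigma> j)) =
          (\<Sum>l<?n. (bs ! l) [?L (\<xi>s ! \<sigma> l)] p * ?R \<sigma> l)"
        using sum.permute[OF \<sigma>, of "\<lambda>j. (bs ! inv \<sigma> j) [?L (\<xi>s ! j)] p * ?R \<sigma> (inv \<sigma> j)"]
        by (simp add: o_def permutes_inverses(2)[OF \<sigma>])
      then show "of_int (sign \<sigma>) * (\<Sum>j<?n. (bs ! inv \<sigma> j) [?L (\<xi>s ! j)] p * ?R \<sigma> (inv \<sigma> j)) =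
          of_int (sign \<sigma>) * (\<Sum>l<?n. (bs ! l) [?L (\<xi>s ! \<sigma> l)] p * ?R \<sigma> l)" by simp
    qed
    finally show ?thesis ..
  qed
  finally show ?thesis using \<xi>s by (simp add: dact_def fun_apply)
qed

end

section \<open>The bracket of a one-form with a top form\<close>

context bivector_manifold
begin

lemma wedge_fscale_Cons: "wedge E (fscale g x # xs) \<xi>s p = g p * wedge E (x # xs) \<xi>s p"
proof (cases "length \<xi>s = length (x # xs) \<and> set \<xi>s \<subseteq> dsec E")
  case True
  then show ?thesis
    using wedge_update_left[of \<xi>s "x # xs" E 0 "fscale g x" p] wedge_update_left[of \<xi>s "x # xs" E 0 x p]
    by (simp add: sum_distrib_left fun_apply mult_ac)
next
  case False
  then show ?thesis by (subst (1 2) wedge_outside) (auto simp: zero_fun_apply)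
qed

lemma wedge_dual_frame:
  assumes fr: "coframed W e \<epsilon>" and q: "q \<in> W" and ns: "distinct ns"
  shows "wedge E (map \<epsilon> ns) (map e ns) q = 1"
proof -
  let ?n = "length ns"
  have "(\<Prod>i<?n. \<epsilon> (ns ! i) [e (ns ! \<sigma> i)] q) = (if \<sigma> = id then 1 else 0)" if \<sigma>: "\<sigma> permutes {..<?n}" for \<sigma>
  proof (cases "\<sigma> = id")
    case True
    then show ?thesis using coframedD(4)[OF fr q] by simp
  next
    case False
    then obtain i where i: "\<sigma> i \<noteq> i" by (auto simp: fun_eq_iff)
    then have "i < ?n" using \<sigma> by (auto simp: permutes_def)
    moreover have "\<sigma> i < ?n" using permutes_in_image[OF \<sigma>, of i] \<open>i < ?n\<close> by simp
    ultimately have "ns ! i \<noteq> ns ! \<sigma> i" using ns i by (simp add: nth_eq_iff_index_eq)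
    then have "\<epsilon> (ns ! i) [e (ns ! \<sigma> i)] q = 0" using coframedD(4)[OF fr q] by simp
    then show ?thesis using \<open>i < ?n\<close> False by (auto intro!: prod_zero)
  qed
  moreover have "(\<Prod>i<?n. pairing E (map \<epsilon> ns ! i) (map e ns ! \<sigma> i) q) = (\<Prod>i<?n. \<epsilon> (ns ! i) [e (ns ! \<sigma> i)] q)"
    if \<sigma>: "\<sigma> permutes {..<?n}" for \<sigma>
    using permutes_in_image[OF \<sigma>] by (intro prod.cong refl) auto
  ultimately have "wedge E (map \<epsilon> ns) (map e ns) q =
      (\<Sum>\<sigma> | \<sigma> permutes {..<?n}. of_int (sign \<sigma>) * (if \<sigma> = id then 1 else 0))"
    using coframedD(2)[OF fr] by (subst wedge_apply) (auto simp del: cotangent_simps(3))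
  also have "\<dots> = (\<Sum>\<sigma> | \<sigma> permutes {..<?n}. if \<sigma> = id then 1 else 0)"
    by (intro sum.cong refl) simp
  also have "\<dots> = 1" using permutes_id by (simp add: sum.delta finite_permutations)
  finally show ?thesis .
qed

text \<open>In top degree one decomposable suffices, the wedge of the coframe times the value of
  \<omega> on the frame. The coefficient is absorbed by the first covector, which exists because the
  index type is nonempty.\<close>

lemma exists_decomp_top:
  assumes \<omega>: "\<omega> \<in> forms CARD('n)"
  shows "\<exists>bss. decomp E CARD('n) \<omega> p bss"
proof -
  obtain W e \<epsilon> where p: "p \<in> W" and fr: "coframed W e \<epsilon>" by (rule exists_coframe[of p])
  obtain ns :: "'n list" where ns: "distinct ns" "set ns = UNIV" "length ns = CARD('n)" using exists_enum .
  then obtain m ms where m: "ns = m # ms" by (cases ns) auto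
  let ?bs = "fscale (\<omega> (map e ns)) (\<epsilon> m) # map \<epsilon> ms"
  have \<epsilon>: "\<epsilon> i \<in> forms 1" for i using coframedD(3)[OF fr] .
  have wf: "wedge E (map \<epsilon> ns) \<in> forms CARD('n)"
    using wedge_form[of "map \<epsilon> ns"] \<epsilon> ns(3) by (simp add: image_subset_iff)
  have "\<omega> \<xi>s y = wedge E ?bs \<xi>s y" if y: "y \<in> W" for \<xi>s y
    using top_form_frame[OF fr ns(1,2) \<omega> wf y, of \<xi>s] wedge_dual_frame[OF fr y ns(1)]
    by (simp add: wedge_fscale_Cons m)
  then have "decomp E CARD('n) \<omega> p [?bs]"
    unfolding decomp_def using p coframedD(1)[OF fr] \<epsilon> \<omega> ns(3) m
    by (intro conjI exI[of _ W]) (auto simp: image_subset_iff)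
  then show ?thesis by blast
qed

text \<open>The right side does not mention the decomposition, which is what makes the bracket well
  defined. Differentiating \<omega> \<xi>s at p uses the decomposition on a neighbourhood; the other
  terms use it at p only.\<close>

lemma gerst_cotangent_decomp:
  assumes \<alpha>: "\<alpha> \<in> forms 1" and \<omega>: "\<omega> \<in> forms n" and D: "decomp E n \<omega> p bss"
  shows "(\<Sum>bs\<leftarrow>bss. \<Sum>l<n. (-1) ^ l * wedge E (cotangent_bracket \<pi> \<psi> \<alpha> (bs ! l) # omit l bs) \<xi>s p)
    = D_top \<alpha> \<omega> \<xi>s p"
proof (cases "length \<xi>s = n \<and> set \<xi>s \<subseteq> vfields")
  case True
  let ?A = "sharp \<pi> \<alpha>" and ?L = "dual_lie \<alpha>"
  have bs: "length bs = n" "set bs \<subseteq> forms 1" if "bs \<in> set bss" for bs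
    using D that by (auto simp: decomp_def)
  obtain U where U: "open U" "p \<in> U" "\<forall>y\<in>U. \<forall>\<xi>s. \<omega> \<xi>s y = (\<Sum>bs\<leftarrow>bss. wedge E bs \<xi>s y)"
    using D unfolding decomp_def by blast
  have sl: "(\<Sum>bs\<leftarrow>bss. f bs) \<in> smooth_funs \<and> ?A (\<Sum>bs\<leftarrow>bss. f bs) p = (\<Sum>bs\<leftarrow>bss. ?A (f bs) p) \<and>
      (\<Sum>bs\<leftarrow>bss. f bs) y = (\<Sum>bs\<leftarrow>bss. f bs y)"
    if "\<And>bs. bs \<in> set bss \<Longrightarrow> f bs \<in> smooth_funs" for f y
    using that \<alpha> by (induction bss) (auto simp: vfield_add zero_fun_apply plus_fun_apply)
  have wsm: "wedge E bs \<xi>s \<in> smooth_funs" if "bs \<in> set bss" for bs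
    using form_smooth[OF wedge_form[OF bs(2)[OF that]]] .
  have "?A (\<omega> \<xi>s) p = ?A (\<Sum>bs\<leftarrow>bss. wedge E bs \<xi>s) p"
  proof (rule vfield_local[OF sharp_vfield[OF \<alpha>] _ _ U(1,2)])
    show "\<omega> \<xi>s y = (\<Sum>bs\<leftarrow>bss. wedge E bs \<xi>s) y" if "y \<in> U" for y
      using U(3) that sl[of "\<lambda>bs. wedge E bs \<xi>s" y, OF wsm] by simp
  qed (use \<omega> sl[OF wsm] in auto)
  then have A: "?A (\<omega> \<xi>s) p = (\<Sum>bs\<leftarrow>bss. ?A (wedge E bs \<xi>s) p)" using sl[OF wsm] by simp
  have "(\<Sum>l<n. (-1) ^ l * wedge E (cotangent_bracket \<pi> \<psi> \<alpha> (bs ! l) # omit l bs) \<xi>s p) =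
      ?A (wedge E bs \<xi>s) p - (\<Sum>j<n. wedge E bs (\<xi>s[j := ?L (\<xi>s ! j)]) p)" if "bs \<in> set bss" for bs
  proof -
    have "(\<Sum>l<n. (-1) ^ l * wedge E (cotangent_bracket \<pi> \<psi> \<alpha> (bs ! l) # omit l bs) \<xi>s p) =
        (\<Sum>l<length bs. wedge E (bs[l := cotangent_bracket \<pi> \<psi> \<alpha> (bs ! l)]) \<xi>s p)"
      using bs(1)[OF that] by (intro sum.cong) (auto simp: wedge_Cons_omit)
    also have "\<dots> = D_top \<alpha> (wedge E bs) \<xi>s p"
      using True bs[OF that] by (intro wedge_derivation[OF \<alpha>]) auto
    finally show ?thesis using True by (simp add: dact_def fun_apply)
  qed
  then have "(\<Sum>bs\<leftarrow>bss. \<Sum>l<n. (-1) ^ l * wedge E (cotangent_bracket \<pi> \<psi> \<alpha> (bs ! l) # omit l bs) \<xi>s p) =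
      (\<Sum>bs\<leftarrow>bss. ?A (wedge E bs \<xi>s) p - (\<Sum>j<n. wedge E bs (\<xi>s[j := ?L (\<xi>s ! j)]) p))"
    by (intro arg_cong[of _ _ sum_list] map_cong) auto
  also have "\<dots> = ?A (\<omega> \<xi>s) p - (\<Sum>j<n. \<omega> (\<xi>s[j := ?L (\<xi>s ! j)]) p)"
    using U(2,3) by (simp add: A sum_list_subtractf sum_list_sum_swap)
  finally show ?thesis using True by (simp add: dact_def fun_apply)
next
  case False
  have "wedge E (c # omit l bs) \<xi>s p = 0" if "bs \<in> set bss" "l < n" for c l bs
  proof -
    have "length bs = n" using D that by (auto simp: decomp_def)
    then have "wedge E (c # omit l bs) \<xi>s = 0" using False that by (intro wedge_outside) auto
    then show ?thesis by (simp add: zero_fun_apply)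
  qed
  then have "(\<Sum>bs\<leftarrow>bss. \<Sum>l<n. (-1) ^ l * wedge E (cotangent_bracket \<pi> \<psi> \<alpha> (bs ! l) # omit l bs) \<xi>s p)
      = (\<Sum>bs\<leftarrow>bss. 0)"
    by (intro arg_cong[of _ _ sum_list] map_cong) auto
  then show ?thesis using forms_outside[OF D_top_form[OF \<alpha> \<omega>] False] by (simp add: zero_fun_apply)
qed

text \<open>A decomposition in degree 1 is a list of 1-forms whose sum agrees with \<alpha> near p.
  Additivity of \<open>D_top\<close> collects the sum, and locality replaces it by \<alpha>.\<close>

lemma gerst_cotangent:
  assumes \<alpha>: "\<alpha> \<in> forms 1" and \<omega>: "\<omega> \<in> forms CARD('n)"
  shows "gerst E 1 CARD('n) (wedge E [\<alpha>]) \<omega> = D_top \<alpha> \<omega>"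
proof (intro ext)
  fix \<xi>s p
  let ?n = "CARD('n)"
  let ?S = "\<lambda>ass bss. \<Sum>as\<leftarrow>ass. \<Sum>bs\<leftarrow>bss. \<Sum>k<1. \<Sum>l<?n.
      (-1) ^ (k + l) * wedge E (brk E (as ! k) (bs ! l) # omit k as @ omit l bs) \<xi>s p"
  have key: "?S ass bss = D_top \<alpha> \<omega> \<xi>s p"
    if D1: "decomp E 1 (wedge E [\<alpha>]) p ass" and D2: "decomp E ?n \<omega> p bss" for ass bss
  proof -
    have as: "as = [hd as]" "hd as \<in> forms 1" if "as \<in> set ass" for as
    proof -
      have "length as = 1" "set as \<subseteq> forms 1" using D1 that by (auto simp: decomp_def)
      then show "as = [hd as]" "hd as \<in> forms 1" by (cases as; auto)+
    qed
    have "(\<Sum>bs\<leftarrow>bss. \<Sum>k<1. \<Sum>l<?n.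
        (-1) ^ (k + l) * wedge E (brk E (as ! k) (bs ! l) # omit k as @ omit l bs) \<xi>s p) = D_top (hd as) \<omega> \<xi>s p"
      if in_ass: "as \<in> set ass" for as
    proof -
      obtain a where a: "as = [a]" using as(1)[OF in_ass] by blast
      show ?thesis
        using gerst_cotangent_decomp[OF as(2)[OF in_ass] \<omega> D2, of \<xi>s]
        by (simp add: a omit_def One_nat_def)
    qed
    then have "?S ass bss = (\<Sum>as\<leftarrow>ass. D_top (hd as) \<omega> \<xi>s p)"
      by (intro arg_cong[of _ _ sum_list] map_cong) auto
    also have "\<dots> = (\<Sum>a\<leftarrow>map hd ass. D_top a \<omega>) \<xi>s p"
      by (induction ass) (simp_all add: fun_apply)
    also have "\<dots> = D_top (sum_list (map hd ass)) \<omega> \<xi>s p"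
      using D_top_sum_list[OF \<omega>, of "map hd ass"] as(2) by (simp add: image_subset_iff)
    also have "\<dots> = D_top \<alpha> \<omega> \<xi>s p"
    proof -
      have s: "sum_list (map hd ass) \<in> forms 1"
        using D_top_sum_list[OF \<omega>, of "map hd ass"] as(2) by (simp add: image_subset_iff)
      obtain U where U: "open U" "p \<in> U" "\<forall>y\<in>U. \<forall>\<xi>s. wedge E [\<alpha>] \<xi>s y = (\<Sum>as\<leftarrow>ass. wedge E as \<xi>s y)"
        using D1 unfolding decomp_def by blast
      show ?thesis
      proof (rule D_top_local[OF s \<alpha> U(1,2) _ \<omega>])
        fix X y assume X: "X \<in> vfields" and y: "y \<in> U"
        have "wedge E as [X] y = hd as [X] y" if "as \<in> set ass" for as
          using X by (subst as(1)[OF that]) (simp add: wedge_single)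
        then have "(\<Sum>as\<leftarrow>ass. wedge E as [X] y) = (\<Sum>as\<leftarrow>ass. hd as [X] y)"
          by (intro arg_cong[of _ _ sum_list] map_cong) auto
        also have "\<dots> = sum_list (map hd ass) [X] y"
          by (induction ass) (simp_all add: fun_apply)
        finally have "sum_list (map hd ass) [X] y = wedge E [\<alpha>] [X] y" using U(3) y by simp
        then show "sum_list (map hd ass) [X] y = \<alpha> [X] y" using X by (simp add: wedge_single)
      qed
    qed
    finally show ?thesis .
  qed
  have D1: "decomp E 1 (wedge E [\<alpha>]) p [[\<alpha>]]"
    using \<alpha> by (auto simp: decomp_def intro!: exI[of _ UNIV])
  obtain bss where D2: "decomp E ?n \<omega> p bss" using exists_decomp_top[OF \<omega>] by blast
  show "gerst E 1 CARD('n) (wedge E [\<alpha>]) \<omega> \<xi>s p = D_top \<alpha> \<omega> \<xi>s p"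
    unfolding gerst_def
  proof (rule the_equality)
    show "\<exists>ass bss. decomp E 1 (wedge E [\<alpha>]) p ass \<and> decomp E ?n \<omega> p bss \<and> D_top \<alpha> \<omega> \<xi>s p = ?S ass bss"
      using D1 D2 key[OF D1 D2, symmetric] by (intro exI[of _ "[[\<alpha>]]"] exI[of _ bss] conjI)
    show "c = D_top \<alpha> \<omega> \<xi>s p"
      if "\<exists>ass bss. decomp E 1 (wedge E [\<alpha>]) p ass \<and> decomp E ?n \<omega> p bss \<and> c = ?S ass bss" for c
      using that key by (elim exE conjE) (simp only:)
  qed
qed

section \<open>The Evens-Lu-Weinstein representation\<close>

text \<open>An expression in \<open>s\<close> alone, so that \<open>D\<^sub>\<alpha> s\<close> does not depend on the decomposition of \<open>s\<close>.\<close>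

definition elw_value :: "'m form \<Rightarrow> ('m vfield list \<times> 'm vfield list \<Rightarrow> 'm scalar) \<Rightarrow>
    'm vfield list \<Rightarrow> 'm vfield list \<Rightarrow> 'm \<Rightarrow> real" where
  "elw_value \<alpha> s \<xi>s Ys p = sharp \<pi> \<alpha> (s (\<xi>s, Ys)) p
     - (\<Sum>j<CARD('n). s (\<xi>s[j := dual_lie \<alpha> (\<xi>s ! j)], Ys) p)
     - (\<Sum>j<CARD('n). s (\<xi>s, Ys[j := vbracket (sharp \<pi> \<alpha>) (Ys ! j)]) p)"

lemma tensor_apply: "tensor \<omega> \<mu> (\<xi>s, Ys) = \<omega> \<xi>s * \<mu> Ys"
  by (simp add: tensor_def)

text \<open>The Leibniz rule along \<pi>^#\<alpha> merges the derivatives of \<omega> and \<mu> into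
  one derivative of the product.\<close>

lemma elw_value_tensor:
  assumes \<alpha>: "\<alpha> \<in> forms 1" and \<omega>: "\<omega> \<in> forms CARD('n)" and \<mu>: "\<mu> \<in> forms CARD('n)"
    and \<xi>s: "length \<xi>s = CARD('n)" "set \<xi>s \<subseteq> vfields" and Ys: "length Ys = CARD('n)" "set Ys \<subseteq> vfields"
  shows "tensor (D_top \<alpha> \<omega>) \<mu> (\<xi>s, Ys) p + tensor \<omega> (lie_d (sharp \<pi> \<alpha>) \<mu>) (\<xi>s, Ys) p =
    elw_value \<alpha> (tensor \<omega> \<mu>) \<xi>s Ys p"
  using assms by (simp add: elw_value_def tensor_apply lie_d_dact dact_def fun_apply vfield_mult
      sum_distrib_left sum_distrib_right algebra_simps)

text \<open>Any admissible list and the single pair (\<omega>, \<mu>) give the same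
  \<open>elw_value\<close>, which is additive in s and depends on s near p only.\<close>

lemma elw_D_tensor:
  assumes \<alpha>: "\<alpha> \<in> forms 1" and \<omega>0: "\<omega> \<in> forms CARD('n)" and \<mu>0: "\<mu> \<in> forms CARD('n)"
  shows "elw_D E \<alpha> (tensor \<omega> \<mu>) = tensor (D_top \<alpha> \<omega>) \<mu> + tensor \<omega> (lie_d (sharp \<pi> \<alpha>) \<mu>)"
proof (intro ext)
  fix z :: "'m vfield list \<times> 'm vfield list" and p
  let ?n = "CARD('n)"
  obtain \<xi>s Ys where z: "z = (\<xi>s, Ys)" by (cases z)
  let ?s = "tensor \<omega> \<mu>"
  let ?A = "sharp \<pi> \<alpha>"
  let ?adm = "\<lambda>ts. (\<forall>(\<omega>, \<mu>)\<in>set ts. \<omega> \<in> alt (rk E) (dsec E) \<and> \<mu> \<in> forms ?n) \<and>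
      (\<exists>U. open U \<and> p \<in> U \<and> (\<forall>y\<in>U. \<forall>w. ?s w y = (\<Sum>(\<omega>, \<mu>)\<leftarrow>ts. tensor \<omega> \<mu> w y)))"
  let ?S = "\<lambda>ts. \<Sum>(\<omega>, \<mu>)\<leftarrow>ts. tensor (gerst E 1 (rk E) (wedge E [\<alpha>]) \<omega>) \<mu> z p
      + tensor \<omega> (lie_d (anchor E \<alpha>) \<mu>) z p"
  let ?r = "\<lambda>(\<omega>, \<mu>). tensor (D_top \<alpha> \<omega>) \<mu> z p + tensor \<omega> (lie_d ?A \<mu>) z p"
  let ?valid = "(length \<xi>s = ?n \<and> set \<xi>s \<subseteq> vfields) \<and> length Ys = ?n \<and> set Ys \<subseteq> vfields"
  \<comment> \<open>The comparison with \<open>elw_value\<close> is made on vector field lists of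
    length n only; on all other arguments both terms are 0 by convention.\<close>
  have inv: "?r (\<omega>, \<mu>) = 0" if "\<not> ?valid" "\<omega> \<in> forms ?n" "\<mu> \<in> forms ?n" for \<omega> \<mu>
  proof (cases "length \<xi>s = ?n \<and> set \<xi>s \<subseteq> vfields")
    case True
    then have "\<not> (length Ys = ?n \<and> set Ys \<subseteq> vfields)" using that by blast
    then show ?thesis
      using forms_outside[OF that(3)] forms_outside[OF lie_d_form[OF sharp_vfield[OF \<alpha>] that(3)]]
      by (simp add: z tensor_apply fun_apply)
  next
    case False
    then show ?thesis
      using forms_outside[OF that(2)] forms_outside[OF D_top_form[OF \<alpha> that(2)]]
      by (simp add: z tensor_apply fun_apply)
  qed
  have key: "?S ts = ?r (\<omega>, \<mu>)" if T: "?adm ts" for ts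
  proof -
    have ts: "fst t \<in> forms ?n" "snd t \<in> forms ?n" if "t \<in> set ts" for t
      using T that by (auto simp: forms_def)
    obtain U where U: "open U" "p \<in> U" "\<And>y w. y \<in> U \<Longrightarrow> ?s w y = (\<Sum>(\<omega>, \<mu>)\<leftarrow>ts. tensor \<omega> \<mu> w y)"
      using T by blast
    have "?S ts = (\<Sum>t\<leftarrow>ts. ?r t)"
      using ts gerst_cotangent[OF \<alpha>]
      by (intro arg_cong[of _ _ sum_list] map_cong refl) (auto simp: split_beta)
    also have "\<dots> = ?r (\<omega>, \<mu>)"
    proof (cases ?valid)
      case True
      have rv: "?r t = elw_value \<alpha> (\<lambda>w. fst t (fst w) * snd t (snd w)) \<xi>s Ys p" if "t \<in> set ts" for t
        using elw_value_tensor[OF \<alpha> ts[OF that], of \<xi>s Ys p] True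
        by (simp add: z tensor_def case_prod_unfold)
      have sl: "(\<Sum>t\<leftarrow>ts. f t) \<in> smooth_funs \<and> ?A (\<Sum>t\<leftarrow>ts. f t) p = (\<Sum>t\<leftarrow>ts. ?A (f t) p) \<and>
          (\<Sum>t\<leftarrow>ts. f t) y = (\<Sum>t\<leftarrow>ts. f t y)"
        if "\<And>t. t \<in> set ts \<Longrightarrow> f t \<in> smooth_funs" for f y
        using that \<alpha> by (induction ts) (auto simp: vfield_add zero_fun_apply plus_fun_apply)
      have sm: "fst t \<xi>s * snd t Ys \<in> smooth_funs" if "t \<in> set ts" for t
        using ts[OF that] by simp
      have sU: "?s (\<xi>s', Ys') y = (\<Sum>t\<leftarrow>ts. (fst t \<xi>s' * snd t Ys') y)" if "y \<in> U" for \<xi>s' Ys' y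
        using U(3)[OF that, of "(\<xi>s', Ys')"] by (simp add: tensor_apply case_prod_unfold)
      have "?A (?s (\<xi>s, Ys)) p = ?A (\<Sum>t\<leftarrow>ts. fst t \<xi>s * snd t Ys) p"
      proof (rule vfield_local[OF sharp_vfield[OF \<alpha>] _ _ U(1,2)])
        show "?s (\<xi>s, Ys) y = (\<Sum>t\<leftarrow>ts. fst t \<xi>s * snd t Ys) y" if "y \<in> U" for y
          using sU[OF that] sl[of "\<lambda>t. fst t \<xi>s * snd t Ys" y, OF sm] by simp
      qed (use \<omega>0 \<mu>0 sl[OF sm] in \<open>auto simp: tensor_apply\<close>)
      then have A: "?A (?s (\<xi>s, Ys)) p = (\<Sum>t\<leftarrow>ts. ?A (fst t \<xi>s * snd t Ys) p)" using sl[OF sm] by simp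
      have "(\<Sum>t\<leftarrow>ts. ?r t) = (\<Sum>t\<leftarrow>ts. elw_value \<alpha> (\<lambda>w. fst t (fst w) * snd t (snd w)) \<xi>s Ys p)"
        using rv by (intro arg_cong[of _ _ sum_list] map_cong refl) auto
      also have "\<dots> = elw_value \<alpha> ?s \<xi>s Ys p"
        unfolding elw_value_def A sU[OF U(2)] by (simp add: sum_list_subtractf sum_list_sum_swap)
      also have "\<dots> = ?r (\<omega>, \<mu>)"
        using elw_value_tensor[OF \<alpha> \<omega>0 \<mu>0, of \<xi>s Ys p] True by (simp add: z)
      finally show ?thesis .
    next
      case False
      have "?r t = 0" if "t \<in> set ts" for t using inv[OF False ts[OF that]] by simp
      then have "(\<Sum>t\<leftarrow>ts. ?r t) = (\<Sum>t\<leftarrow>ts. 0)"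
        by (intro arg_cong[of _ _ sum_list] map_cong refl) auto
      then show ?thesis using inv[OF False \<omega>0 \<mu>0] by simp
    qed
    finally show ?thesis .
  qed
  have adm: "?adm [(\<omega>, \<mu>)]"
    using \<omega>0 \<mu>0 by (auto simp: forms_def intro!: exI[of _ UNIV])
  have "elw_D E \<alpha> ?s z p = ?r (\<omega>, \<mu>)"
    unfolding elw_D_def
  proof (rule the_equality)
    show "\<exists>ts. (\<forall>(\<omega>, \<mu>)\<in>set ts. \<omega> \<in> alt (rk E) (dsec E) \<and> \<mu> \<in> forms ?n) \<and>
      (\<exists>U. open U \<and> p \<in> U \<and> (\<forall>y\<in>U. \<forall>w. ?s w y = (\<Sum>(\<omega>, \<mu>)\<leftarrow>ts. tensor \<omega> \<mu> w y))) \<and> ?r (\<omega>, \<mu>) = ?S ts"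
      using adm key[OF adm, symmetric] by (intro exI[of _ "[(\<omega>, \<mu>)]"] conjI) blast+
    show "c = ?r (\<omega>, \<mu>)" if ex: "\<exists>ts. (\<forall>(\<omega>, \<mu>)\<in>set ts. \<omega> \<in> alt (rk E) (dsec E) \<and> \<mu> \<in> forms ?n) \<and>
      (\<exists>U. open U \<and> p \<in> U \<and> (\<forall>y\<in>U. \<forall>w. ?s w y = (\<Sum>(\<omega>, \<mu>)\<leftarrow>ts. tensor \<omega> \<mu> w y))) \<and> c = ?S ts" for c
    proof -
      obtain ts where ts: "?adm ts" and c: "c = ?S ts" using ex by blast
      show ?thesis unfolding c by (rule key[OF ts])
    qed
  qed
  then show "elw_D E \<alpha> ?s z p = (tensor (D_top \<alpha> \<omega>) \<mu> + tensor \<omega> (lie_d ?A \<mu>)) z p"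
    by (simp add: plus_fun_apply)
qed

text \<open>Top forms are proportional, in each group of arguments separately. The coefficient g is
  a quotient at arguments \<open>\<Xi> p\<close> chosen with vol nonzero; its expression in a frame
  shows that it is smooth.\<close>

lemma elw_section_tensor:
  assumes vol: "volume_form vol" and s: "s \<in> elw_sections E"
  obtains g where "g \<in> smooth_funs" "s = tensor (fscale g vol) vol"
proof -
  let ?n = "CARD('n)"
  have s1: "(\<lambda>\<xi>s. s (\<xi>s, Ys)) \<in> forms ?n" and s2: "(\<lambda>Ys. s (\<xi>s, Ys)) \<in> forms ?n" for \<xi>s Ys
    using s by (auto simp: elw_sections_def forms_def)
  define \<Xi> where "\<Xi> p = (SOME Ys. vol Ys p \<noteq> 0)" for p
  have \<Xi>: "vol (\<Xi> p) p \<noteq> 0" for p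
    unfolding \<Xi>_def using volume_formD(2)[OF vol] by (rule someI_ex)
  define g where "g p = s (\<Xi> p, \<Xi> p) p / (vol (\<Xi> p) p * vol (\<Xi> p) p)" for p
  obtain ns :: "'n list" where ns: "distinct ns" "set ns = UNIV" using exists_enum by metis
  have prod: "vol (map e ns) q * vol (map e ns) q * s (\<xi>s, Ys) q = s (map e ns, map e ns) q * (vol \<xi>s q * vol Ys q)"
    if fr: "coframed W e \<epsilon>" and q: "q \<in> W" for W e \<epsilon> q \<xi>s Ys
  proof -
    let ?v = "vol (map e ns) q"
    have "?v * (?v * s (\<xi>s, Ys) q) = (?v * s (map e ns, Ys) q) * vol \<xi>s q"
      unfolding top_form_frame[OF fr ns s1[of Ys] volume_formD(1)[OF vol] q, of \<xi>s] by simp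
    also have "\<dots> = (s (map e ns, map e ns) q * vol Ys q) * vol \<xi>s q"
      unfolding top_form_frame[OF fr ns s2[of "map e ns"] volume_formD(1)[OF vol] q, of Ys] ..
    finally show ?thesis by (simp add: mult_ac)
  qed
  have gq: "g q = s (map e ns, map e ns) q * (inverse (vol (map e ns) q) * inverse (vol (map e ns) q))"
    if fr: "coframed W e \<epsilon>" and q: "q \<in> W" for W e \<epsilon> q
    using prod[OF fr q, of "\<Xi> q" "\<Xi> q"] \<Xi>[of q] volume_frame_nonzero[OF fr ns vol q]
    by (simp add: g_def field_simps)
  have "g \<in> smooth_funs"
  proof (rule smooth_funs_local)
    fix p
    obtain W e \<epsilon> where W: "p \<in> W" and fr: "coframed W e \<epsilon>" by (rule exists_coframe[of p])
    have "vol (map e ns) \<in> smooth_funs" using volume_formD(1)[OF vol] by simp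
    from smooth_local_inverse[OF this volume_frame_nonzero[OF fr ns vol W]]
    obtain h N where h: "h \<in> smooth_funs" "open N" "p \<in> N" "\<And>y. y \<in> N \<Longrightarrow> h y = inverse (vol (map e ns) y)"
      by blast
    have "s (map e ns, map e ns) \<in> smooth_funs" using form_smooth[OF s1] .
    then show "\<exists>W g'. open W \<and> p \<in> W \<and> g' \<in> smooth_funs \<and> (\<forall>y\<in>W. g y = g' y)"
      using h W coframedD(1)[OF fr] gq[OF fr]
      by (intro exI[of _ "W \<inter> N"] exI[of _ "s (map e ns, map e ns) * (h * h)"]) (auto simp: fun_apply)
  qed
  moreover have "s = tensor (fscale g vol) vol"
  proof (intro ext)
    fix z :: "'m vfield list \<times> 'm vfield list" and p
    obtain \<xi>s Ys where z: "z = (\<xi>s, Ys)" by (cases z)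
    obtain W e \<epsilon> where W: "p \<in> W" and fr: "coframed W e \<epsilon>" by (rule exists_coframe[of p])
    have v: "vol (map e ns) p \<noteq> 0" by (rule volume_frame_nonzero[OF fr ns vol W])
    have "s (map e ns, map e ns) p = g p * (vol (map e ns) p * vol (map e ns) p)"
      using gq[OF fr W] v by (simp add: field_simps)
    then have "vol (map e ns) p * (vol (map e ns) p * s (\<xi>s, Ys) p) =
        vol (map e ns) p * (vol (map e ns) p * (g p * (vol \<xi>s p * vol Ys p)))"
      using prod[OF fr W, of \<xi>s Ys] by (simp add: mult_ac)
    then show "s z p = tensor (fscale g vol) vol z p"
      using v by (simp add: z tensor_apply fun_apply mult_ac)
  qed
  ultimately show thesis by (rule that)
qed

section \<open>The two modular classes\<close>

text \<open>\<open>dual_lie \<alpha>\<close> and the Lie bracket with \<pi>^#\<alpha> differ by the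
  endomorphism \<open>dual_tensor \<alpha>\<close>, which acts on vol as minus its trace; the frame
  formulas for contraction and trace evaluate it.\<close>

lemma ratio_D_top:
  assumes vol: "volume_form vol" and \<alpha>: "\<alpha> \<in> forms 1"
  shows "ratio (D_top \<alpha> vol) vol =
    divergence vol (sharp \<pi> \<alpha>) - (\<lambda>_. 2) * contract 2 \<pi> (ext_d \<alpha>) [] + trace (psi2 \<pi> \<psi> \<alpha>)"
proof -
  note v = volume_formD(1)[OF vol]
  have "D_top \<alpha> vol = dact (sharp \<pi> \<alpha> + 0) (\<lambda>X. vbracket (sharp \<pi> \<alpha>) X + dual_tensor \<alpha> X) vol"
    by (rule dact_cong) (simp_all add: dual_lie_def)
  also have "\<dots> = lie_d (sharp \<pi> \<alpha>) vol + dact 0 (dual_tensor \<alpha>) vol"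
    unfolding lie_d_dact using \<alpha> dual_tensor by (intro dact_add[OF v]) auto
  finally have "ratio (D_top \<alpha> vol) vol =
      divergence vol (sharp \<pi> \<alpha>) + ratio (dact 0 (dual_tensor \<alpha>) vol) vol"
    using ratio_add[OF vol] v \<alpha> dact_form[OF dual_tensor_derivation[OF \<alpha>] v] by (simp add: divergence_def)
  moreover have "ratio (dact 0 (dual_tensor \<alpha>) vol) vol q =
      trace (psi2 \<pi> \<psi> \<alpha>) q - 2 * contract 2 \<pi> (ext_d \<alpha>) [] q" for q
  proof -
    obtain W e \<epsilon> where q: "q \<in> W" and fr: "coframed W e \<epsilon>" by (rule exists_coframe[of q])
    show ?thesis
      using \<alpha> coframedD(2,3)[OF fr]
      by (simp add: ratio_linear_frame[OF fr q vol dual_tensor_derivation[OF \<alpha>]] trace_psi2[OF fr q \<alpha>]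
          contract_frame[OF ext_d_form2[OF \<alpha>] fr q] dual_tensor minus_apply sum_subtractf)
  qed
  ultimately show ?thesis by (auto simp: fun_eq_iff fun_apply)
qed

lemma mod_Z_vfield: "volume_form vol \<Longrightarrow> mod_Z \<pi> \<psi> vol \<in> vfields"
  by (simp add: mod_Z_def mod_X mod_Y)

text \<open>The divergence occurs once for each tensor factor, the contraction already carries its
  2, and the half in \<open>mod_Y\<close> leaves a 2 with the trace term.\<close>

lemma ratio_D_top_mod_Z:
  assumes vol: "volume_form vol" and \<alpha>: "\<alpha> \<in> forms 1"
  shows "ratio (D_top \<alpha> vol) vol + divergence vol (sharp \<pi> \<alpha>) = (\<lambda>_. 2) * \<alpha> [mod_Z \<pi> \<psi> vol]"
  using assms by (simp add: ratio_D_top mod_Z_def mod_X mod_Y form1_add fun_eq_iff fun_apply)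

text \<open>This is ln |g|, in a form to which smoothness of ln of a positive function applies: g
  may have different signs on different components of M.\<close>

definition log_square :: "'m scalar \<Rightarrow> 'm scalar" where
  "log_square g = (\<lambda>p. 1 / 2 * ln ((g * g) p))"

lemma log_square:
  assumes g: "g \<in> smooth_funs" "\<And>p. g p \<noteq> 0"
  shows "log_square g \<in> smooth_funs" "X \<in> vfields \<Longrightarrow> X g = g * X (log_square g)"
proof -
  have sq: "g * g \<in> smooth_funs" "(g * g) p > 0" for p
    using g by (simp_all add: fun_apply) (metis not_real_square_gt_zero)
  have l: "(\<lambda>p. ln ((g * g) p)) \<in> smooth_funs" by (rule smooth_ln[OF sq])
  show "log_square g \<in> smooth_funs" unfolding log_square_def by (rule smooth_cmult[OF l])
  assume X: "X \<in> vfields"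
  show "X g = g * X (log_square g)"
  proof
    fix q
    have "X (log_square g) q = 1 / 2 * (X (g * g) q / (g * g) q)"
      unfolding log_square_def vfield_cmult[OF X l] vfield_ln[OF X sq] ..
    then show "X g q = (g * X (log_square g)) q"
      using X g by (simp add: vfield_mult fun_apply field_simps)
  qed
qed

lemma divergence_change:
  assumes vol: "volume_form vol" and g: "g \<in> smooth_funs" "\<And>p. g p \<noteq> 0"
    and vol': "volume_form (fscale g vol)" and X: "X \<in> vfields"
  shows "divergence (fscale g vol) X = divergence vol X + X (log_square g)"
  unfolding divergence_def[of "fscale g vol"]
proof (rule ratio_unique[OF vol'])
  have "lie_d X (fscale g vol) = fscale (X g) vol + fscale g (lie_d X vol)"
    unfolding lie_d_dact by (rule dact_fscale[OF X volume_formD(1)[OF vol] g(1)])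
  then show "lie_d X (fscale g vol) = fscale (divergence vol X + X (log_square g)) (fscale g vol)"
    unfolding lie_d_vol[OF vol X] log_square(2)[OF g X]
    by (simp add: fun_eq_iff fun_apply algebra_simps)
qed

text \<open>The shape shared by \<open>twisted_class\<close> and \<open>algebroid_class\<close>, so
  that both modular classes are compared in one quotient.\<close>

definition coset :: "'m vfield \<Rightarrow> 'm vfield set" where
  "coset Z = {Y \<in> vfields. \<exists>f\<in>smooth_funs. \<forall>\<xi>\<in>forms 1. \<xi> [Y] = \<xi> [Z] + sharp \<pi> \<xi> f}"

lemma coset_eq:
  assumes "f \<in> smooth_funs" "\<And>\<xi>. \<xi> \<in> forms 1 \<Longrightarrow> \<xi> [Z'] = \<xi> [Z] + sharp \<pi> \<xi> f"
  shows "coset Z' = coset Z"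
proof -
  have "(\<exists>h\<in>smooth_funs. \<forall>\<xi>\<in>forms 1. \<xi> [Y] = \<xi> [Z'] + sharp \<pi> \<xi> h) \<longleftrightarrow>
      (\<exists>h\<in>smooth_funs. \<forall>\<xi>\<in>forms 1. \<xi> [Y] = \<xi> [Z] + sharp \<pi> \<xi> h)" for Y
  proof
    assume "\<exists>h\<in>smooth_funs. \<forall>\<xi>\<in>forms 1. \<xi> [Y] = \<xi> [Z'] + sharp \<pi> \<xi> h"
    then obtain h where "h \<in> smooth_funs" "\<forall>\<xi>\<in>forms 1. \<xi> [Y] = \<xi> [Z'] + sharp \<pi> \<xi> h" by blast
    then show "\<exists>h\<in>smooth_funs. \<forall>\<xi>\<in>forms 1. \<xi> [Y] = \<xi> [Z] + sharp \<pi> \<xi> h"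
      using assms by (intro bexI[of _ "h + f"]) (simp_all add: vfield_add algebra_simps)
  next
    assume "\<exists>h\<in>smooth_funs. \<forall>\<xi>\<in>forms 1. \<xi> [Y] = \<xi> [Z] + sharp \<pi> \<xi> h"
    then obtain h where "h \<in> smooth_funs" "\<forall>\<xi>\<in>forms 1. \<xi> [Y] = \<xi> [Z] + sharp \<pi> \<xi> h" by blast
    then show "\<exists>h\<in>smooth_funs. \<forall>\<xi>\<in>forms 1. \<xi> [Y] = \<xi> [Z'] + sharp \<pi> \<xi> h"
      using assms by (intro bexI[of _ "h - f"]) (simp_all add: vfield_diff algebra_simps)
  qed
  then show ?thesis unfolding coset_def by blast
qed

lemma algebroid_class_coset: "algebroid_class E \<theta> = coset \<theta>"
  by (simp add: algebroid_class_def coset_def)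

lemma volume_form_change:
  assumes vol: "volume_form vol" and vol': "volume_form vol'"
  obtains g where "g \<in> smooth_funs" "\<And>p. g p \<noteq> 0" "vol' = fscale g vol"
proof
  note v' = volume_formD(1)[OF vol']
  show "ratio vol' vol \<in> smooth_funs" by (rule ratio_smooth[OF vol v'])
  show eq: "vol' = fscale (ratio vol' vol) vol" by (rule ratio_eq[OF vol v'])
  \<comment> \<open>\<open>fun_apply(8)\<close> is \<open>fscale_apply\<close>: a zero of the ratio
    at p would make vol' vanish at p.\<close>
  show "ratio vol' vol p \<noteq> 0" for p
    using volume_formD(2)[OF vol', of p] eq by (metis fun_apply(8) mult_eq_0_iff times_fun_apply)
qed

text \<open>Replacing vol by g vol changes only the divergence in \<open>mod_X\<close>, by the
  derivative of \<open>log_square g\<close> along \<pi>^#\<xi>. So all volume forms give one coset,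
  and the description denotes it.\<close>

lemma modular_class_eq:
  assumes vol: "volume_form vol"
  shows "modular_class \<pi> \<psi> = coset (mod_Z \<pi> \<psi> vol)"
proof -
  have "twisted_class \<pi> (mod_Z \<pi> \<psi> vol') = coset (mod_Z \<pi> \<psi> vol)" if vol': "volume_form vol'" for vol'
  proof -
    obtain g where g: "g \<in> smooth_funs" "\<And>p. g p \<noteq> 0" and eq: "vol' = fscale g vol"
      using volume_form_change[OF vol vol'] by metis
    have "coset (mod_Z \<pi> \<psi> vol') = coset (mod_Z \<pi> \<psi> vol)"
    proof (rule coset_eq[OF log_square(1)[OF g]])
      fix \<xi> assume \<xi>: "\<xi> \<in> forms 1"
      show "\<xi> [mod_Z \<pi> \<psi> vol'] = \<xi> [mod_Z \<pi> \<psi> vol] + sharp \<pi> \<xi> (log_square g)"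
        using \<xi> vol vol' divergence_change[OF vol g vol'[unfolded eq] sharp_vfield[OF \<xi>]]
        by (simp add: mod_Z_def mod_X mod_Y form1_add eq[symmetric] algebra_simps)
    qed
    then show ?thesis using twisted_class_eq[OF mod_Z_vfield[OF vol']] by (simp add: coset_def)
  qed
  then show ?thesis unfolding modular_class_def using vol by (intro the_equality) blast+
qed

text \<open>Writing s as g vol \<otimes> vol adds the differential of ln |g| to the cocycle 2 Z of
  vol \<otimes> vol, which does not change the coset.\<close>

lemma elw_theta_coset:
  assumes vol: "volume_form vol" and s: "s \<in> elw_sections E" "\<And>p. \<exists>z. s z p \<noteq> 0"
  shows "coset (elw_theta E s) = coset (fscale (\<lambda>_. 2) (mod_Z \<pi> \<psi> vol))"
proof -
  obtain g where g: "g \<in> smooth_funs" and sg: "s = tensor (fscale g vol) vol"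
    by (rule elw_section_tensor[OF vol s(1)])
  have g0: "g p \<noteq> 0" for p
  proof
    assume "g p = 0"
    then have "s z p = 0" for z by (cases z) (simp add: sg tensor_apply fun_apply)
    then show False using s(2) by blast
  qed
  let ?f = "log_square g" and ?Z = "mod_Z \<pi> \<psi> vol"
  note f = log_square[OF g g0] and v = volume_formD(1)[OF vol]
  have Z: "?Z \<in> vfields" by (rule mod_Z_vfield[OF vol])
  \<comment> \<open>The minus sign: pairing \<alpha> with \<pi>^# df gives \<pi>(df, \<alpha>), the
    negative of the derivative of f along \<pi>^#\<alpha>.\<close>
  define \<theta> where "\<theta> = fscale (\<lambda>_. 2) ?Z - sharp \<pi> (ext_d (form0 ?f))"
  have \<theta>v: "\<theta> \<in> vfields" unfolding \<theta>_def using Z f(1) df_form by simp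
  have \<theta>: "\<alpha> [\<theta>] = (\<lambda>_. 2) * \<alpha> [?Z] + sharp \<pi> \<alpha> ?f" if \<alpha>: "\<alpha> \<in> forms 1" for \<alpha>
  proof -
    have "\<theta> = fscale (\<lambda>_. 2) ?Z + fscale (\<lambda>_. -1) (sharp \<pi> (ext_d (form0 ?f)))"
      by (simp add: \<theta>_def fun_eq_iff fun_apply)
    then have "\<alpha> [\<theta>] = (\<lambda>_. 2) * \<alpha> [?Z] + (\<lambda>_. -1) * \<pi> [ext_d (form0 ?f), \<alpha>]"
      using Z \<alpha> f(1) df_form by (simp add: form1_add form1_scale sharp_pairing)
    then show ?thesis
      using pi_swap[OF df_form[OF f(1)] \<alpha>] \<alpha> f(1) by (simp add: sharp_apply fun_eq_iff fun_apply)
  qed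
  have D: "elw_D E \<alpha> s = fscale (\<alpha> [\<theta>]) s" if \<alpha>: "\<alpha> \<in> forms 1" for \<alpha>
  proof -
    let ?A = "sharp \<pi> \<alpha>" and ?r = "ratio (D_top \<alpha> vol) vol"
    have A: "?A \<in> vfields" using \<alpha> by simp
    have "elw_D E \<alpha> s = tensor (D_top \<alpha> (fscale g vol)) vol + tensor (fscale g vol) (lie_d ?A vol)"
      unfolding sg using v g by (intro elw_D_tensor[OF \<alpha>]) auto
    also have "D_top \<alpha> (fscale g vol) = fscale (?A g) vol + fscale g (fscale ?r vol)"
      unfolding dact_fscale[OF A v g] using ratio_eq[OF vol D_top_form[OF \<alpha> v]] by simp
    also have "?A g = g * ?A ?f" by (rule f(2)[OF A])
    also have "lie_d ?A vol = fscale (divergence vol ?A) vol" by (rule lie_d_vol[OF vol A])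
    also have "tensor (fscale (g * ?A ?f) vol + fscale g (fscale ?r vol)) vol +
        tensor (fscale g vol) (fscale (divergence vol ?A) vol) =
        fscale (?r + divergence vol ?A + ?A ?f) s"
      by (auto simp: sg tensor_def fun_eq_iff fun_apply algebra_simps)
    finally show ?thesis unfolding \<theta>[OF \<alpha>] ratio_D_top_mod_Z[OF vol \<alpha>] .
  qed
  have "elw_theta E s = \<theta>"
    unfolding elw_theta_def
  proof (rule the_equality)
    show "\<theta> \<in> dsec E \<and> (\<forall>x\<in>sec E. elw_D E x s = fscale (pairing E x \<theta>) s)" using \<theta>v D by simp
    \<comment> \<open>At each point s has a nonzero value to cancel, so the eigenvalue functions,
      and with them the vector field, are unique.\<close>
    fix \<eta> assume \<eta>: "\<eta> \<in> dsec E \<and> (\<forall>x\<in>sec E. elw_D E x s = fscale (pairing E x \<eta>) s)"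
    show "\<eta> = \<theta>"
    proof (rule vfield_eqI)
      show "\<eta> \<in> vfields" using \<eta> by simp
      show "\<beta> [\<eta>] = \<beta> [\<theta>]" if "\<beta> \<in> forms 1" for \<beta>
      proof
        fix p
        obtain z where z: "s z p \<noteq> 0" using s(2) by blast
        have "fscale (\<beta> [\<eta>]) s = fscale (\<beta> [\<theta>]) s" using D[OF that] \<eta> that by simp
        then have "fscale (\<beta> [\<eta>]) s z p = fscale (\<beta> [\<theta>]) s z p" by simp
        then show "\<beta> [\<eta>] p = \<beta> [\<theta>] p" using z by (simp add: fun_apply)
      qed
    qed (rule \<theta>v)
  qed
  moreover have "coset \<theta> = coset (fscale (\<lambda>_. 2) ?Z)"
    using Z \<theta> by (intro coset_eq[OF f(1)]) (simp add: form1_scale)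
  ultimately show ?thesis by simp
qed

text \<open>vol \<otimes> vol is a nowhere vanishing section, so the description has a witness; the
  coset is the same for every other section.\<close>

lemma elw_modular_class_eq:
  assumes vol: "volume_form vol"
  shows "elw_modular_class E = coset (fscale (\<lambda>_. 2) (mod_Z \<pi> \<psi> vol))"
proof -
  let ?s = "tensor vol vol"
  note v = volume_formD(1)[OF vol]
  have "(\<lambda>\<xi>s. ?s (\<xi>s, Ys)) = fscale (vol Ys) vol" "(\<lambda>Ys. ?s (\<xi>s, Ys)) = fscale (vol \<xi>s) vol" for \<xi>s Ys
    by (simp_all add: tensor_apply fun_eq_iff fun_apply mult.commute)
  then have s: "?s \<in> elw_sections E"
    using v forms_fscale[OF form_smooth[OF v] v] by (simp add: elw_sections_def forms_def)
  have nz: "\<exists>z. ?s z p \<noteq> 0" for p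
  proof -
    obtain Ys where "vol Ys p \<noteq> 0" using volume_formD(2)[OF vol] by blast
    then show ?thesis by (intro exI[of _ "(Ys, Ys)"]) (simp add: tensor_apply fun_apply)
  qed
  show ?thesis
    unfolding elw_modular_class_def algebroid_class_coset
  proof (rule the_equality)
    show "\<exists>s. s \<in> elw_sections E \<and> (\<forall>p. \<exists>z. s z p \<noteq> 0) \<and>
        coset (fscale (\<lambda>_. 2) (mod_Z \<pi> \<psi> vol)) = coset (elw_theta E s)"
      using s nz elw_theta_coset[OF vol s nz] by (intro exI[of _ ?s]) simp
  qed (use elw_theta_coset[OF vol] in blast)
qed

text \<open>Doubling a representative doubles the function f that relates it to Z, and halving
  inverts this.\<close>

lemma coset_double:
  assumes Z: "Z \<in> vfields"
  shows "coset Z = class_scale (1 / 2) (coset (fscale (\<lambda>_. 2) Z))"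
proof -
  have half: "\<xi> [fscale (\<lambda>_. c) Y] = (\<lambda>_. c) * \<xi> [Y]" if "\<xi> \<in> forms 1" "Y \<in> vfields" for \<xi> Y c
    using that by (simp add: form1_scale)
  show ?thesis
  proof
    show "coset Z \<subseteq> class_scale (1 / 2) (coset (fscale (\<lambda>_. 2) Z))"
    proof
      fix Y assume "Y \<in> coset Z"
      then obtain f where Y: "Y \<in> vfields" and f: "f \<in> smooth_funs" "\<forall>\<xi>\<in>forms 1. \<xi> [Y] = \<xi> [Z] + sharp \<pi> \<xi> f"
        unfolding coset_def by blast
      have "fscale (\<lambda>_. 2) Y \<in> coset (fscale (\<lambda>_. 2) Z)"
        unfolding coset_def using Y f Z
        by (auto intro!: bexI[of _ "\<lambda>p. 2 * f p"] simp: half vfield_cmult) (simp add: fun_eq_iff fun_apply distrib_left)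
      moreover have "Y = fscale (\<lambda>_. 1 / 2) (fscale (\<lambda>_. 2) Y)" by (simp add: fun_eq_iff fun_apply)
      ultimately show "Y \<in> class_scale (1 / 2) (coset (fscale (\<lambda>_. 2) Z))"
        unfolding class_scale_def by (metis image_eqI)
    qed
    show "class_scale (1 / 2) (coset (fscale (\<lambda>_. 2) Z)) \<subseteq> coset Z"
    proof
      fix Y assume "Y \<in> class_scale (1 / 2) (coset (fscale (\<lambda>_. 2) Z))"
      then obtain \<eta> f where Y: "Y = fscale (\<lambda>_. 1 / 2) \<eta>" and \<eta>: "\<eta> \<in> vfields" and f: "f \<in> smooth_funs"
        and eq: "\<forall>\<xi>\<in>forms 1. \<xi> [\<eta>] = \<xi> [fscale (\<lambda>_. 2) Z] + sharp \<pi> \<xi> f"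
        unfolding coset_def class_scale_def by blast
      let ?h = "\<lambda>p. 1 / 2 * f p"
      have "?h \<in> smooth_funs" by (rule smooth_cmult[OF f])
      moreover have "\<xi> [Y] = \<xi> [Z] + sharp \<pi> \<xi> ?h" if \<xi>: "\<xi> \<in> forms 1" for \<xi>
        unfolding vfield_cmult[OF sharp_vfield[OF \<xi>] f] Y
        using eq \<xi> Z \<eta> by (auto simp: half fun_eq_iff fun_apply)
      moreover have "Y \<in> vfields" unfolding Y using \<eta> by simp
      ultimately show "Y \<in> coset Z" unfolding coset_def by blast
    qed
  qed
qed

end

theorem proposition7p2:
  fixes atlas :: "('m::{t2_space,second_countable_topology} set \<times> ('m \<Rightarrow> real^'n)) set"
    and \<pi> :: "'m mvector" and \<psi> :: "'m form"
  assumes "smooth_atlas atlas"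
    and "charted.orientable atlas"
    and "charted.twisted_poisson atlas \<pi> \<psi>"
  shows "charted.modular_class atlas \<pi> \<psi> =
    class_scale (1/2) (charted.elw_modular_class atlas (charted.cotangent_algebroid atlas \<pi> \<psi>))"
proof -
  interpret bivector_manifold atlas \<pi> \<psi>
    using assms(1,3) by unfold_locales (simp_all add: charted.twisted_poisson_def)
  obtain vol where vol: "volume_form vol" using assms(2) unfolding orientable_def by blast
  show ?thesis
    unfolding modular_class_eq[OF vol] elw_modular_class_eq[OF vol] by (rule coset_double[OF mod_Z_vfield[OF vol]])
qed

end
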